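(* Fix positive integers $I,O$, and let $N_n(i,j)$, $p_{ij}$ and the matrices $K_{IO}$ and $\Sigma_{IO}$ be as specified in the context. Provided that $K_{IO}$ is invertible, we have, as $n\to\infty$, the convergence in distribution $$\left(\sqrt{n}\left(\frac{N_n(i,j)}{n}-p_{ij}\right):\ 0\le i\le I,\ 0\le j\le O\right)\Rightarrow N\left(0,\;K_{IO}^{-1}\,\Sigma_{IO}\,K_{IO}^{-T}\right),$$ where $K_{IO}^{-T}=(K_{IO}^{-1})^T$ and $N(0,S)$ is the centered Gaussian law with covariance matrix $S$.
   Context: **Model.** Let $\alpha,\gamma,\lambda,\mu$ be strictly positive with $\alpha+\gamma=1$ and $\alpha,\gamma<1$. Random directed graphs $G_n$ with node set $V_n=\{1,\dots,n\}$, $n\ge1$, are grown as follows. $G_1$ is a single node, labeled $1$, with a self-loop, so its in-degree and out-degree are both $1$. For $v\in V_n$ let $D_n(v)=(D_{in}(v),D_{out}(v))$ be its in- and out-degree in $G_n$. Given $G_n$, the graph $G_{n+1}$ is obtained as follows: (i) with probability $\alpha$, a new node $n+1$ is born and an edge is added from it to an existing node, where $v\in V_n$ is chosen with probability $\frac{D_{in}(v)+\lambda}{(1+\lambda)n}$; (ii) with probability $\gamma$, a new node $n+1$ is born and an edge is added from an existing node to it, where $v\in V_n$ is chosen with probability $\frac{D_{out}(v)+\mu}{(1+\mu)n}$. Let $\mathcal F_n$ be the $\sigma$-field of information from watching the graph grow until stage $n$. **Counts and limits.** $N_n(i,j)=\sum_{v\in V_n}\mathbf 1_{\{D_n(v)=(i,j)\}}$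 is the number of nodes of $G_n$ with in-degree $i$ and out-degree $j$, and $\nu_n(i,j)=E[N_n(i,j)]$. Put $$c_1=\frac{\alpha}{1+\lambda},\quad c_2=\frac{\gamma}{1+\mu},\quad \delta_{ij}=c_1(i+\lambda)+c_2(j+\mu).$$ The constants $p_{ij}$ are the almost sure limits of $N_n(i,j)/n$. They satisfy, with $p_{ij}=0$ if $i$ or $j$ is $-1$, $$p_{ij}=\alpha\mathbf 1_{\{(i,j)=(0,1)\}}+\gamma\mathbf 1_{\{(i,j)=(1,0)\}}+c_1(i-1+\lambda)p_{i-1,j}+c_2(j-1+\mu)p_{i,j-1}-\delta_{ij}p_{ij}.$$ **Coefficients and martingales.** For each $(i,j)$, non-random constants $b^{(i,j)}_{k,l,n}$ ($0\le k\le i$, $0\le l\le j$, $n\ge1$) are given by $b^{(i,j)}_{k,l,1}=1$ and, for $n\ge 1$, $$b^{(i,j)}_{k,l,n+1}\Bigl(1-\frac{\delta_{kl}}{n}\Bigr)+b^{(i,j)}_{k+1,l,n+1}\frac{c_1(k+\lambda)}{n}+b^{(i,j)}_{k,l+1,n+1}\frac{c_2(l+\mu)}{n}=b^{(i,j)}_{k,l,n},$$ with $b^{(i,j)}_{k,l,n}=0$ if $k=i+1$ or $l=j+1$; in particular $b^{(i,j)}_{i,j,n+1}=\prod_{m=1}^n(1-\delta_{ij}/m)^{-1}$. Then $$M_n(i,j)=\sum_{l=0}^{j}\sum_{k=0}^{i}b^{(i,j)}_{k,l,n}\bigl(N_n(k,l)-\nu_n(k,l)\bigr)$$ is a martingale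 in $n$. **The constants $\xi$.** Let $\xi^{(i,j)}_{kl}=\lim_{n\to\infty}b^{(i,j)}_{k,l,n+1}/b^{(i,j)}_{i,j,n+1}$, which are given by $\xi^{(i,j)}_{ij}=1$, $$\xi^{(i,j)}_{kj}=(-1)^{i-k}\prod_{d=k}^{i-1}\frac{\lambda+d}{i-d}\ (0\le k\le i-1),\qquad \xi^{(i,j)}_{il}=(-1)^{j-l}\prod_{r=l}^{j-1}\frac{\mu+r}{j-r}\ (0\le l\le j-1),$$ $$\xi^{(i,j)}_{kl}=-\left[\frac{c_1(k+\lambda)}{\delta_{ij}-\delta_{kl}}\xi^{(i,j)}_{k+1,l}+\frac{c_2(l+\mu)}{\delta_{ij}-\delta_{kl}}\xi^{(i,j)}_{k,l+1}\right]\quad(0\le k\le i-1,\ 0\le l\le j-1),$$ except that one sets $\xi^{(i,j)}_{00}=0$ for $(i,j)\ne(0,0)$; and $\xi^{(i,j)}_{kl}=0$ if $k>i$ or $l>j$. **The matrix $K_{IO}$.** Rows and columns are indexed by pairs in $\{0,\dots,I\}\times\{0,\dots,O\}$ in a fixed order. $K_{IO}$ is the matrix for which, with $o_p(1)$ terms dropped, $$\Bigl(\frac{M_n(i,j)}{n^{\delta_{ij}+1/2}};\,0\le i\le I,\,0\le j\le O\Bigr)=K_{IO}\Bigl(\frac{N_n(k,l)-\nu_n(k,l)}{\sqrt n}:\,0\le k\le I,\,0\le l\le O\Bigr)^T,$$ that is, its entry in row $(i,j)$ and column $(k,l)$ is $\Gamma(1-\delta_{ij})\,\xi^{(i,j)}_{kl}$,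 where $\Gamma$ is the gamma function. **The matrix $\Sigma_{IO}$.** Put $$a(i,j)=\sum_{l=0}^j\sum_{k=0}^i p_{kl}\bigl(\delta_{kl}\xi^{(i,j)}_{kl}-c_1(k+\lambda)\xi^{(i,j)}_{k+1,l}-c_2(l+\mu)\xi^{(i,j)}_{k,l+1}\bigr)-\bigl(\alpha\xi^{(i,j)}_{01}+\gamma\xi^{(i,j)}_{10}\bigr),\qquad e(i,j)=\sum_{l=0}^j\sum_{k=0}^i\xi^{(i,j)}_{kl}p_{kl},$$ $$A(i,j,s,t)=a(i,j)a(s,t)+a(i,j)e(s,t)+a(s,t)e(i,j),$$ $$\begin{aligned}B(i,j,s,t)=&\,(\alpha+c_1\lambda p_{01})\xi^{(i,j)}_{01}\xi^{(s,t)}_{01}+(\gamma+c_2\mu p_{10})\xi^{(i,j)}_{10}\xi^{(s,t)}_{10}\\ &+\sum_{q=0}^\infty\sum_{r=0}^\infty\Bigl\{c_1(r-1+\lambda)p_{r-1,q}\bigl(\xi^{(i,j)}_{rq}+\xi^{(i,j)}_{01}-\xi^{(i,j)}_{r-1,q}\bigr)\bigl(\xi^{(s,t)}_{rq}+\xi^{(s,t)}_{01}-\xi^{(s,t)}_{r-1,q}\bigr)\\ &\quad+c_2(q-1+\mu)p_{r,q-1}\bigl(\xi^{(i,j)}_{rq}+\xi^{(i,j)}_{10}-\xi^{(i,j)}_{r,q-1}\bigr)\bigl(\xi^{(s,t)}_{rq}+\xi^{(s,t)}_{10}-\xi^{(s,t)}_{r,q-1}\bigr)\\ &\quad+c_1(r+\lambda)p_{rq}\bigl(\xi^{(i,j)}_{r+1,q}+\xi^{(i,j)}_{01}-\xi^{(i,j)}_{rq}\bigr)\bigl(\xi^{(s,t)}_{r+1,q}+\xi^{(s,t)}_{01}-\xi^{(s,t)}_{rq}\bigr)\\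 &\quad+c_2(q+\mu)p_{rq}\bigl(\xi^{(i,j)}_{r,q+1}+\xi^{(i,j)}_{10}-\xi^{(i,j)}_{rq}\bigr)\bigl(\xi^{(s,t)}_{r,q+1}+\xi^{(s,t)}_{10}-\xi^{(s,t)}_{rq}\bigr)\Bigr\}\end{aligned}$$ (terms with $p_{-1,q}$ or $p_{r,-1}$ are zero), and $$C(i,j,s,t)=A(i,j,s,t)+B(i,j,s,t),\qquad \tau(i,j,s,t)=\frac{C(i,j,s,t)}{\Gamma(1-\delta_{ij})\Gamma(1-\delta_{st})},\qquad \sigma^2(i,j,s,t)=\frac{\tau(i,j,s,t)}{1+\delta_{ij}+\delta_{st}}.$$ Then $\Sigma_{IO}=(\sigma^2(i,j,s,t))$, with $0\le i,s\le I$, $0\le j,t\le O$, has entry $\sigma^2(i,j,s,t)$ in row $(i,j)$ and column $(s,t)$. It is obtained as the limit as $n\to\infty$ of the matrix of conditional covariances $$V_n(i,j,s,t)=\sum_{m=\max(I,O)+1}^{n}n^{-(\delta_{ij}+\delta_{st}+1)}E\bigl[(M_m(i,j)-M_{m-1}(i,j))(M_m(s,t)-M_{m-1}(s,t))\,\big|\,\mathcal F_{m-1}\bigr].$$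
   Formalization: As δ_11=1 always, Γ(1−δ_11) is undefined: b is set to 1 at a free stage n0≥1, so Γ(1−δ_ij) becomes Γ(n0−δ_ij)/Γ(n0) in K and Σ; τ is C times, not divided by, these factors; B keeps only its last two sum lines, so each transition counts once. *)

theory Defs
  imports "HOL-Probability.Probability" "Graph_Theory.Pair_Digraph"
begin

section \<open>Convergence in distribution and centered Gaussian laws on a Euclidean space\<close>

definition converges_in_distribution ::
  "'w measure \<Rightarrow> (nat \<Rightarrow> 'w \<Rightarrow> 'b::euclidean_space) \<Rightarrow> 'b measure \<Rightarrow> bool" where
  "converges_in_distribution M X N \<longleftrightarrow>
     (\<forall>f :: 'b \<Rightarrow> real. continuous_on UNIV f \<and> bounded (range f) \<longrightarrow>
        (\<lambda>n. \<integral>\<omega>. f (X n \<omega>) \<partial>M) \<longlonglongrightarrow> (\<integral>x. f x \<partial>N))"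

definition normal_law :: "real \<Rightarrow> real measure" where
  "normal_law v = (if v = 0 then return borel 0
                   else density lborel (\<lambda>x. ennreal (normal_density 0 (sqrt v) x)))"

text \<open>
  \<open>N\<close> is the law \<open>N(0, S)\<close>: every linear functional is normally distributed with the variance
  prescribed by \<open>S\<close>.  The matrix \<open>S\<close> may be singular, and it is singular in the application: every
  node has at least one incident edge, so the coordinate \<open>(0,0)\<close> vanishes identically.
\<close>

definition centered_gaussian :: "real^'n^'n \<Rightarrow> (real^'n) measure \<Rightarrow> bool" where
  "centered_gaussian S N \<longleftrightarrow>
     prob_space N \<and> sets N = sets borel \<and> transpose S = S \<and>
     (\<forall>t. 0 \<le> t \<bullet> (S *v t) \<and> distr N borel (\<lambda>x. t \<bullet> x) = normal_law (t \<bullet> (S *v t)))"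


section \<open>The growing random graph\<close>

definition history :: "'w measure \<Rightarrow> (nat \<Rightarrow> 'w \<Rightarrow> 'g) \<Rightarrow> nat \<Rightarrow> 'w measure" where
  "history M G n = sigma (space M) {G m -` A \<inter> space M | m A. m \<in> {1..n}}"

text \<open>
  Apart from the initial self-loop, each edge joins a new node to an older one.  Parallel edges
  therefore never occur, and a graph is a set of nodes together with a set of ordered pairs, the
  pair \<open>(u, v)\<close> being an edge from \<open>u\<close> to \<open>v\<close>.  The graph \<open>G 0\<close> plays no role.
\<close>

locale directed_pa = prob_space M
  for M :: "'w measure" +
  fixes \<alpha> \<gamma> lam mu :: real
    and G :: "nat \<Rightarrow> 'w \<Rightarrow> nat pair_pre_digraph"
  assumes params_pos: "0 < \<alpha>" "0 < \<gamma>" "0 < lam" "0 < mu"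
    and params_sum: "\<alpha> + \<gamma> = 1" "\<alpha> < 1" "\<gamma> < 1"
    and measurable_G: "\<And>n. 1 \<le> n \<Longrightarrow> G n \<in> measurable M (count_space UNIV)"
    and nodes_G: "\<And>n \<omega>. 1 \<le> n \<Longrightarrow> \<omega> \<in> space M \<Longrightarrow>
          pverts (G n \<omega>) = {1..n} \<and> parcs (G n \<omega>) \<subseteq> {1..n} \<times> {1..n}"
    and initial_G: "\<And>\<omega>. \<omega> \<in> space M \<Longrightarrow> G 1 \<omega> = \<lparr>pverts = {1}, parcs = {(1, 1)}\<rparr>"
    and step_from_new: "\<And>n v. 1 \<le> n \<Longrightarrow> v \<in> {1..n} \<Longrightarrow>
          AE \<omega> in M. real_cond_exp M (history M G n)
              (indicator {\<omega> \<in> space M.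
                 G (Suc n) \<omega> = \<lparr>pverts = {1..Suc n}, parcs = insert (Suc n, v) (parcs (G n \<omega>))\<rparr>}) \<omega>
            = \<alpha> * ((real (in_degree (with_proj (G n \<omega>)) v) + lam) / ((1 + lam) * real n))"
    and step_to_new: "\<And>n v. 1 \<le> n \<Longrightarrow> v \<in> {1..n} \<Longrightarrow>
          AE \<omega> in M. real_cond_exp M (history M G n)
              (indicator {\<omega> \<in> space M.
                 G (Suc n) \<omega> = \<lparr>pverts = {1..Suc n}, parcs = insert (v, Suc n) (parcs (G n \<omega>))\<rparr>}) \<omega>
            = \<gamma> * ((real (out_degree (with_proj (G n \<omega>)) v) + mu) / ((1 + mu) * real n))"
begin

definition N :: "nat \<Rightarrow> nat \<Rightarrow> nat \<Rightarrow> 'w \<Rightarrow> real" where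
  "N n i j \<omega> = real (card {v \<in> {1..n}. in_degree (with_proj (G n \<omega>)) v = i
                                      \<and> out_degree (with_proj (G n \<omega>)) v = j})"

definition nu :: "nat \<Rightarrow> nat \<Rightarrow> nat \<Rightarrow> real" where
  "nu n i j = expectation (N n i j)"

definition p :: "nat \<Rightarrow> nat \<Rightarrow> real" where
  "p i j = (THE x. AE \<omega> in M. (\<lambda>n. N n i j \<omega> / real n) \<longlonglongrightarrow> x)"

definition c1 :: real where "c1 = \<alpha> / (1 + lam)"

definition c2 :: real where "c2 = \<gamma> / (1 + mu)"

definition \<delta> :: "nat \<Rightarrow> nat \<Rightarrow> real" where
  "\<delta> i j = c1 * (real i + lam) + c2 * (real j + mu)"


subsection \<open>The martingales\<close>

text \<open>
  The coefficients \<open>b\<close> are normalized to be \<open>1\<close> at a stage \<open>n0 \<ge> 1\<close>; from there on they follow the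
  backward-in-degree recursion
  \<open>b k l (n+1) (1 - \<delta> k l / n) + b (k+1) l (n+1) c1 (k + lam) / n + b k (l+1) (n+1) c2 (l + mu) / n
     = b k l n\<close>, solved here for \<open>b k l (n+1)\<close>.

  Usually one takes \<open>n0 = 1\<close>.  But \<open>\<delta> 1 1 = \<alpha> + \<gamma> = 1\<close> for all parameter values, so with
  \<open>n0 = 1\<close> the recursion divides by zero and \<open>Gamma (1 - \<delta> 1 1)\<close> sits at a pole (where HOL sets
  \<open>Gamma\<close> to \<open>0\<close>).  Keeping \<open>n0\<close> free includes that case verbatim and also provides
  normalizations without poles: \<open>\<delta> i j \<le> max Imax Omax\<close> for \<open>i \<le> Imax\<close>, \<open>j \<le> Omax\<close>, so any
  \<open>n0 > max Imax Omax\<close> will do.  The limit law does not depend on \<open>n0\<close>.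
\<close>

function b :: "nat \<Rightarrow> nat \<Rightarrow> nat \<Rightarrow> nat \<Rightarrow> nat \<Rightarrow> nat \<Rightarrow> real" where
  "b n0 i j k l n =
     (if i < k \<or> j < l then 0
      else if n \<le> n0 \<or> n = 0 then 1
      else (b n0 i j k l (n - 1)
              - b n0 i j (k + 1) l n * (c1 * (real k + lam) / real (n - 1))
              - b n0 i j k (l + 1) n * (c2 * (real l + mu) / real (n - 1)))
           / (1 - \<delta> k l / real (n - 1)))"
  by pat_completeness auto
termination
  by (relation "Wellfounded.measure (\<lambda>(n0, i, j, k, l, n). n + (Suc i - k) + (Suc j - l))") auto

declare b.simps [simp del]

definition Mart :: "nat \<Rightarrow> nat \<Rightarrow> nat \<Rightarrow> nat \<Rightarrow> 'w \<Rightarrow> real" where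
  "Mart n0 i j n \<omega> = (\<Sum>l=0..j. \<Sum>k=0..i. b n0 i j k l n * (N n k l \<omega> - nu n k l))"

definition V :: "nat \<Rightarrow> nat \<Rightarrow> nat \<Rightarrow> nat \<Rightarrow> nat \<Rightarrow> nat \<Rightarrow> nat \<Rightarrow> nat \<Rightarrow> 'w \<Rightarrow> real" where
  "V n0 Imax Omax i j s t n \<omega> =
     (\<Sum>m \<in> {max Imax Omax + 1..n}. real n powr (- (\<delta> i j + \<delta> s t + 1)) *
        real_cond_exp M (history M G (m - 1))
          (\<lambda>\<omega>. (Mart n0 i j m \<omega> - Mart n0 i j (m - 1) \<omega>) *
                (Mart n0 s t m \<omega> - Mart n0 s t (m - 1) \<omega>)) \<omega>)"


subsection \<open>The matrices\<close>

text \<open>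
  \<open>\<xi> i j k l\<close> is the limit of \<open>b n0 i j k l n / b n0 i j i j n\<close>, except that
  \<open>\<xi> i j 0 0 = 0\<close> for \<open>(i, j) \<noteq> (0, 0)\<close>.
\<close>

function \<xi> :: "nat \<Rightarrow> nat \<Rightarrow> nat \<Rightarrow> nat \<Rightarrow> real" where
  "\<xi> i j k l =
     (if i < k \<or> j < l then 0
      else if k = i \<and> l = j then 1
      else if k = 0 \<and> l = 0 then 0
      else if l = j then (- 1) ^ (i - k) * (\<Prod>d = k..<i. (lam + real d) / (real i - real d))
      else if k = i then (- 1) ^ (j - l) * (\<Prod>r = l..<j. (mu + real r) / (real j - real r))
      else - (c1 * (real k + lam) / (\<delta> i j - \<delta> k l) * \<xi> i j (k + 1) l
            + c2 * (real l + mu) / (\<delta> i j - \<delta> k l) * \<xi> i j k (l + 1)))"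
  by pat_completeness auto
termination
  by (relation "Wellfounded.measure (\<lambda>(i, j, k, l). (Suc i - k) + (Suc j - l))") auto

declare \<xi>.simps [simp del]

text \<open>
  The limit of \<open>b n0 i j i j n / n powr \<delta> i j\<close>, where
  \<open>b n0 i j i j n\<close> is the product of the \<open>1 / (1 - \<delta> i j / m)\<close> over \<open>n0 \<le> m < n\<close>; it equals
  \<open>Gamma (1 - \<delta> i j)\<close> for \<open>n0 = 1\<close>.
\<close>

definition g :: "nat \<Rightarrow> nat \<Rightarrow> nat \<Rightarrow> real" where
  "g n0 i j = Gamma (real n0 - \<delta> i j) / Gamma (real n0)"

definition a :: "nat \<Rightarrow> nat \<Rightarrow> real" where
  "a i j = (\<Sum>l=0..j. \<Sum>k=0..i. p k l *
              (\<delta> k l * \<xi> i j k l - c1 * (real k + lam) * \<xi> i j (k + 1) l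
                                 - c2 * (real l + mu) * \<xi> i j k (l + 1)))
           - (\<alpha> * \<xi> i j 0 1 + \<gamma> * \<xi> i j 1 0)"

definition e :: "nat \<Rightarrow> nat \<Rightarrow> real" where
  "e i j = (\<Sum>l=0..j. \<Sum>k=0..i. \<xi> i j k l * p k l)"

definition A :: "nat \<Rightarrow> nat \<Rightarrow> nat \<Rightarrow> nat \<Rightarrow> real" where
  "A i j s t = a i j * a s t + a i j * e s t + a s t * e i j"

text \<open>
  The limiting conditional mean of the product of the increments of
  \<open>\<Sum> \<xi> i j k l * N n k l\<close> and \<open>\<Sum> \<xi> s t k l * N n k l\<close>.  A node of degree \<open>(r, q)\<close> becomes a node
  of degree \<open>(r+1, q)\<close> while a node of degree \<open>(0, 1)\<close> is born, or it becomes a node of degree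
  \<open>(r, q+1)\<close> while a node of degree \<open>(1, 0)\<close> is born; each transition is counted once.  (Indexing
  the transitions by the degree after instead of before the change gives the same two sums, shifted
  by one; they must not be added a second time.)
\<close>

definition B :: "nat \<Rightarrow> nat \<Rightarrow> nat \<Rightarrow> nat \<Rightarrow> real" where
  "B i j s t = (\<Sum>q. \<Sum>r.
       c1 * (real r + lam) * p r q * (\<xi> i j (r + 1) q + \<xi> i j 0 1 - \<xi> i j r q)
                                   * (\<xi> s t (r + 1) q + \<xi> s t 0 1 - \<xi> s t r q)
     + c2 * (real q + mu) * p r q * (\<xi> i j r (q + 1) + \<xi> i j 1 0 - \<xi> i j r q)
                                  * (\<xi> s t r (q + 1) + \<xi> s t 1 0 - \<xi> s t r q))"

definition C :: "nat \<Rightarrow> nat \<Rightarrow> nat \<Rightarrow> nat \<Rightarrow> real" where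
  "C i j s t = A i j s t + B i j s t"

text \<open>
  Since \<open>Mart n0 i j n / n powr (\<delta> i j)\<close> carries the factor \<open>g n0 i j\<close>, its covariances
  carry the product of two such factors (not its reciprocal).
\<close>

definition \<tau> :: "nat \<Rightarrow> nat \<Rightarrow> nat \<Rightarrow> nat \<Rightarrow> nat \<Rightarrow> real" where
  "\<tau> n0 i j s t = C i j s t * (g n0 i j * g n0 s t)"

definition \<sigma>2 :: "nat \<Rightarrow> nat \<Rightarrow> nat \<Rightarrow> nat \<Rightarrow> nat \<Rightarrow> real" where
  "\<sigma>2 n0 i j s t = \<tau> n0 i j s t / (1 + \<delta> i j + \<delta> s t)"

text \<open>
  The type \<open>'n\<close> indexes rows and columns; \<open>idx\<close> enumerates the pairs \<open>(i, j)\<close>, \<open>i \<le> Imax\<close>, \<open>j \<le> Omax\<close>.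
\<close>

definition K :: "nat \<Rightarrow> ('n \<Rightarrow> nat \<times> nat) \<Rightarrow> real^'n^'n" where
  "K n0 idx = (\<chi> u v. case idx u of (i, j) \<Rightarrow> case idx v of (k, l) \<Rightarrow> g n0 i j * \<xi> i j k l)"

definition Sig :: "nat \<Rightarrow> ('n \<Rightarrow> nat \<times> nat) \<Rightarrow> real^'n^'n" where
  "Sig n0 idx = (\<chi> u v. case idx u of (i, j) \<Rightarrow> case idx v of (s, t) \<Rightarrow> \<sigma>2 n0 i j s t)"

definition normalized_counts :: "('n \<Rightarrow> nat \<times> nat) \<Rightarrow> nat \<Rightarrow> 'w \<Rightarrow> real^'n" where
  "normalized_counts idx n \<omega> =
     (\<chi> u. case idx u of (i, j) \<Rightarrow> sqrt (real n) * (N n i j \<omega> / real n - p i j))"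

end

end

theory Submission
  imports Defs "HOL-Real_Asymp.Real_Asymp" "HOL-Library.Discrete_Functions"
begin

text \<open>
  Write the counts as degree sums: \<open>deg_sum f n\<close> adds \<open>f (in-degree) (out-degree)\<close> over the vertices.  One
  step of the growth changes such a sum by a jump that depends only on the degree of the chosen
  vertex, so its conditional mean and covariances are again degree sums divided by \<open>n\<close>.  The backward
  recursion for \<open>b\<close> says exactly that the increment of \<open>Mart\<close> is such a jump minus its conditional mean.

  Second moments of the centered counts grow linearly, which gives the law of large numbers
  \<open>N n i j / n \<longlonglongrightarrow> p i j\<close>, while \<open>nu n i j - n * p i j\<close> stays bounded.  Since \<open>b\<close> grows like
  \<open>g * \<xi> * n powr \<delta>\<close>, the conditional covariances converge; here the infinite sums in \<open>B\<close> are evaluated by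
  showing that \<open>p\<close> loses no mass and no mean degree.  As \<open>p\<close> is stationary, \<open>a = - e\<close>, and \<open>C\<close> is the
  covariance of the limiting jumps.

  The rescaled martingales have increments \<open>O(n powr (-1/2))\<close>, so characteristic functions yield a Gaussian
  limit for each of their linear combinations.  Multiplying the counts by \<open>K\<close> turns them into the
  martingales up to an error that vanishes in the mean; invertibility of \<open>K\<close> transfers the limit back.
\<close>

text \<open>Invertibility of \<open>K\<close> acts twice. A zero of \<open>g n0 i j\<close> would
  make a row of \<open>K\<close> vanish, so every \<open>g\<close> on the index rectangle is
  nonzero; as \<open>Gamma\<close> is 0 at its poles, this also keeps every denominator
  \<open>1 - \<delta> k l / m\<close> with \<open>m >= n0\<close> away from 0, and only then does
  the solved form of \<open>b\<close> satisfy the backward recursion. \<open>p\<close> is defined as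
  an almost sure limit, so nothing is known about it before that limit exists; the solution
  \<open>pl\<close> of the recursion serves as the candidate. Passing to the limit bounds mass and
  mean degrees only from above, while the infinite sums in \<open>B\<close> need equality. The model
  prescribes the conditional probabilities of \<open>2 * n\<close> transitions but not that nothing
  else happens. That they exhaust the space follows from the total degrees, and the two facts are
  proved in one induction. Degree \<open>(0, 0)\<close> is exceptional: \<open>\<xi>\<close> is 0
  there by convention, whatever the limit of \<open>b\<close>. Positive semidefiniteness of the
  limiting covariance is read off from the characteristic functions, which are bounded by 1.\<close>

section \<open>Growth of sums with power weights\<close>

lemma Stolz_Cesaro:
  fixes x B :: "nat \<Rightarrow> real"
  assumes "strict_mono B" "filterlim B at_top sequentially"
    and lim: "(\<lambda>n. (x (Suc n) - x n) / (B (Suc n) - B n)) \<longlonglongrightarrow> L"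
  shows "(\<lambda>n. x n / B n) \<longlonglongrightarrow> L"
proof (rule LIMSEQ_I)
  fix r :: real assume r: "0 < r"
  have incr: "B n < B (Suc n)" for n
    using assms(1) by (simp add: strict_mono_Suc_iff)
  from LIMSEQ_D[OF lim, of "r/2"] r obtain n0 where
    n0: "\<And>n. n \<ge> n0 \<Longrightarrow> \<bar>(x (Suc n) - x n) / (B (Suc n) - B n) - L\<bar> < r/2" by auto
  have stp: "\<bar>(x (Suc n) - x n) - L * (B (Suc n) - B n)\<bar> \<le> r/2 * (B (Suc n) - B n)" if "n \<ge> n0" for n
  proof -
    have d: "B (Suc n) - B n > 0" using incr by simp
    have "(x (Suc n) - x n) - L * (B (Suc n) - B n) = ((x (Suc n) - x n) / (B (Suc n) - B n) - L) * (B (Suc n) - B n)"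
      using d by (simp add: field_simps)
    then have "\<bar>(x (Suc n) - x n) - L * (B (Suc n) - B n)\<bar> = \<bar>(x (Suc n) - x n) / (B (Suc n) - B n) - L\<bar> * (B (Suc n) - B n)"
      using d by (simp add: abs_mult)
    then show ?thesis using n0[OF that] d by (auto intro!: mult_right_mono)
  qed
  have tel: "\<bar>(x n - x n0) - L * (B n - B n0)\<bar> \<le> r/2 * (B n - B n0)" if "n \<ge> n0" for n
    using that
  proof (induction n rule: dec_induct)
    case (step n)
    have "(x (Suc n) - x n0) - L * (B (Suc n) - B n0) =
        ((x n - x n0) - L * (B n - B n0)) + ((x (Suc n) - x n) - L * (B (Suc n) - B n))"
      by (simp add: algebra_simps)
    then have "\<bar>(x (Suc n) - x n0) - L * (B (Suc n) - B n0)\<bar> \<le> r/2 * (B n - B n0) + r/2 * (B (Suc n) - B n)"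
      using step.IH stp[OF step.hyps(1)] by linarith
    moreover have "r/2 * (B n - B n0) + r/2 * (B (Suc n) - B n) = r/2 * (B (Suc n) - B n0)"
      by (simp add: field_simps)
    ultimately show ?case by simp
  qed simp
  \<comment> \<open>Collects all contributions of the stage \<open>n0\<close>; from
    \<open>n1\<close> on it is less than half of \<open>r * B n\<close>.\<close>
  define c where "c = \<bar>x n0 - L * B n0\<bar> + r * \<bar>B n0\<bar> + 1"
  have "eventually (\<lambda>n. B n > 2 * c / r) sequentially"
    using assms(2) by (simp add: filterlim_at_top_dense)
  then obtain n1 where n1: "\<And>n. n \<ge> n1 \<Longrightarrow> B n > 2 * c / r" by (auto simp: eventually_sequentially)
  have c: "c > 0" unfolding c_def using r by (simp add: add_nonneg_pos)
  show "\<exists>no. \<forall>n\<ge>no. norm (x n / B n - L) < r"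
  proof (intro exI allI impI)
    fix n assume n: "n \<ge> max n0 n1"
    have B: "B n > 2 * c / r" using n1 n by simp
    have "2 * c / r > 0" using c r by simp
    then have Bp: "B n > 0" using B by linarith
    have Bc: "2 * c < r * B n" using B r by (simp add: field_simps)
    have t: "\<bar>(x n - x n0) - L * (B n - B n0)\<bar> \<le> r/2 * (B n - B n0)" using tel n by simp
    have "\<bar>x n - L * B n\<bar> \<le> \<bar>x n0 - L * B n0\<bar> + r/2 * (B n - B n0)"
    proof -
      have "x n - L * B n = (x n0 - L * B n0) + ((x n - x n0) - L * (B n - B n0))"
        by (simp add: algebra_simps)
      then show ?thesis using t by linarith
    qed
    also have "\<dots> \<le> \<bar>x n0 - L * B n0\<bar> + r/2 * B n + r * \<bar>B n0\<bar>"
    proof -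
      have "- (r / 2 * B n0) \<le> r * \<bar>B n0\<bar>" 
      proof -
        have "- (B n0 / 2) \<le> \<bar>B n0\<bar>" by linarith
        from mult_left_mono[OF this, of r] r show ?thesis by simp
      qed
      then show ?thesis by (simp add: algebra_simps)
    qed
    also have "\<dots> < c + r/2 * B n" unfolding c_def by simp
    also have "\<dots> < r * B n" using Bc by simp
    finally have "\<bar>x n - L * B n\<bar> < r * B n" .
    moreover have "x n / B n - L = (x n - L * B n) / B n" using Bp by (simp add: field_simps)
    ultimately show "norm (x n / B n - L) < r" using Bp by (simp add: abs_divide divide_less_eq)
  qed
qed

text \<open>Stolz-Cesaro against \<open>n powr k\<close>, whose increments are about
  \<open>k * n powr (k - 1)\<close>. The divisor \<open>k\<close> is the origin of both
  \<open>1 + \<delta> i j + \<delta> s t\<close> in \<open>\<sigma>2\<close> and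
  \<open>\<delta> i j - \<delta> k l\<close> in \<open>\<xi>\<close>.\<close>

lemma powr_weighted_sum_limit:
  fixes q :: "nat \<Rightarrow> real"
  assumes k: "k > 0" and lim: "(\<lambda>m. q m / real m powr (k - 1)) \<longlonglongrightarrow> L"
  shows "(\<lambda>n. real n powr - k * (\<Sum>m=a..n. q m)) \<longlonglongrightarrow> L / k"
proof -
  have "(\<lambda>n. (\<Sum>m=a..n. q m) / real n powr k) \<longlonglongrightarrow> L / k"
  proof (rule Stolz_Cesaro)
    show "strict_mono (\<lambda>n. real n powr k)"
      using k by (auto simp: strict_mono_def intro!: powr_less_mono2)
    show "filterlim (\<lambda>n. real n powr k) at_top sequentially"
      using k by real_asymp
    have "(\<lambda>n. q (Suc n) / real (Suc n) powr (k - 1)) \<longlonglongrightarrow> L"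
      using lim by (rule LIMSEQ_Suc)
    moreover have "(\<lambda>n. real (Suc n) powr (k - 1) / (real (Suc n) powr k - real n powr k)) \<longlonglongrightarrow> inverse k"
      using k by real_asymp
    ultimately have "(\<lambda>n. q (Suc n) / real (Suc n) powr (k - 1) *
        (real (Suc n) powr (k - 1) / (real (Suc n) powr k - real n powr k))) \<longlonglongrightarrow> L * inverse k"
      by (rule tendsto_mult)
    moreover have "eventually (\<lambda>n. q (Suc n) / real (Suc n) powr (k - 1) *
        (real (Suc n) powr (k - 1) / (real (Suc n) powr k - real n powr k))
       = ((\<Sum>m=a..Suc n. q m) - (\<Sum>m=a..n. q m)) / (real (Suc n) powr k - real n powr k)) sequentially"
      using eventually_ge_at_top[of a] by eventually_elim auto
    ultimately show "(\<lambda>n. ((\<Sum>m=a..Suc n. q m) - (\<Sum>m=a..n. q m)) / (real (Suc n) powr k - real n powr k)) \<longlonglongrightarrow> L / k"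
      unfolding divide_inverse[of L] by (rule Lim_transform_eventually)
  qed
  then show ?thesis by (simp add: powr_minus_divide mult.commute)
qed

lemma iexp_integrable:
  fixes h :: "'a \<Rightarrow> real"
  assumes "finite_measure M" "h \<in> borel_measurable M"
  shows "integrable M (\<lambda>x. iexp (h x))"
proof -
  interpret finite_measure M by fact
  show ?thesis using assms(2) by (intro integrable_const_bound[where B=1]) auto
qed

subsection \<open>Centered Gaussian laws\<close>

lemma normal_law_char: 
  assumes "v \<ge> 0"
  shows "real_distribution (normal_law v)" "char (normal_law v) s = exp (- (s^2 * v / 2))"
proof -
  have "real_distribution (normal_law v) \<and> char (normal_law v) s = exp (- (s^2 * v / 2))"
  proof (cases "v = 0")
    case True
    have "prob_space (return borel (0::real))" by (rule prob_space_return) simp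
    then have "real_distribution (return borel (0::real))"
      by (simp add: real_distribution_def real_distribution_axioms_def)
    moreover have "char (return borel (0::real)) s = 1"
      unfolding char_def by (subst integral_return) auto
    ultimately show ?thesis using True by (simp add: normal_law_def)
  next
    case False
    then have v: "sqrt v > 0" using assms by simp
    interpret S: prob_space std_normal_distribution 
      by (intro prob_space_normal_density) simp
    have "distributed std_normal_distribution lborel (\<lambda>x::real. x) (normal_density 0 1)"
      unfolding distributed_def by (auto simp: distr_id2)
    from S.normal_density_affine[OF this, of "sqrt v" 0] v
    have d: "distributed std_normal_distribution lborel (\<lambda>x. sqrt v * x) (normal_density 0 (sqrt v))"
      by simp
    have eq: "normal_law v = distr std_normal_distribution lborel (\<lambda>x. sqrt v * x)"
      using distributed_distr_eq_density[OF d] False by (simp add: normal_law_def)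
    then have eq': "normal_law v = distr std_normal_distribution borel (\<lambda>x. sqrt v * x)"
      by (metis distr_cong sets_lborel)
    have "prob_space (normal_law v)" unfolding eq' by (rule S.prob_space_distr) simp
    then have "real_distribution (normal_law v)"
      by (simp add: real_distribution_def real_distribution_axioms_def eq')
    moreover have "char (normal_law v) s = exp (- (s^2 * v / 2))"
    proof -
    have "char (normal_law v) s = (\<integral>x. iexp (s * (sqrt v * x)) \<partial>std_normal_distribution)"
      unfolding char_def eq' by (subst integral_distr) auto
    also have "\<dots> = char std_normal_distribution (s * sqrt v)"
      unfolding char_def by (simp add: mult_ac)
    also have "\<dots> = exp (- (s^2 * v / 2))"
      using assms by (simp add: char_std_normal_distribution power_mult_distrib)
    finally show ?thesis .
    qed
    ultimately show ?thesis by simp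
  qed
  then show "real_distribution (normal_law v)" "char (normal_law v) s = exp (- (s^2 * v / 2))" by auto
qed

definition psd :: "real^'n^'n \<Rightarrow> bool" where
  "psd S \<longleftrightarrow> transpose S = S \<and> (\<forall>t. 0 \<le> t \<bullet> (S *v t))"

lemma sym_dot: "transpose S = S \<Longrightarrow> (s::real^'n) \<bullet> (S *v t) = t \<bullet> (S *v s)"
  by (metis dot_lmul_matrix inner_commute vector_transpose_matrix)

lemma psd_add_scaled:
  assumes "transpose S = (S::real^'n^'n)"
  shows "(t + c *\<^sub>R s) \<bullet> (S *v (t + c *\<^sub>R s)) = t \<bullet> (S *v t) + 2 * c * (t \<bullet> (S *v s)) + c^2 * (s \<bullet> (S *v s))"
  using sym_dot[OF assms, of s t]
  by (simp add: matrix_vector_right_distrib matrix_vector_mult_scaleR inner_add_left inner_add_right 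
      power2_eq_square algebra_simps)

lemma axis_dot: "axis i (1::real) \<bullet> (S *v axis j 1) = S $ i $ j"
  by (simp add: inner_axis' matrix_vector_mul_component inner_axis)

text \<open>Cauchy-Schwarz for a form that may be degenerate: the quadratic in \<open>c\<close>
  given by \<open>t + c *\<^sub>R s\<close> is nonnegative, in particular at its minimizer
  \<open>- ?b / ?d\<close>.\<close>

lemma psd_cauchy:
  assumes "psd S" shows "(t \<bullet> (S *v s))^2 \<le> (t \<bullet> (S *v t)) * (s \<bullet> (S *v s))"
proof -
  have S: "transpose S = S" and P: "\<And>t. 0 \<le> t \<bullet> (S *v t)" using assms by (auto simp: psd_def)
  let ?a = "t \<bullet> (S *v t)" and ?b = "t \<bullet> (S *v s)" and ?d = "s \<bullet> (S *v s)"
  have q: "0 \<le> ?a + 2 * c * ?b + c^2 * ?d" for c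
    using P[of "t + c *\<^sub>R s"] by (simp add: psd_add_scaled[OF S])
  show ?thesis
  proof (cases "?d = 0")
    case True
    have "?b = 0"
    proof (rule ccontr)
      assume b: "?b \<noteq> 0"
      \<comment> \<open>For \<open>?d = 0\<close> the quadratic is affine in \<open>c\<close>; at
        this \<open>c\<close> it would equal -1.\<close>
      from q[of "- (?a + 1) / (2 * ?b)"] True b show False by (simp add: field_simps)
    qed
    then show ?thesis using True by simp
  next
    case False
    then have d: "?d > 0" using P[of s] by simp
    from q[of "- ?b / ?d"] d have "0 \<le> ?a - ?b^2 / ?d"
      by (simp add: field_simps power2_eq_square)
    then show ?thesis using d by (simp add: field_simps)
  qed
qed

text \<open>Splitting off a rank-one summand (a Schur complement) kills one diagonal entry, so that
  finitely many independent standard normals suffice.\<close>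

lemma gaussian_char_exists:
  fixes S :: "real^'n^'n"
  assumes "psd S"
  shows "\<exists>N. prob_space N \<and> sets N = sets (borel :: (real^'n) measure) \<and>
           (\<forall>t. (\<integral>x. iexp (t \<bullet> x) \<partial>N) = exp (- (t \<bullet> (S *v t)) / 2))"
  using assms
proof (induction "card {i. S $ i $ i \<noteq> 0}" arbitrary: S rule: less_induct)
  case less
  note psdS = less.prems
  have S: "transpose S = S" and P: "\<And>t. 0 \<le> t \<bullet> (S *v t)" using less.prems by (auto simp: psd_def)
  show ?case
  proof (cases "\<exists>i. S $ i $ i \<noteq> 0")
    case False
    \<comment> \<open>A vanishing diagonal forces \<open>S = 0\<close> by Cauchy-Schwarz, and a
      point mass has the required transform.\<close>
    have "S $ i $ j = 0" for i j
      using psd_cauchy[OF psdS, of "axis i 1" "axis j 1"] False by (simp add: axis_dot)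
    then have "S = 0" by (simp add: vec_eq_iff)
    moreover have "prob_space (return borel (0::real^'n))" by (rule prob_space_return) simp
    moreover have "(\<integral>x. iexp (t \<bullet> x) \<partial>(return borel (0::real^'n))) = 1" for t
      by (subst integral_return) auto
    ultimately show ?thesis by (intro exI[of _ "return borel 0"]) auto
  next
    case True
    then obtain i where i: "S $ i $ i \<noteq> 0" by auto
    define d where "d = S $ i $ i"
    have d: "d > 0" using P[of "axis i 1"] i by (simp add: axis_dot d_def)
    \<comment> \<open>The \<open>i\<close>-th column divided by the root of its diagonal entry, so
      that subtracting \<open>w $ u * w $ v\<close> clears row and column \<open>i\<close>. That
      \<open>S'\<close> stays positive semidefinite is \<open>psd_cauchy\<close> with
      \<open>axis i 1\<close>.\<close>
    define w where "w = (1 / sqrt d) *\<^sub>R (S *v axis i 1)"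
    define S' where "S' = (\<chi> u v. S $ u $ v - w $ u * w $ v)"
    have wS: "w $ u = S $ u $ i / sqrt d" for u
      by (simp add: w_def matrix_vector_mul_component inner_axis)
    have S'v: "S' *v t = S *v t - (w \<bullet> t) *\<^sub>R w" for t
      by (simp add: vec_eq_iff S'_def matrix_vector_mult_def inner_vec_def left_diff_distrib right_diff_distrib sum_subtractf
          sum_distrib_left sum_distrib_right mult_ac)
    have quad: "t \<bullet> (S' *v t) = t \<bullet> (S *v t) - (t \<bullet> w)^2" for t
      by (simp add: S'v inner_diff_right power2_eq_square inner_commute)
    have "psd S'"
      unfolding psd_def
    proof (intro conjI allI)
      show "transpose S' = S'"
        using S by (auto simp: S'_def transpose_def vec_eq_iff mult.commute)
      fix t
      have "(t \<bullet> w)^2 = (t \<bullet> (S *v axis i 1))^2 / d" using d by (simp add: w_def power_divide)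
      also have "\<dots> \<le> t \<bullet> (S *v t)"
        using psd_cauchy[OF psdS, of t "axis i 1"] d by (simp add: axis_dot divide_le_eq flip: d_def)
      finally show "0 \<le> t \<bullet> (S' *v t)" by (simp add: quad)
    qed
    moreover have "card {j. S' $ j $ j \<noteq> 0} < card {j. S $ j $ j \<noteq> 0}"
    proof (rule psubset_card_mono)
      have "S' $ i $ i = 0" using d by (simp add: S'_def wS flip: d_def)
      moreover have "S' $ j $ j = 0" if "S $ j $ j = 0" for j
        using psd_cauchy[OF psdS, of "axis j 1" "axis i 1"] that by (simp add: S'_def wS axis_dot)
      ultimately show "{j. S' $ j $ j \<noteq> 0} \<subset> {j. S $ j $ j \<noteq> 0}" using i by blast
    qed simp
    ultimately obtain N' where N': "prob_space N'" "sets N' = sets (borel :: (real^'n) measure)"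
      and ch: "\<And>t. (\<integral>x. iexp (t \<bullet> x) \<partial>N') = exp (- (t \<bullet> (S' *v t)) / 2)"
      using less.hyps by blast
    interpret N: prob_space N' by fact
    interpret Z: prob_space std_normal_distribution by (intro prob_space_normal_density) simp
    interpret NZ: pair_prob_space N' std_normal_distribution ..
    \<comment> \<open>The law of \<open>x + z *\<^sub>R w\<close> with an independent standard
      normal \<open>z\<close>, which restores the term \<open>(t \<bullet> w)^2\<close> removed from
      the quadratic form.\<close>
    let ?N = "distr (N' \<Otimes>\<^sub>M std_normal_distribution) borel (\<lambda>(x,z). x + z *\<^sub>R w)"
    have ms[measurable]: "(\<lambda>(x,z). x + z *\<^sub>R w) \<in> borel_measurable (N' \<Otimes>\<^sub>M std_normal_distribution)"
    proof -
      have "sets (N' \<Otimes>\<^sub>M std_normal_distribution) = sets (borel \<Otimes>\<^sub>M borel)"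
        by (intro sets_pair_measure_cong) (auto simp: N'(2))
      then show ?thesis by (subst measurable_cong_sets) (auto simp: split_beta)
    qed
    show ?thesis
    proof (intro exI[of _ ?N] conjI allI)
      show "prob_space ?N" by (rule NZ.prob_space_distr) simp
      show "sets ?N = sets borel" by simp
      fix t
      have "(\<integral>x. iexp (t \<bullet> x) \<partial>?N) = (\<integral>p. iexp (t \<bullet> (case p of (x,z) \<Rightarrow> x + z *\<^sub>R w)) \<partial>(N' \<Otimes>\<^sub>M std_normal_distribution))"
        by (subst integral_distr) auto
      also have "\<dots> = (\<integral>x. \<integral>z. iexp (t \<bullet> (case (x,z) of (x,z) \<Rightarrow> x + z *\<^sub>R w)) \<partial>std_normal_distribution \<partial>N')"
      proof (rule NZ.integral_fst'[symmetric])
        have "(\<lambda>p. t \<bullet> (case p of (x,z) \<Rightarrow> x + z *\<^sub>R w)) \<in> borel_measurable (N' \<Otimes>\<^sub>M std_normal_distribution)"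
          using ms by measurable
        then show "integrable (N' \<Otimes>\<^sub>M std_normal_distribution) (\<lambda>p. iexp (t \<bullet> (case p of (x,z) \<Rightarrow> x + z *\<^sub>R w)))"
          by (intro iexp_integrable) (auto intro: NZ.finite_measure_axioms)
      qed
      also have "\<dots> = (\<integral>x. iexp (t \<bullet> x) * (\<integral>z. iexp ((t \<bullet> w) * z) \<partial>std_normal_distribution) \<partial>N')"
        by (simp add: inner_add_right distrib_left exp_add mult_ac)
      also have "\<dots> = (\<integral>x. iexp (t \<bullet> x) \<partial>N') * char std_normal_distribution (t \<bullet> w)"
        unfolding char_def by simp
      also have "\<dots> = exp (- (t \<bullet> (S *v t)) / 2)"
        by (simp only: ch quad char_std_normal_distribution flip: exp_add of_real_add of_real_mult)
          (simp add: field_simps)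
      finally show "(\<integral>x. iexp (t \<bullet> x) \<partial>?N) = exp (- (t \<bullet> (S *v t)) / 2)" .
    qed
  qed
qed

text \<open>The characteristic function of \<open>t \<bullet> x\<close> at \<open>s\<close> is that
  of the vector at \<open>s *\<^sub>R t\<close>; Levy uniqueness then identifies each
  one-dimensional projection.\<close>

lemma centered_gaussian_exists:
  fixes S :: "real^'n^'n"
  assumes "psd S"
  shows "\<exists>N. centered_gaussian S N \<and> (\<forall>t. (\<integral>x. iexp (t \<bullet> x) \<partial>N) = exp (- (t \<bullet> (S *v t)) / 2))"
proof -
  from gaussian_char_exists[OF assms] obtain N where
    N: "prob_space N" "sets N = sets (borel :: (real^'n) measure)"
     and ch: "\<And>t. (\<integral>x. iexp (t \<bullet> x) \<partial>N) = exp (- (t \<bullet> (S *v t)) / 2)" by blast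
  interpret prob_space N by fact
  have "distr N borel (\<lambda>x. t \<bullet> x) = normal_law (t \<bullet> (S *v t))" for t
  proof -
    have [measurable]: "(\<lambda>x. t \<bullet> x) \<in> borel_measurable N"
      using N(2) by (simp cong: measurable_cong_sets)
    have pos: "0 \<le> t \<bullet> (S *v t)" using assms by (simp add: psd_def)
    have "prob_space (distr N borel (\<lambda>x. t \<bullet> x))" by (rule prob_space_distr) simp
    then have 1: "real_distribution (distr N borel (\<lambda>x. t \<bullet> x))"
      by (simp add: real_distribution_def real_distribution_axioms_def)
    have 2: "char (distr N borel (\<lambda>x. t \<bullet> x)) s = char (normal_law (t \<bullet> (S *v t))) s" for s
    proof -
      have "char (distr N borel (\<lambda>x. t \<bullet> x)) s = (\<integral>x. iexp ((s *\<^sub>R t) \<bullet> x) \<partial>N)"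
        unfolding char_def by (subst integral_distr) auto
      also have "\<dots> = exp (- (s^2 * (t \<bullet> (S *v t)) / 2))"
        unfolding ch by (simp add: matrix_vector_mult_scaleR power2_eq_square mult_ac)
      finally show ?thesis using normal_law_char(2)[OF pos] by simp
    qed
    show ?thesis
      using Levy_uniqueness[OF 1 normal_law_char(1)[OF pos]] 2 by blast
  qed
  then show ?thesis using N ch assms by (auto simp: centered_gaussian_def psd_def)
qed

subsection \<open>Convergence in distribution from characteristic functions\<close>

inductive trig_poly :: "('b::euclidean_space \<Rightarrow> complex) \<Rightarrow> bool" where
  trig_exp: "trig_poly (\<lambda>x. c * iexp (t \<bullet> x))"
| trig_add: "trig_poly f \<Longrightarrow> trig_poly h \<Longrightarrow> trig_poly (\<lambda>x. f x + h x)"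

lemma trig_const: "trig_poly (\<lambda>x. c)"
  using trig_exp[of c 0] by simp

lemma trig_exp_mult:
  assumes "trig_poly f" shows "trig_poly (\<lambda>x. (c * iexp (t \<bullet> x)) * f x)"
  using assms
proof induction
  case (trig_exp d s)
  have "(\<lambda>x. (c * iexp (t \<bullet> x)) * (d * iexp (s \<bullet> x))) = (\<lambda>x. (c * d) * iexp ((t + s) \<bullet> x))"
    by (simp add: inner_add_left distrib_left exp_add mult_ac)
  then show ?case using trig_poly.trig_exp by metis
next
  case (trig_add f h)
  then show ?case by (simp add: distrib_left trig_poly.trig_add)
qed

lemma trig_mult:
  assumes "trig_poly f" "trig_poly h" shows "trig_poly (\<lambda>x. f x * h x)"
  using assms
proof induction
  case (trig_exp d s)
  then show ?case by (rule trig_exp_mult)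
next
  case (trig_add f h)
  then show ?case by (simp add: distrib_right trig_poly.trig_add)
qed

lemma trig_sum:
  assumes "finite A" "\<And>a. a \<in> A \<Longrightarrow> trig_poly (f a)" shows "trig_poly (\<lambda>x. \<Sum>a\<in>A. f a x)"
  using assms by (induction A rule: finite_induct) (auto intro: trig_const trig_poly.trig_add)

lemma trig_sin: "trig_poly (\<lambda>x. of_real (c * sin (t \<bullet> x)))"
proof -
  have "complex_of_real (c * sin y) = (c / (2 * \<i>)) * iexp y + (- c / (2 * \<i>)) * iexp (- y)" for y
    unfolding sin_of_real[symmetric] of_real_mult sin_exp_eq by (simp add: field_simps)
  then have "(\<lambda>x. complex_of_real (c * sin (t \<bullet> x))) =
      (\<lambda>x. (c / (2 * \<i>)) * iexp (t \<bullet> x) + (- c / (2 * \<i>)) * iexp ((- t) \<bullet> x))" by simp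
  then show ?thesis by (simp only:) (intro trig_poly.intros)
qed

text \<open>Trigonometric polynomials form an algebra containing the sines of the coordinates, so a
  polynomial supplied by Stone-Weierstrass stays trigonometric after this substitution.\<close>

lemma trig_real_polynomial:
  fixes P :: "'b::euclidean_space \<Rightarrow> real"
  assumes "real_polynomial_function P"
  shows "trig_poly (\<lambda>x. of_real (P (\<Sum>b\<in>Basis. sin ((c *\<^sub>R b) \<bullet> x) *\<^sub>R b)))"
  using assms
proof induction
  case (linear f)
  have "f (\<Sum>b\<in>Basis. sin ((c *\<^sub>R b) \<bullet> x) *\<^sub>R b) = (\<Sum>b\<in>Basis. f b * sin ((c *\<^sub>R b) \<bullet> x))" for x :: 'b
    by (subst linear_sum[OF bounded_linear.linear[OF linear]])
      (simp add: linear_scale[OF bounded_linear.linear[OF linear]] mult.commute)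
  then show ?case by (simp only: of_real_sum) (intro trig_sum trig_sin, simp)
next
  case (const c)
  then show ?case by (rule trig_const)
next
  case (add f g)
  then show ?case by (simp add: trig_add)
next
  case (mult f g)
  then show ?case by (simp add: trig_mult)
qed

lemma trig_measurable [measurable]:
  assumes "trig_poly f" shows "f \<in> borel_measurable borel"
  using assms by induction auto

lemma trig_integrable:
  assumes "trig_poly f" "finite_measure M" "X \<in> borel_measurable M"
  shows "integrable M (\<lambda>w. f (X w))"
  using assms
proof induction
  case (trig_exp c t)
  then show ?case by (intro integrable_mult_right iexp_integrable) auto
qed auto

lemma trig_limit:
  assumes "trig_poly f" and M: "finite_measure M" and X: "\<And>n. X n \<in> borel_measurable M"
    and N: "finite_measure N" and sN: "sets N = sets borel"
    and ch: "\<And>t. (\<lambda>n. \<integral>w. iexp (t \<bullet> X n w) \<partial>M) \<longlonglongrightarrow> (\<integral>x. iexp (t \<bullet> x) \<partial>N)"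
  shows "(\<lambda>n. \<integral>w. f (X n w) \<partial>M) \<longlonglongrightarrow> (\<integral>x. f x \<partial>N)"
  using assms(1)
proof induction
  case (trig_exp c t)
  show ?case using tendsto_mult_left[OF ch[of t], of c] by simp
next
  case (trig_add f h)
  have id: "(\<lambda>x. x) \<in> borel_measurable N"
    using sN by (simp cong: measurable_cong_sets)
  note int = trig_integrable[OF trig_add(1) M X] trig_integrable[OF trig_add(2) M X]
    trig_integrable[OF trig_add(1) N id] trig_integrable[OF trig_add(2) N id]
  show ?case using tendsto_add[OF trig_add.IH] int by simp
qed

lemma triangle_wave_id:
  fixes x :: "'b::euclidean_space"
  assumes "R > 0" "norm x \<le> R"
  shows "(\<Sum>b\<in>Basis. (R * arcsin (sin ((inverse R *\<^sub>R b) \<bullet> x))) *\<^sub>R b) = x"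
proof -
  have "R * arcsin (sin ((inverse R *\<^sub>R b) \<bullet> x)) = x \<bullet> b" if "b \<in> Basis" for b
  proof -
    have "\<bar>x \<bullet> b\<bar> \<le> R" using Basis_le_norm[OF that, of x] assms by simp
    then have "\<bar>inverse R * (b \<bullet> x)\<bar> \<le> 1"
      using assms by (simp add: abs_mult inner_commute field_simps)
    moreover have "1 \<le> pi / 2" using pi_gt3 by simp
    ultimately have "arcsin (sin (inverse R * (b \<bullet> x))) = inverse R * (b \<bullet> x)"
      by (intro arcsin_sin) auto
    then show ?thesis using assms by (simp add: inner_commute)
  qed
  then show ?thesis by (simp add: euclidean_representation cong: sum.cong)
qed

text \<open>The triangle wave \<open>R * arcsin (sin (x / R))\<close> agrees with \<open>x\<close> near \<open>0\<close> and is a continuous function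
  of \<open>sin (x / R) \<in> [-1, 1]\<close>.  Hence a polynomial approximation on the cube \<open>[-1, 1]\<^sup>d\<close> yields a
  trigonometric polynomial that is uniformly bounded on the whole space and close to \<open>f\<close> on a ball.\<close>

lemma trig_approx:
  fixes f :: "'b::euclidean_space \<Rightarrow> real"
  assumes cont: "continuous_on UNIV f" and bd: "\<And>x. \<bar>f x\<bar> \<le> F" and R: "R > 0" and e: "e > 0"
  shows "\<exists>h. trig_poly (\<lambda>x. complex_of_real (h x)) \<and> (\<forall>x. \<bar>f x - h x\<bar> \<le> e + 2 * F * indicator {x. R < norm x} x)"
proof -
  define T where "T u = (\<Sum>b\<in>Basis. (R * arcsin (u \<bullet> b)) *\<^sub>R b)" for u :: 'b
  define S where "S x = (\<Sum>b\<in>Basis. sin ((inverse R *\<^sub>R b) \<bullet> x) *\<^sub>R b)" for x :: 'b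
  have Sb: "S x \<bullet> b = sin ((inverse R *\<^sub>R b) \<bullet> x)" if "b \<in> Basis" for x b
    unfolding S_def using that by (simp add: inner_sum_left_Basis)
  have Sc: "S x \<in> cbox (-One) One" for x
    by (auto simp: mem_box Sb simp del: inner_scaleR_left)
  have "continuous_on (cbox (-One) One) T"
    unfolding T_def
    by (intro continuous_intros) (auto simp: mem_box)
  then have "continuous_on (cbox (-One) One) (\<lambda>u. f (T u))"
    using continuous_on_compose2[OF cont] by blast
  then obtain P where P: "real_polynomial_function P" "\<And>u. u \<in> cbox (-One) One \<Longrightarrow> \<bar>f (T u) - P u\<bar> < e"
    using Stone_Weierstrass_real_polynomial_function[OF compact_cbox _ e] by metis
  have "trig_poly (\<lambda>x. complex_of_real (P (S x)))"
    unfolding S_def by (rule trig_real_polynomial[OF P(1)])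
  moreover have "\<bar>f x - P (S x)\<bar> \<le> e + 2 * F * indicator {x. R < norm x} x" for x
  proof (cases "norm x \<le> R")
    case True
    have "T (S x) = x"
      unfolding T_def using triangle_wave_id[OF R True] by (simp add: Sb cong: sum.cong)
    then show ?thesis using P(2)[OF Sc[of x]] True by simp
  next
    case False
    \<comment> \<open>Outside the ball \<open>P (S x)\<close> is still within \<open>e\<close> of
      \<open>f (T (S x))\<close>, which differs from \<open>f x\<close> by at most
      \<open>2 * F\<close>.\<close>
    then show ?thesis using P(2)[OF Sc[of x]] bd[of x] bd[of "T (S x)"] by simp
  qed
  ultimately show ?thesis by (intro exI[of _ "\<lambda>x. P (S x)"]) auto
qed

lemma (in prob_space) integral_dist_le_tail:
  fixes f h :: "'b::euclidean_space \<Rightarrow> real"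
  assumes X[measurable]: "X \<in> borel_measurable M" and "f \<in> borel_measurable borel"
    and int: "integrable M (\<lambda>w. f (X w))" "integrable M (\<lambda>w. h (X w))"
    and le: "\<And>x. \<bar>f x - h x\<bar> \<le> e + c * indicator {x. R < norm x} x"
  shows "\<bar>expectation (\<lambda>w. f (X w)) - expectation (\<lambda>w. h (X w))\<bar> \<le> e + c * prob {w \<in> space M. R < norm (X w)}"
proof -
  have A[measurable]: "{w \<in> space M. R < norm (X w)} \<in> sets M" by measurable
  have i: "integrable M (indicator {w \<in> space M. R < norm (X w)} :: 'a \<Rightarrow> real)"
    by (intro integrable_const_bound[where B=1]) auto
  have "\<bar>expectation (\<lambda>w. f (X w)) - expectation (\<lambda>w. h (X w))\<bar> = \<bar>expectation (\<lambda>w. f (X w) - h (X w))\<bar>"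
    using int by simp
  also have "\<dots> \<le> expectation (\<lambda>w. \<bar>f (X w) - h (X w)\<bar>)" by (rule integral_abs_bound)
  also have "\<dots> \<le> expectation (\<lambda>w. e + c * indicator {w \<in> space M. R < norm (X w)} w)"
  proof (rule integral_mono)
    show "integrable M (\<lambda>w. \<bar>f (X w) - h (X w)\<bar>)" using int by auto
    show "integrable M (\<lambda>w. e + c * indicator {w \<in> space M. R < norm (X w)} w)"
      using i by auto
    show "\<bar>f (X w) - h (X w)\<bar> \<le> e + c * indicator {w \<in> space M. R < norm (X w)} w" if "w \<in> space M" for w
      using le[of "X w"] that by (simp add: indicator_def)
  qed
  also have "\<dots> = e + c * prob {w \<in> space M. R < norm (X w)}"
    using i by (simp add: prob_space)
  finally show ?thesis .
qed

text \<open>Continuity theorem in several dimensions with known limit. Trigonometric polynomials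
  approximate \<open>f\<close> well only on a ball, and tightness controls the complement; it is
  assumed here because first absolute moments supply it directly.\<close>

lemma converges_in_distribution_char:
  fixes X :: "nat \<Rightarrow> 'w \<Rightarrow> 'b::euclidean_space"
  assumes "prob_space M" and X[measurable]: "\<And>n. X n \<in> borel_measurable M"
    and "prob_space N" and sN: "sets N = sets borel"
    and ch: "\<And>t. (\<lambda>n. \<integral>w. iexp (t \<bullet> X n w) \<partial>M) \<longlonglongrightarrow> (\<integral>x. iexp (t \<bullet> x) \<partial>N)"
    and tight: "\<And>e. e > 0 \<Longrightarrow> \<exists>R. \<forall>\<^sub>F n in sequentially. measure M {w \<in> space M. R < norm (X n w)} \<le> e"
  shows "converges_in_distribution M X N"
  unfolding converges_in_distribution_def
proof (intro allI impI, elim conjE)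
  interpret M: prob_space M by fact
  interpret N: prob_space N by fact
  fix f :: "'b \<Rightarrow> real" assume cont: "continuous_on UNIV f" and bdd: "bounded (range f)"
  from bdd obtain F0 where F0: "\<And>x. \<bar>f x\<bar> \<le> F0" unfolding bounded_iff by auto
  define F where "F = max 1 F0"
  have F: "F \<ge> 1" "\<And>x. \<bar>f x\<bar> \<le> F" using order.trans[OF F0 max.cobounded2] by (auto simp: F_def)
  have [measurable]: "f \<in> borel_measurable borel" using cont by (rule borel_measurable_continuous_onI)
  have [measurable]: "(\<lambda>x. x) \<in> borel_measurable N" using sN by (simp cong: measurable_cong_sets)
  have spN: "space N = UNIV" using sN by (metis sets_eq_imp_space_eq space_borel)
  have iM: "integrable M (\<lambda>w. f (X n w))" for n
    by (rule M.integrable_const_bound[where B=F]) (auto simp: F)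
  have iN: "integrable N (\<lambda>w. f w)"
  proof (rule N.integrable_const_bound[where B=F])
    show "f \<in> borel_measurable N" using sN by (simp cong: measurable_cong_sets)
  qed (auto simp: F)
  have tightN: "\<exists>R>0. N.prob {x. R < norm x} \<le> e" if "e > 0" for e
  proof -
    have "(\<lambda>n. N.prob {x. real n < norm x}) \<longlonglongrightarrow> N.prob (\<Inter>n. {x. real n < norm x})"
    proof (rule N.finite_Lim_measure_decseq)
      have "{x::'b. real i < norm x} \<in> N.events" for i
        unfolding sN by measurable
      then show "range (\<lambda>i. {x. real i < norm x}) \<subseteq> N.events" by blast
      show "decseq (\<lambda>i. {x::'b. real i < norm x})"
        by (rule decseq_SucI) auto
    qed
    moreover have "(\<Inter>n. {x::'b. real n < norm x}) = {}"
    proof -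
      have "x \<notin> (\<Inter>n. {x. real n < norm x})" for x :: 'b
      proof -
        obtain n where "norm x \<le> real n" using real_arch_simple by blast
        then have "x \<notin> {x. real n < norm x}" by simp
        then show ?thesis by blast
      qed
      then show ?thesis by blast
    qed
    ultimately have "(\<lambda>n. N.prob {x. real n < norm x}) \<longlonglongrightarrow> 0" by simp
    from LIMSEQ_D[OF this that] obtain n where n: "\<And>m. m \<ge> n \<Longrightarrow> N.prob {x. real m < norm x} < e" by auto
    then show ?thesis by (intro exI[of _ "real (Suc n)"]) (auto simp del: of_nat_Suc intro: less_imp_le)
  qed
  show "(\<lambda>n. \<integral>w. f (X n w) \<partial>M) \<longlonglongrightarrow> (\<integral>x. f x \<partial>N)"
  proof (rule LIMSEQ_I)
    fix r :: real assume r: "0 < r"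
    \<comment> \<open>Each of the two laws costs \<open>e + 2 * F * e\<close> and the trigonometric
      polynomial \<open>r / 8\<close>, in total at most \<open>7 * r / 8\<close>;
      \<open>F >= 1\<close> gives \<open>e <= r / 8\<close>.\<close>
    define e where "e = r / (8 * F)"
    have e: "e > 0" using r F by (simp add: e_def)
    have Fe: "F * e = r / 8" using F by (simp add: e_def)
    have er: "e \<le> r / 8" using r F by (simp add: e_def field_simps)
    obtain R1 where R1: "\<forall>\<^sub>F n in sequentially. M.prob {w \<in> space M. R1 < norm (X n w)} \<le> e"
      using tight[OF e] by auto
    obtain R2 where R2: "R2 > 0" "N.prob {x. R2 < norm x} \<le> e" using tightN[OF e] by auto
    define R where "R = max R1 R2"
    have R: "R > 0" using R2 by (simp add: R_def)
    have RN: "N.prob {x \<in> space N. R < norm x} \<le> e"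
    proof -
      have "{x::'b. R2 < norm x} \<in> sets borel" by measurable
      then have "N.prob {x \<in> space N. R < norm x} \<le> N.prob {x. R2 < norm x}"
        using sN spN by (intro N.finite_measure_mono) (auto simp: R_def)
      then show ?thesis using R2 by simp
    qed
    have RM: "\<forall>\<^sub>F n in sequentially. M.prob {w \<in> space M. R < norm (X n w)} \<le> e"
      using R1
    proof eventually_elim
      case (elim n)
      have "M.prob {w \<in> space M. R < norm (X n w)} \<le> M.prob {w \<in> space M. R1 < norm (X n w)}"
        by (intro M.finite_measure_mono) (auto simp: R_def)
      then show ?case using elim by simp
    qed
    obtain h where h: "trig_poly (\<lambda>x. complex_of_real (h x))"
      and le: "\<And>x. \<bar>f x - h x\<bar> \<le> e + 2 * F * indicator {x. R < norm x} x"
      using trig_approx[OF cont F(2) R e] by auto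
    have [measurable]: "h \<in> borel_measurable borel"
      using measurable_compose[OF trig_measurable[OF h] borel_measurable_Re] by simp
    have ihM: "integrable M (\<lambda>w. h (X n w))" for n
      using integrable_Re[OF trig_integrable[OF h M.finite_measure_axioms X[of n]]] by simp
    have ihN: "integrable N (\<lambda>x. h x)"
    proof -
      have "(\<lambda>x. x) \<in> borel_measurable N" by simp
      from integrable_Re[OF trig_integrable[OF h N.finite_measure_axioms this]] show ?thesis by simp
    qed
    have "(\<lambda>n. \<integral>w. complex_of_real (h (X n w)) \<partial>M) \<longlonglongrightarrow> (\<integral>x. complex_of_real (h x) \<partial>N)"
      by (rule trig_limit[OF h M.finite_measure_axioms X N.finite_measure_axioms sN ch])
    then have "(\<lambda>n. \<integral>w. h (X n w) \<partial>M) \<longlonglongrightarrow> (\<integral>x. h x \<partial>N)"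
      by (simp add: tendsto_of_real_iff)
    from LIMSEQ_D[OF this, of "r/8"] r have "\<forall>\<^sub>F n in sequentially. \<bar>(\<integral>w. h (X n w) \<partial>M) - (\<integral>x. h x \<partial>N)\<bar> < r/8"
      by (auto simp: eventually_sequentially)
    then have "\<forall>\<^sub>F n in sequentially. \<bar>(\<integral>w. f (X n w) \<partial>M) - (\<integral>x. f x \<partial>N)\<bar> < r"
      using RM
    proof eventually_elim
      case (elim n)
      have 1: "\<bar>(\<integral>w. f (X n w) \<partial>M) - (\<integral>w. h (X n w) \<partial>M)\<bar> \<le> e + 2 * F * M.prob {w \<in> space M. R < norm (X n w)}"
        by (rule M.integral_dist_le_tail[OF X _ iM ihM le]) simp
      have 2: "\<bar>(\<integral>x. f x \<partial>N) - (\<integral>x. h x \<partial>N)\<bar> \<le> e + 2 * F * N.prob {x \<in> space N. R < norm x}"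
        by (rule N.integral_dist_le_tail[OF _ _ iN ihN le]) simp_all
      have 3: "2 * F * M.prob {w \<in> space M. R < norm (X n w)} \<le> 2 * F * e"
        using elim(2) F by (intro mult_left_mono) auto
      have 4: "2 * F * N.prob {x \<in> space N. R < norm x} \<le> 2 * F * e"
        using RN F by (intro mult_left_mono) auto
      show ?case using 1 2 3 4 elim(1) Fe er r by linarith
    qed
    then show "\<exists>no. \<forall>n\<ge>no. norm ((\<integral>w. f (X n w) \<partial>M) - (\<integral>x. f x \<partial>N)) < r"
      by (auto simp: eventually_sequentially)
  qed
qed

lemma matrix_inv_mult_self: "invertible Q \<Longrightarrow> matrix_inv Q ** Q = mat 1"
  using someI_ex[of "\<lambda>R. Q ** R = mat 1 \<and> R ** Q = mat 1"] by (simp add: invertible_def matrix_inv_def)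

lemma cmod_iexp_diff_le: "cmod (iexp x - iexp y) \<le> \<bar>x - y\<bar>"
proof -
  have "iexp x - iexp y = iexp y * (iexp (x - y) - 1)"
    by (simp add: algebra_simps flip: exp_add)
  then have "cmod (iexp x - iexp y) = cmod (iexp (x - y) - 1)" by (simp add: norm_mult)
  then show ?thesis using iexp_approx1[of "x - y" 0] by simp
qed

subsection \<open>A central limit theorem for arrays of bounded martingale differences\<close>

text \<open>Above by \<open>1 - x <= exp (- x)\<close>; below by
  \<open>(1 + x) * (1 - x + x^2) = 1 + x^3\<close> and \<open>1 + x <= exp x\<close>.\<close>

lemma exp_mult_one_minus_bound:
  fixes x :: real assumes "x \<ge> 0" shows "\<bar>exp x * (1 - x) - 1\<bar> \<le> x^2 * exp x"
proof -
  have 1: "exp x * (1 - x) \<le> exp x * exp (- x)"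
    using exp_ge_add_one_self[of "- x"] by (intro mult_left_mono) auto
  have "1 \<le> (1 + x) * (1 - x + x^2)" using assms by (simp add: algebra_simps power2_eq_square)
  also have "\<dots> \<le> exp x * (1 - x + x^2)"
  proof (rule mult_right_mono)
    have "0 \<le> (1 - x)^2 + x" using assms by simp
    then show "0 \<le> 1 - x + x^2" by (simp add: power2_eq_square algebra_simps)
  qed simp
  finally have "1 - exp x * (1 - x) \<le> x^2 * exp x" by (simp add: algebra_simps)
  moreover have "x^2 * exp x \<ge> 0" by simp
  ultimately show ?thesis using 1 by (simp add: exp_minus)
qed

lemma (in finite_measure) integrable_bounded:
  fixes f :: "'a \<Rightarrow> 'b::{banach,second_countable_topology}"
  assumes "f \<in> borel_measurable M" "AE x in M. norm (f x) \<le> B"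
  shows "integrable M f"
  using assms(2,1) by (rule integrable_const_bound)

text \<open>\<open>real_cond_exp\<close> acts on real functions while \<open>U\<close> carries a
  complex exponential, so the identity is split into real and imaginary parts, both of the form
  \<open>P (U x)\<close>.\<close>

lemma (in finite_measure_subalgebra) complex_cond_exp_intg:
  fixes U :: "'a \<Rightarrow> complex" and f g :: "'a \<Rightarrow> real"
  assumes U[measurable]: "U \<in> borel_measurable F" and Ub: "AE x in M. cmod (U x) \<le> C"
    and f: "integrable M f" and fg: "AE x in M. real_cond_exp M F f x = g x"
    and g: "g \<in> borel_measurable M"
  shows "(\<integral>x. U x * of_real (f x) \<partial>M) = (\<integral>x. U x * of_real (g x) \<partial>M)"
    and "integrable M (\<lambda>x. U x * of_real (f x))" and "integrable M (\<lambda>x. U x * of_real (g x))"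
proof -
  have UM[measurable]: "U \<in> borel_measurable M" by (rule measurable_from_subalg[OF subalg U])
  have [measurable]: "f \<in> borel_measurable M" using f by simp
  note [measurable] = g
  have ig: "integrable M g"
    using real_cond_exp_int(1)[OF f] by (rule integrable_cong_AE_imp) (use fg g in auto)
  have i: "integrable M (\<lambda>x. U x * of_real (h x))" if h: "integrable M h" for h :: "'a \<Rightarrow> real"
  proof (rule Bochner_Integration.integrable_bound[where f="\<lambda>x. C * h x"])
    show "AE x in M. norm (U x * of_real (h x)) \<le> norm (C * h x)"
      using Ub
    proof eventually_elim
      case (elim x)
      have "cmod (U x) * \<bar>h x\<bar> \<le> \<bar>C\<bar> * \<bar>h x\<bar>" using elim by (intro mult_right_mono) auto
      then show ?case by (simp add: norm_mult abs_mult)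
    qed
  qed (use h in auto)
  show i1: "integrable M (\<lambda>x. U x * of_real (f x))" and i2: "integrable M (\<lambda>x. U x * of_real (g x))"
    by (rule i[OF f], rule i[OF ig])
  have R: "(\<integral>x. P (U x) * f x \<partial>M) = (\<integral>x. P (U x) * g x \<partial>M)"
    if P: "P \<in> borel_measurable borel" "integrable M (\<lambda>x. P (U x) * f x)" for P :: "complex \<Rightarrow> real"
  proof -
    note [measurable] = P(1)
    have "(\<lambda>x. P (U x)) \<in> borel_measurable F" by measurable
    from real_cond_exp_intg(2)[OF P(2) this]
    have "(\<integral>x. P (U x) * f x \<partial>M) = (\<integral>x. P (U x) * real_cond_exp M F f x \<partial>M)" by simp
    also have "\<dots> = (\<integral>x. P (U x) * g x \<partial>M)"
      by (rule integral_cong_AE) (use fg in auto)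
    finally show ?thesis .
  qed
  show "(\<integral>x. U x * of_real (f x) \<partial>M) = (\<integral>x. U x * of_real (g x) \<partial>M)"
  proof (rule complex_eqI)
    have "integrable M (\<lambda>x. Re (U x) * f x)" using integrable_Re[OF i1] by simp
    from R[OF _ this] show "Re (\<integral>x. U x * of_real (f x) \<partial>M) = Re (\<integral>x. U x * of_real (g x) \<partial>M)"
      using i1 i2 by (simp flip: integral_Re)
    have "integrable M (\<lambda>x. Im (U x) * f x)" using integrable_Im[OF i1] by simp
    from R[OF _ this] show "Im (\<integral>x. U x * of_real (f x) \<partial>M) = Im (\<integral>x. U x * of_real (g x) \<partial>M)"
      using i1 i2 by (simp flip: integral_Im)
  qed
qed

text \<open>Given \<open>F\<close>, \<open>iexp (d x)\<close> has mean \<open>1 - v x / 2\<close> up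
  to order \<open>h^3\<close>, and the compensator \<open>exp (v x / 2)\<close> brings this back to
  1 up to order \<open>h^4\<close>. Compensating multiplicatively avoids dividing by conditional
  characteristic functions.\<close>

lemma (in finite_measure_subalgebra) char_step:
  fixes Z :: "'a \<Rightarrow> complex" and d v :: "'a \<Rightarrow> real"
  assumes P: "prob_space M"
    and d[measurable]: "d \<in> borel_measurable M" and v[measurable]: "v \<in> borel_measurable F"
    and Z[measurable]: "Z \<in> borel_measurable F"
    and db: "AE x in M. \<bar>d x\<bar> \<le> h" and mean: "AE x in M. real_cond_exp M F d x = 0"
    and var: "AE x in M. real_cond_exp M F (\<lambda>x. (d x)^2) x = v x"
    and Zb: "AE x in M. cmod (Z x) \<le> C" and C: "C \<ge> 0" and h: "h \<ge> 0"
  shows "cmod ((\<integral>x. Z x * iexp (d x) * exp (v x / 2) \<partial>M) - (\<integral>x. Z x \<partial>M)) \<le> C * exp (h^2 / 2) * (h^3 / 6 + h^4 / 4)"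
proof -
  interpret prob_space M by fact
  have ZM[measurable]: "Z \<in> borel_measurable M" by (rule measurable_from_subalg[OF subalg Z])
  have vM[measurable]: "v \<in> borel_measurable M" by (rule measurable_from_subalg[OF subalg v])
  have id: "integrable M d" by (rule integrable_bounded[OF _ db[folded real_norm_def]]) simp
  have d2b: "AE x in M. (d x)^2 \<le> h^2" using db by eventually_elim (use h in \<open>simp add: abs_le_square_iff[symmetric]\<close>)
  have id2: "integrable M (\<lambda>x. (d x)^2)" by (rule integrable_bounded[where B="h^2"]) (use d2b in auto)
  have v0: "AE x in M. 0 \<le> v x" using real_cond_exp_ge_c[OF id2, of 0] var by auto
  have vh: "AE x in M. v x \<le> h^2" using real_cond_exp_le_c[OF id2 d2b] var by auto
  define U where "U x = Z x * exp (v x / 2)" for x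
  have U[measurable]: "U \<in> borel_measurable F" unfolding U_def by measurable
  have UM[measurable]: "U \<in> borel_measurable M" by (rule measurable_from_subalg[OF subalg U])
  have Ub: "AE x in M. cmod (U x) \<le> C * exp (h^2 / 2)"
    using Zb vh
  proof eventually_elim
    case (elim x)
    then have "cmod (Z x) * exp (v x / 2) \<le> C * exp (h^2 / 2)" using C by (intro mult_mono) auto
    then show ?case by (simp add: U_def norm_mult flip: exp_of_real)
  qed
  have iU: "integrable M U" by (rule integrable_bounded[OF _ Ub]) simp
  have iZ: "integrable M Z" by (rule integrable_bounded[OF _ Zb]) simp
  note c1 = complex_cond_exp_intg[OF U Ub id mean, simplified]
  note c2 = complex_cond_exp_intg[OF U Ub id2 var vM]
  define r where "r y = iexp y - (1 + \<i> * y - y^2 / 2)" for y :: real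
  have rb: "cmod (r y) \<le> \<bar>y\<bar>^3 / 6" for y
    using iexp_approx1[of y 2] by (simp add: r_def eval_nat_numeral algebra_simps)
  have [measurable]: "r \<in> borel_measurable borel" unfolding r_def by measurable
  have Urb: "AE x in M. cmod (U x * r (d x)) \<le> C * exp (h^2 / 2) * (h^3 / 6)"
    using Ub db
  proof eventually_elim
    case (elim x)
    have "cmod (r (d x)) \<le> h^3 / 6" using rb[of "d x"] power_mono[OF elim(2), of 3] by simp
    then have "cmod (U x) * cmod (r (d x)) \<le> C * exp (h^2 / 2) * (h^3 / 6)"
      using elim(1) C by (intro mult_mono) auto
    then show ?case by (simp add: norm_mult)
  qed
  have ir: "integrable M (\<lambda>x. U x * r (d x))" by (rule integrable_bounded[OF _ Urb]) simp
  define w where "w x = Z x * of_real (exp (v x / 2) * (1 - v x / 2) - 1)" for x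
  have wb: "AE x in M. cmod (w x) \<le> C * exp (h^2 / 2) * (h^4 / 4)"
    using Zb v0 vh
  proof eventually_elim
    case (elim x)
    have "\<bar>exp (v x / 2) * (1 - v x / 2) - 1\<bar> \<le> (v x / 2)^2 * exp (v x / 2)"
      using elim by (intro exp_mult_one_minus_bound) auto
    also have "\<dots> \<le> (h^2 / 2)^2 * exp (h^2 / 2)"
      using elim by (intro mult_mono power_mono) auto
    finally have "\<bar>exp (v x / 2) * (1 - v x / 2) - 1\<bar> \<le> exp (h^2 / 2) * (h^4 / 4)"
      by (simp add: power_divide mult.commute flip: power_mult)
    then have "cmod (Z x) * \<bar>exp (v x / 2) * (1 - v x / 2) - 1\<bar> \<le> C * (exp (h^2 / 2) * (h^4 / 4))"
      using elim C by (intro mult_mono) auto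
    then show ?case by (simp only: w_def norm_mult norm_of_real mult.assoc)
  qed
  have [measurable]: "w \<in> borel_measurable M" unfolding w_def by measurable
  have iw: "integrable M w" by (rule integrable_bounded[OF _ wb]) simp
  \<comment> \<open>Second-order Taylor expansion with remainder \<open>r\<close>. As
    \<open>U\<close> is measurable for \<open>F\<close>, the linear term integrates to 0 and
    \<open>(d x)^2\<close> may be replaced by \<open>v x\<close>.\<close>
  have "Z x * iexp (d x) * exp (v x / 2) = U x * r (d x) + U x + \<i> * (U x * of_real (d x)) - (U x * of_real ((d x)^2)) / 2" for x
    by (simp add: U_def r_def algebra_simps)
  then have "(\<integral>x. Z x * iexp (d x) * exp (v x / 2) \<partial>M)
      = (\<integral>x. U x * r (d x) \<partial>M) + (\<integral>x. U x \<partial>M) + \<i> * (\<integral>x. U x * of_real (d x) \<partial>M) - (\<integral>x. U x * of_real ((d x)^2) \<partial>M) / 2"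
    using iU ir c1(2) c2(2) by simp
  also have "\<dots> = (\<integral>x. U x * r (d x) \<partial>M) + (\<integral>x. U x \<partial>M) - (\<integral>x. U x * of_real (v x) \<partial>M) / 2"
    unfolding c1(1) c2(1) by simp
  also have "\<dots> = (\<integral>x. U x * r (d x) \<partial>M) + (\<integral>x. U x - (U x * of_real (v x)) / 2 \<partial>M)"
    using iU c2(3) by simp
  also have "(\<lambda>x. U x - (U x * of_real (v x)) / 2) = (\<lambda>x. w x + Z x)"
    by (simp add: fun_eq_iff U_def w_def algebra_simps exp_of_real)
  also have "(\<integral>x. w x + Z x \<partial>M) = (\<integral>x. w x \<partial>M) + (\<integral>x. Z x \<partial>M)"
    using iw iZ by simp
  finally have "(\<integral>x. Z x * iexp (d x) * exp (v x / 2) \<partial>M) - (\<integral>x. Z x \<partial>M) = (\<integral>x. U x * r (d x) \<partial>M) + (\<integral>x. w x \<partial>M)"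
    by simp
  moreover have "cmod (\<integral>x. U x * r (d x) \<partial>M) \<le> C * exp (h^2 / 2) * (h^3 / 6)"
    by (rule order.trans[OF integral_norm_bound integral_le_const]) (use ir Urb in auto)
  moreover have "cmod (\<integral>x. w x \<partial>M) \<le> C * exp (h^2 / 2) * (h^4 / 4)"
    by (rule order.trans[OF integral_norm_bound integral_le_const]) (use iw wb in auto)
  ultimately show ?thesis
    by (simp only: distrib_left norm_triangle_mono)
qed

text \<open>With \<open>Y m = (\<Sum>k<m. d k)\<close> and \<open>S m = (\<Sum>k<m. v k)\<close>, the expectation of \<open>exp (i Y m + S m / 2)\<close> changes by
  only \<open>O(n powr (-3/2))\<close> per step, and \<open>S n\<close> tends to a constant.\<close>

theorem martingale_difference_array_CLT:
  fixes M :: "'a measure" and F :: "nat \<Rightarrow> 'a measure" and d v :: "nat \<Rightarrow> nat \<Rightarrow> 'a \<Rightarrow> real"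
  assumes P: "prob_space M"
    and sub: "\<And>m. subalgebra M (F m)" and mono: "\<And>m. sets (F m) \<subseteq> sets (F (Suc m))"
    and d: "\<And>n m. d n m \<in> borel_measurable (F (Suc m))"
    and v: "\<And>n m. v n m \<in> borel_measurable (F m)"
    and db: "\<And>n m. m < n \<Longrightarrow> AE x in M. \<bar>d n m x\<bar> \<le> c / sqrt (real n)"
    and mean: "\<And>n m. m < n \<Longrightarrow> AE x in M. real_cond_exp M (F m) (d n m) x = 0"
    and var: "\<And>n m. m < n \<Longrightarrow> AE x in M. real_cond_exp M (F m) (\<lambda>x. (d n m x)^2) x = v n m x"
    and lim: "AE x in M. (\<lambda>n. \<Sum>m<n. v n m x) \<longlonglongrightarrow> s"
  shows "(\<lambda>n. \<integral>x. iexp (\<Sum>m<n. d n m x) \<partial>M) \<longlonglongrightarrow> of_real (exp (- s / 2))"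
proof -
  interpret prob_space M by fact
  have subalg': "finite_measure_subalgebra M (F m)" for m
    using sub by unfold_locales
  have space: "space (F m) = space M" for m using sub by (simp add: subalgebra_def)
  have monoF: "sets (F k) \<subseteq> sets (F m)" if "k \<le> m" for k m
    using lift_Suc_mono_le[of "\<lambda>m. sets (F m)", OF mono that] .
  have measF: "f \<in> borel_measurable (F m)" if "f \<in> borel_measurable (F k)" "k \<le> m" 
    for f :: "'a \<Rightarrow> real" and k m
    using that monoF[OF that(2)] by (auto simp: measurable_def space)
  have dM[measurable]: "d n m \<in> borel_measurable M" for n m
    using d sub measurable_from_subalg by blast
  have vM[measurable]: "v n m \<in> borel_measurable M" for n m
    using v sub measurable_from_subalg by blast
  have d2b: "AE x in M. (d n m x)^2 \<le> c^2 / n" if "m < n" for n m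
    using db[OF that]
  proof eventually_elim
    case (elim x)
    then have "\<bar>d n m x\<bar>^2 \<le> (c / sqrt n)^2" by (intro power_mono) auto
    then show ?case by (simp add: power_divide)
  qed
  have vb: "AE x in M. 0 \<le> v n m x \<and> v n m x \<le> c^2 / n" if "m < n" for n m
  proof -
    interpret finite_measure_subalgebra M "F m" by (rule subalg')
    have id2: "integrable M (\<lambda>x. (d n m x)^2)"
      by (rule integrable_bounded[where B="c^2 / n"]) (use d2b[OF that] in auto)
    show ?thesis using real_cond_exp_ge_c[OF id2, of 0] real_cond_exp_le_c[OF id2 d2b[OF that]] var[OF that]
      by auto
  qed
  define Y where "Y n m x = (\<Sum>k<m. d n k x)" for n m x
  define S where "S n m x = (\<Sum>k<m. v n k x)" for n m x
  define Z where "Z n m x = iexp (Y n m x) * exp (S n m x / 2)" for n m x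
  have [measurable]: "Y n m \<in> borel_measurable M" "S n m \<in> borel_measurable M" for n m
    unfolding Y_def S_def by measurable
  have Sb: "AE x in M. 0 \<le> S n m x \<and> S n m x \<le> c^2" if "m \<le> n" for n m
  proof -
    have "AE x in M. \<forall>k<m. 0 \<le> v n k x \<and> v n k x \<le> c^2 / n"
      unfolding AE_all_countable
    proof
      fix k show "AE x in M. k < m \<longrightarrow> 0 \<le> v n k x \<and> v n k x \<le> c^2 / n"
        using vb[of k n] that by (cases "k < m") auto
    qed
    then show ?thesis
    proof eventually_elim
      case (elim x)
      have "S n m x \<le> (\<Sum>k<m. c^2 / n)" unfolding S_def using elim by (intro sum_mono) auto
      also have "\<dots> = real m / real n * c^2" by simp
      also have "\<dots> \<le> 1 * c^2" using that by (intro mult_right_mono) (auto simp: divide_le_eq_1)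
      finally show ?case unfolding S_def using elim by (auto intro!: sum_nonneg)
    qed
  qed
  have Zb: "AE x in M. cmod (Z n m x) \<le> exp (c^2 / 2)" if "m \<le> n" for n m
    using Sb[OF that] by eventually_elim (simp add: Z_def norm_mult flip: exp_of_real)
  have step: "cmod ((\<integral>x. Z n (Suc m) x \<partial>M) - (\<integral>x. Z n m x \<partial>M)) \<le>
      exp (c^2 / 2) * exp ((c / sqrt n)^2 / 2) * ((c / sqrt n)^3 / 6 + (c / sqrt n)^4 / 4)" if "m < n" and c: "c \<ge> 0" for n m
  proof -
    interpret finite_measure_subalgebra M "F m" by (rule subalg')
    have ZF: "Z n m \<in> borel_measurable (F m)"
    proof -
      have [measurable]: "d n k \<in> borel_measurable (F m)" if "k < m" for k
        using measF[OF d, of k m] that by simp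
      have [measurable]: "v n k \<in> borel_measurable (F m)" if "k < m" for k
        using measF[OF v, of k m] that by simp
      have [measurable]: "Y n m \<in> borel_measurable (F m)" "S n m \<in> borel_measurable (F m)"
        unfolding Y_def S_def by (intro borel_measurable_sum; simp)+
      show ?thesis unfolding Z_def by measurable
    qed
    have "Z n (Suc m) x = Z n m x * iexp (d n m x) * exp (v n m x / 2)" for x
      by (simp add: Z_def Y_def S_def distrib_left add_divide_distrib exp_add)
    then show ?thesis
      using char_step[OF P dM v ZF db[OF that(1)] mean[OF that(1)] var[OF that(1)] Zb[of m n]] c that by simp
  qed
  \<comment> \<open>Forced by the bound on the increments for \<open>n = 1\<close> and
    \<open>m = 0\<close>.\<close>
  have c: "c \<ge> 0"
  proof -
    have "AE x in M. \<bar>d 1 0 x\<bar> \<le> c" using db[of 0 1] by simp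
    then have "AE x in M. 0 \<le> c" by eventually_elim simp
    then show ?thesis by simp
  qed
  have Z0: "(\<integral>x. Z n 0 x \<partial>M) = 1" for n
    by (simp add: Z_def Y_def S_def prob_space)
  have EZ: "(\<lambda>n. \<integral>x. Z n n x \<partial>M) \<longlonglongrightarrow> 1"
  proof -
    \<comment> \<open>The bound of \<open>char_step\<close> with \<open>h = c / sqrt n\<close> and
      \<open>C = exp (c^2 / 2)\<close>.\<close>
    let ?K = "\<lambda>n::nat. exp (c^2 / 2) * exp ((c / sqrt n)^2 / 2) * ((c / sqrt n)^3 / 6 + (c / sqrt n)^4 / 4)"
    have bound: "cmod ((\<integral>x. Z n m x \<partial>M) - 1) \<le> real m * ?K n" if "m \<le> n" for n m
      using that
    proof (induction m)
      case (Suc m)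
      have "(\<integral>x. Z n (Suc m) x \<partial>M) - 1 = ((\<integral>x. Z n (Suc m) x \<partial>M) - (\<integral>x. Z n m x \<partial>M)) + ((\<integral>x. Z n m x \<partial>M) - 1)"
        by simp
      then have "cmod ((\<integral>x. Z n (Suc m) x \<partial>M) - 1) \<le> ?K n + real m * ?K n"
        using norm_triangle_le[OF add_mono[OF step[of m n] Suc.IH]] Suc.prems c by simp
      then show ?case by (simp only: of_nat_Suc distrib_right mult_1 add.commute)
    qed (simp add: Z0)
    have "(\<lambda>n. real n * ?K n) \<longlonglongrightarrow> 0"
    proof -
      have q: "(\<lambda>n. 1 / sqrt (real n)) \<longlonglongrightarrow> 0" by real_asymp
      have "(\<lambda>n. c / sqrt (real n)) \<longlonglongrightarrow> 0" using tendsto_mult_right_zero[OF q, of c] by simp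
      from tendsto_power[OF this, of 2] have "(\<lambda>n. (c / sqrt (real n))^2) \<longlonglongrightarrow> 0" by simp
      then have "(\<lambda>n. exp (c^2 / 2) * exp ((c / sqrt n)^2 / 2)) \<longlonglongrightarrow> exp (c^2 / 2) * exp (0 / 2)"
        by (intro tendsto_intros) auto
      moreover have "(\<lambda>n. real n * ((c / sqrt n)^3 / 6 + (c / sqrt n)^4 / 4)) \<longlonglongrightarrow> 0"
      proof -
        have "(\<lambda>n. c^3 / 6 * (1 / sqrt (real n)) + c^4 / 4 * (1 / sqrt (real n))^2) \<longlonglongrightarrow> c^3 / 6 * 0 + c^4 / 4 * 0^2"
          by (intro tendsto_intros q)
        moreover have "c^3 / 6 * (1 / sqrt (real n)) + c^4 / 4 * (1 / sqrt (real n))^2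
            = real n * ((c / sqrt n)^3 / 6 + (c / sqrt n)^4 / 4)" for n
        proof (cases "n = 0")
          case False
          define t where "t = sqrt (real n)"
          have "t > 0" "real n = t^2" using False by (auto simp: t_def)
          then show ?thesis by (simp add: field_simps eval_nat_numeral flip: t_def)
        qed simp
        ultimately show ?thesis by simp
      qed
      ultimately have "(\<lambda>n. (exp (c^2 / 2) * exp ((c / sqrt n)^2 / 2)) * (real n * ((c / sqrt n)^3 / 6 + (c / sqrt n)^4 / 4)))
          \<longlonglongrightarrow> exp (c^2 / 2) * exp (0 / 2) * 0" by (rule tendsto_mult)
      then show ?thesis by (simp add: mult_ac)
    qed
    then have "(\<lambda>n. (\<integral>x. Z n n x \<partial>M) - 1) \<longlonglongrightarrow> 0"
      by (rule Lim_null_comparison[rotated]) (use bound in auto)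
    then show ?thesis by (rule LIM_zero_cancel)
  qed
  \<comment> \<open>Error of replacing the random \<open>S n n\<close> in \<open>Z n n\<close> by
    its limit \<open>s\<close>. It is bounded since \<open>S n n\<close> lies between 0 and
    \<open>c^2\<close>, so dominated convergence applies.\<close>
  define D where "D n x = iexp (Y n n x) * of_real (1 - exp ((S n n x - s) / 2))" for n x
  have "(\<lambda>n. \<integral>x. D n x \<partial>M) \<longlonglongrightarrow> (\<integral>x. (0::complex) \<partial>M)"
  proof (rule integral_dominated_convergence[where w="\<lambda>x. 1 + exp ((c^2 - s) / 2)"])
    show "AE x in M. (\<lambda>n. D n x) \<longlonglongrightarrow> 0"
      using lim
    proof eventually_elim
      case (elim x)
      then have "(\<lambda>n. 1 - exp ((S n n x - s) / 2)) \<longlonglongrightarrow> 1 - exp ((s - s) / 2)"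
        unfolding S_def by (intro tendsto_intros) auto
      then have "(\<lambda>n. \<bar>1 - exp ((S n n x - s) / 2)\<bar>) \<longlonglongrightarrow> 0" by (simp add: tendsto_rabs_zero)
      then have "(\<lambda>n. cmod (D n x)) \<longlonglongrightarrow> 0" unfolding D_def norm_mult norm_of_real by simp
      then show ?case by (rule tendsto_norm_zero_cancel)
    qed
    fix n
    show "AE x in M. norm (D n x) \<le> 1 + exp ((c^2 - s) / 2)"
      using Sb[of n n, OF order_refl]
    proof eventually_elim
      case (elim x)
      have "\<bar>1 - exp ((S n n x - s) / 2)\<bar> \<le> 1 + exp ((S n n x - s) / 2)" by (simp add: abs_le_iff)
      also have "\<dots> \<le> 1 + exp ((c^2 - s) / 2)" using elim by simp
      finally show ?case unfolding D_def norm_mult norm_of_real by simp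
    qed
    show "D n \<in> borel_measurable M" unfolding D_def by measurable
  qed auto
  then have D0: "(\<lambda>n. \<integral>x. D n x \<partial>M) \<longlonglongrightarrow> 0" by simp
  have "(\<integral>x. iexp (Y n n x) \<partial>M) = (\<integral>x. D n x \<partial>M) + of_real (exp (- s / 2)) * (\<integral>x. Z n n x \<partial>M)" for n
  proof -
    have iY: "integrable M (\<lambda>x. iexp (Y n n x))" by (rule iexp_integrable) (auto intro: finite_measure_axioms)
    have iZ: "integrable M (Z n n)"
      by (rule integrable_bounded[OF _ Zb[of n n, OF order_refl]]) (unfold Z_def, measurable)
    have "D n x = iexp (Y n n x) - of_real (exp (- s / 2)) * Z n n x" for x
      by (simp add: D_def Z_def algebra_simps diff_divide_distrib flip: exp_of_real exp_add)
    then show ?thesis using iY iZ by simp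
  qed
  moreover have "(\<lambda>n. (\<integral>x. D n x \<partial>M) + of_real (exp (- s / 2)) * (\<integral>x. Z n n x \<partial>M)) \<longlonglongrightarrow> 0 + of_real (exp (- s / 2)) * 1"
    by (intro tendsto_intros D0 EZ)
  ultimately show ?thesis by (simp add: Y_def)
qed

subsection \<open>Strong law from second moments\<close>

text \<open>The sum of the squares has finite expectation, hence is finite almost surely, and its
  terms tend to 0.\<close>

lemma (in prob_space) AE_tendsto_zero_second_moment:
  fixes f :: "nat \<Rightarrow> 'a \<Rightarrow> real"
  assumes [measurable]: "\<And>k. f k \<in> borel_measurable M"
    and int: "\<And>k. integrable M (\<lambda>x. (f k x)^2)"
    and sum: "summable (\<lambda>k. expectation (\<lambda>x. (f k x)^2))"
  shows "AE x in M. (\<lambda>k. f k x) \<longlonglongrightarrow> 0"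
proof -
  have "(\<integral>\<^sup>+x. (\<Sum>k. ennreal ((f k x)^2)) \<partial>M) = (\<Sum>k. \<integral>\<^sup>+x. ennreal ((f k x)^2) \<partial>M)"
    by (rule nn_integral_suminf) simp
  also have "\<dots> = (\<Sum>k. ennreal (expectation (\<lambda>x. (f k x)^2)))"
    by (subst nn_integral_eq_integral[OF int]) auto
  also have "\<dots> = ennreal (\<Sum>k. expectation (\<lambda>x. (f k x)^2))"
    by (rule suminf_ennreal2[OF _ sum]) simp
  finally have "(\<integral>\<^sup>+x. (\<Sum>k. ennreal ((f k x)^2)) \<partial>M) \<noteq> \<infinity>" by simp
  then have "AE x in M. (\<Sum>k. ennreal ((f k x)^2)) \<noteq> \<infinity>"
    by (intro nn_integral_PInf_AE) auto
  then show ?thesis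
  proof eventually_elim
    case (elim x)
    then have "summable (\<lambda>k. (f k x)^2)" by (intro summable_suminf_not_top) auto
    then have "(\<lambda>k. (f k x)^2) \<longlonglongrightarrow> 0" by (rule summable_LIMSEQ_zero)
    then have "(\<lambda>k. sqrt ((f k x)^2)) \<longlonglongrightarrow> sqrt 0" by (rule tendsto_real_sqrt)
    then show ?case by (simp add: tendsto_rabs_zero_iff)
  qed
qed

lemma filterlim_floor_sqrt: "filterlim floor_sqrt at_top at_top"
  unfolding filterlim_at_top
proof
  fix k show "\<forall>\<^sub>F n in sequentially. k \<le> floor_sqrt n"
    using eventually_ge_at_top[of "k^2"] by eventually_elim (rule le_floor_sqrtI)
qed

text \<open>From \<open>k^2\<close> at most \<open>2 * k\<close> steps lead to any \<open>n\<close>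
  below the next square, so \<open>x\<close> changes by \<open>O(sqrt n)\<close> in between. Squares
  are used because second moments of order \<open>n\<close>, divided by \<open>n^2\<close>, become
  summable along them.\<close>

lemma tendsto_zero_from_squares:
  fixes x :: "nat \<Rightarrow> real"
  assumes inc: "\<And>n. n \<ge> 1 \<Longrightarrow> \<bar>x (Suc n) - x n\<bar> \<le> c"
    and lim: "(\<lambda>k. x (k^2) / real (k^2)) \<longlonglongrightarrow> 0"
  shows "(\<lambda>n. x n / real n) \<longlonglongrightarrow> 0"
proof -
  have c: "c \<ge> 0" using inc[of 1] by simp
  have diff: "\<bar>x (m + d) - x m\<bar> \<le> c * real d" if "m \<ge> 1" for m d
  proof (induction d)
    case (Suc d)
    have "\<bar>x (Suc (m + d)) - x (m + d)\<bar> \<le> c" using inc[of "m + d"] that by simp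
    then show ?case using Suc by (simp add: algebra_simps)
  qed simp
  let ?s = "\<lambda>n. (floor_sqrt n)^2"
  have "(\<lambda>n. \<bar>x (?s n) / real (?s n)\<bar> + 2 * c * (1 / real (floor_sqrt n))) \<longlonglongrightarrow> \<bar>0\<bar> + 2 * c * 0"
  proof (intro tendsto_intros)
    show "(\<lambda>n. x (?s n) / real (?s n)) \<longlonglongrightarrow> 0"
      using filterlim_compose[OF lim filterlim_floor_sqrt] by simp
    have "(\<lambda>k. 1 / real k) \<longlonglongrightarrow> 0" by real_asymp
    then show "(\<lambda>n. 1 / real (floor_sqrt n)) \<longlonglongrightarrow> 0"
      by (rule filterlim_compose[OF _ filterlim_floor_sqrt])
  qed
  then have "(\<lambda>n. \<bar>x (?s n) / real (?s n)\<bar> + 2 * c * (1 / real (floor_sqrt n))) \<longlonglongrightarrow> 0" by simp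
  then show ?thesis
  proof (rule Lim_null_comparison[rotated])
    show "\<forall>\<^sub>F n in sequentially. norm (x n / real n) \<le> \<bar>x (?s n) / real (?s n)\<bar> + 2 * c * (1 / real (floor_sqrt n))"
      using eventually_ge_at_top[of 1]
    proof eventually_elim
      case (elim n)
      define k where "k = floor_sqrt n"
      have k: "k \<ge> 1" unfolding k_def using elim by (simp add: Suc_le_eq)
      have le: "k^2 \<le> n" and gt: "n < (Suc k)^2" unfolding k_def by (simp_all only: floor_sqrt_power2_le Suc_floor_sqrt_power2_gt)
      then obtain d where n: "n = k^2 + d" using le_Suc_ex by blast
      have d: "d \<le> 2 * k" using gt n by (simp add: power2_eq_square)
      have "k^2 \<ge> 1" using k by simp
      from diff[OF this, of d] have "\<bar>x n\<bar> \<le> \<bar>x (k^2)\<bar> + c * real d" using n by simp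
      also have "\<dots> \<le> \<bar>x (k^2)\<bar> + c * (2 * real k)" using d c by (intro add_left_mono mult_left_mono) auto
      finally have "\<bar>x n\<bar> \<le> \<bar>x (k^2)\<bar> + c * (2 * real k)" .
      then have "\<bar>x n\<bar> / real n \<le> (\<bar>x (k^2)\<bar> + c * (2 * real k)) / real n" by (intro divide_right_mono) auto
      also have "\<dots> \<le> (\<bar>x (k^2)\<bar> + c * (2 * real k)) / real (k^2)"
      proof (rule divide_left_mono)
        show "real (k^2) \<le> real n" using le by (simp only: of_nat_le_iff)
        have "0 < k^2" using k by simp
        then show "0 < real n * real (k^2)" using le by (intro mult_pos_pos) linarith+
      qed (use c in simp)
      also have "\<dots> = \<bar>x (k^2) / real (k^2)\<bar> + 2 * c * (1 / real k)"
        using k by (simp add: add_divide_distrib power2_eq_square)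
      finally show ?case by (simp add: k_def)
    qed
  qed
qed

text \<open>Once \<open>n >= d\<close> the factor \<open>1 - d / n\<close> is nonnegative, and any
  bound \<open>B >= C / d\<close> is preserved: \<open>(1 - d / n) * B + C / n <= B\<close>. The
  finitely many earlier values are added at the end.\<close>

lemma perturbed_contraction_bounded:
  fixes x :: "nat \<Rightarrow> real"
  assumes d: "d > 0" and C: "C \<ge> 0"
    and rec: "\<And>n. n \<ge> 1 \<Longrightarrow> \<bar>x (Suc n) - (1 - d / real n) * x n\<bar> \<le> C / real n"
  shows "\<exists>B. \<forall>n\<ge>1. \<bar>x n\<bar> \<le> B"
proof -
  define m where "m = max 1 (nat \<lceil>d\<rceil>)"
  define B where "B = max \<bar>x m\<bar> (C / d)"
  have tail: "\<bar>x n\<bar> \<le> B" if "n \<ge> m" for n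
    using that
  proof (induction n rule: dec_induct)
    case (step n)
    have n: "real n \<ge> d" "n \<ge> 1" using step.hyps unfolding m_def by linarith+
    then have q: "0 \<le> 1 - d / real n" using d by simp
    have CB: "C \<le> d * B" using d by (simp add: B_def max_def field_simps)
    have "\<bar>x (Suc n)\<bar> \<le> \<bar>(1 - d / real n) * x n\<bar> + C / real n"
      using order.trans[OF abs_triangle_ineq2 rec[OF n(2)]] by (simp only: diff_le_eq add.commute)
    also have "\<bar>(1 - d / real n) * x n\<bar> = (1 - d / real n) * \<bar>x n\<bar>" using q by (simp add: abs_mult)
    also have "(1 - d / real n) * \<bar>x n\<bar> + C / real n \<le> (1 - d / real n) * B + d * B / real n"
      using q step.IH CB by (intro add_mono mult_left_mono divide_right_mono) auto
    also have "\<dots> = B" by (simp add: algebra_simps)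
    finally show ?case .
  qed (simp add: B_def)
  show ?thesis
  proof (intro exI allI impI)
    fix n :: nat assume "1 \<le> n"
    show "\<bar>x n\<bar> \<le> B + (\<Sum>k<m. \<bar>x k\<bar>)"
    proof (cases "n \<ge> m")
      case True
      then show ?thesis using add_increasing2[OF sum_nonneg tail[OF True], of "{..<m}" "\<lambda>k. \<bar>x k\<bar>"] by simp
    next
      case False
      have "0 \<le> B" unfolding B_def by (rule order.trans[OF abs_ge_zero max.cobounded1])
      then show ?thesis using member_le_sum[of n "{..<m}" "\<lambda>k. \<bar>x k\<bar>"] False by simp
    qed
  qed
qed

subsection \<open>Total mass of a two-type preferential recursion\<close>

text \<open>A positive limit would push \<open>f n\<close> above \<open>l / (2 * n)\<close>
  eventually.\<close>

lemma summable_weighted_limit_zero: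
  fixes f :: "nat \<Rightarrow> real"
  assumes f: "summable f" and lim: "(\<lambda>n. real n * f n) \<longlonglongrightarrow> l" and pos: "\<And>n. f n \<ge> 0"
  shows "l = 0"
proof (rule ccontr)
  assume "l \<noteq> 0"
  moreover have "l \<ge> 0" by (rule LIMSEQ_le_const[OF lim]) (use pos in auto)
  ultimately have l: "l > 0" by simp
  have "\<forall>\<^sub>F n in sequentially. real n * f n > l / 2"
    using order_tendstoD(1)[OF lim, of "l/2"] l by simp
  then have "\<forall>\<^sub>F n in sequentially. norm (inverse (real n)) \<le> 2 / l * f n"
    using eventually_gt_at_top[of 0]
  proof eventually_elim
    case (elim n)
    then show ?case using l by (simp add: field_simps)
  qed
  then have "summable (\<lambda>n. inverse (real n))"
    by (rule summable_comparison_test_ev) (intro summable_mult f)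
  then show False using not_summable_harmonic[where 'a=real] by simp
qed

text \<open>Tonelli, through unconditional sums over the product. \<open>B\<close> has the in-degree
  sum inside, whereas the marginal recursion for the in-degree has the out-degree sum
  inside.\<close>

lemma sums_swap_nonneg:
  fixes f :: "nat \<Rightarrow> nat \<Rightarrow> real"
  assumes pos: "\<And>r q. f r q \<ge> 0" and inner: "\<And>r. summable (f r)" and outer: "(\<lambda>r. \<Sum>q. f r q) sums s"
  shows "summable (\<lambda>r. f r q)" "(\<lambda>q. \<Sum>r. f r q) sums s"
proof -
  have in1: "((\<lambda>q. f r q) has_sum (\<Sum>q. f r q)) UNIV" for r
    by (rule sums_nonneg_imp_has_sum[OF summable_sums[OF inner] pos])
  have out1: "((\<lambda>r. \<Sum>q. f r q) has_sum s) UNIV"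
    by (rule sums_nonneg_imp_has_sum[OF outer]) (intro suminf_nonneg inner pos)
  have "(\<lambda>(r,q). f r q) summable_on UNIV \<times> UNIV"
    by (rule summable_on_SigmaI[where g="\<lambda>r. \<Sum>q. f r q"])
      (use in1 out1 pos in \<open>auto simp: summable_on_def\<close>)
  then have hs: "((\<lambda>(r,q). f r q) has_sum s) (UNIV \<times> UNIV)"
    by (intro has_sum_SigmaI[where g="\<lambda>r. \<Sum>q. f r q"]) (use in1 out1 in auto)
  then have hs': "((\<lambda>(q,r). f r q) has_sum s) (UNIV \<times> UNIV)"
    by (subst has_sum_swap) (simp add: case_prod_unfold)
  have s1: "(\<lambda>r. f r q) summable_on UNIV" for q
    using summable_on_SigmaD1[of "\<lambda>q r. f r q" UNIV "\<lambda>_. UNIV" q] hs' by (auto simp: summable_on_def)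
  then show "summable (\<lambda>r. f r q)" by (rule summable_on_imp_summable)
  have "((\<lambda>q. \<Sum>r. f r q) has_sum s) UNIV"
  proof (rule has_sum_SigmaD[OF hs'])
    show "((\<lambda>r. (\<lambda>(q,r). f r q) (q, r)) has_sum (\<Sum>r. f r q)) UNIV" for q
      using sums_nonneg_imp_has_sum[OF summable_sums[OF summable_on_imp_summable[OF s1]] pos] by simp
  qed
  then show "(\<lambda>q. \<Sum>r. f r q) sums s" by (rule has_sum_imp_sums)
qed

text \<open>No mass escapes to infinity: the boundary terms of the summed recursion converge, and a nonzero limit
  would contradict the summability of the masses (compare with the harmonic series).\<close>

lemma preferential_recursion_mass:
  fixes q :: "nat \<Rightarrow> nat \<Rightarrow> real" and x y c d s t :: real
  assumes par: "x + y = 1" "0 < c" "c < 1" "0 < d" "0 < s" "0 < t" "c * (1 + s) = x"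
    and pos: "\<And>k l. 0 \<le> q k l"
    and rec: "\<And>k l. q k l * (1 + c * (real k + s) + d * (real l + t)) =
      (if k = 0 \<and> l = 1 then x else 0) + (if k = 1 \<and> l = 0 then y else 0)
      + (if k = 0 then 0 else c * (real k - 1 + s) * q (k - 1) l)
      + (if l = 0 then 0 else d * (real l - 1 + t) * q k (l - 1))"
    and b1: "\<And>m n. (\<Sum>k<m. \<Sum>l<n. q k l) \<le> 1"
    and b2: "\<And>m n. (\<Sum>k<m. \<Sum>l<n. real k * q k l) \<le> 1"
    and b3: "\<And>m n. (\<Sum>k<m. \<Sum>l<n. real l * q k l) \<le> 1"
  shows "summable (q k)" and "(\<lambda>k. c * (real k + s) * (\<Sum>l. q k l)) sums x"
proof -
  have one: "(\<Sum>l<n. h k l) \<le> (\<Sum>k'<Suc k. \<Sum>l<n. h k' l)" if "\<And>k l. h k l \<ge> 0" for h :: "nat \<Rightarrow> nat \<Rightarrow> real" and k n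
    using member_le_sum[of k "{..<Suc k}" "\<lambda>k'. \<Sum>l<n. h k' l"] that by (auto intro!: sum_nonneg)
  show sq: "summable (q k)" for k
    by (rule bounded_imp_summable[where B=1])
      (use pos order.trans[OF one[of q] b1] order.trans[OF one[of q k "Suc _"] b1] in \<open>auto simp: lessThan_Suc_atMost\<close>)
  have slq: "summable (\<lambda>l. real l * q k l)" for k
    by (rule bounded_imp_summable[where B=1])
      (use pos order.trans[OF one[of "\<lambda>k l. real l * q k l" k "Suc _"] b3] in \<open>auto simp: lessThan_Suc_atMost\<close>)
  define P where "P k = (\<Sum>l. q k l)" for k
  have Ppos: "P k \<ge> 0" for k unfolding P_def by (rule suminf_nonneg[OF sq pos])
  have Psums: "q k sums P k" for k unfolding P_def by (rule summable_sums[OF sq])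
  have PB: "(\<Sum>k<m. P k) \<le> 1" for m
  proof -
    have "(\<lambda>n. \<Sum>k<m. \<Sum>l<n. q k l) \<longlonglongrightarrow> (\<Sum>k<m. P k)"
      using Psums by (intro tendsto_sum) (simp add: sums_def)
    then show ?thesis by (rule LIMSEQ_le_const2) (use b1 in auto)
  qed
  have kPB: "(\<Sum>k<m. real k * P k) \<le> 1" for m
  proof -
    have "(\<lambda>n. \<Sum>k<m. \<Sum>l<n. real k * q k l) \<longlonglongrightarrow> (\<Sum>k<m. real k * P k)"
      unfolding sum_distrib_left[symmetric] using Psums by (intro tendsto_sum tendsto_mult_left) (simp add: sums_def)
    then show ?thesis by (rule LIMSEQ_le_const2) (use b2 in auto)
  qed
  have sP: "summable P"
    by (rule bounded_imp_summable[where B=1]) (use Ppos PB[of "Suc _"] in \<open>auto simp: lessThan_Suc_atMost\<close>)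
  have skP: "summable (\<lambda>k. real k * P k)"
    by (rule bounded_imp_summable[where B=1]) (use Ppos kPB[of "Suc _"] in \<open>auto simp: lessThan_Suc_atMost\<close>)
  \<comment> \<open>Summation over \<open>l\<close> cancels the transitions of the second coordinate
    and leaves a recursion for the first marginal.\<close>
  have recP: "P k * (1 + c * (real k + s)) = (if k = 0 then x else 0) + (if k = 1 then y else 0)
      + (if k = 0 then 0 else c * (real k - 1 + s) * P (k - 1))" for k
  proof -
    \<comment> \<open>\<open>T l\<close> is the flow into \<open>l\<close> and
      \<open>T (Suc l)\<close> the flow out of it; the differences sum to 0 because
      \<open>T 0 = 0\<close> and the flow vanishes at infinity.\<close>
    define T where "T l = (if l = 0 then 0 else d * (real l - 1 + t) * q k (l - 1))" for l
    have TS: "T (Suc l) = d * (real l + t) * q k l" for l by (simp add: T_def)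
    have "(\<lambda>l. d * (real l * q k l) + d * t * q k l) \<longlonglongrightarrow> d * 0 + d * t * 0"
      by (intro tendsto_intros summable_LIMSEQ_zero slq sq)
    then have "(\<lambda>l. T (Suc l)) \<longlonglongrightarrow> 0" by (simp add: TS algebra_simps)
    then have "T \<longlonglongrightarrow> 0" by (simp add: filterlim_sequentially_Suc)
    from telescope_sums'[OF this] have Tsum: "(\<lambda>l. T l - T (Suc l)) sums 0" by (simp add: T_def)
    have "(\<lambda>l. (if l = 1 then (if k = 0 then x else 0) else 0) + (if l = 0 then (if k = 1 then y else 0) else 0)
        + (if k = 0 then 0 else c * (real k - 1 + s)) * q (k - 1) l + (T l - T (Suc l)))
      sums ((if k = 0 then x else 0) + (if k = 1 then y else 0)
        + (if k = 0 then 0 else c * (real k - 1 + s)) * P (k - 1) + 0)"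
      by (intro sums_add sums_mult Psums Tsum sums_single)
    moreover have "(\<lambda>l. (if l = 1 then (if k = 0 then x else 0) else 0) + (if l = 0 then (if k = 1 then y else 0) else 0)
        + (if k = 0 then 0 else c * (real k - 1 + s)) * q (k - 1) l + (T l - T (Suc l)))
        = (\<lambda>l. q k l * (1 + c * (real k + s)))"
    proof
      fix l
      have "T l = (if l = 0 then 0 else d * (real l - 1 + t) * q k (l - 1))" by (simp add: T_def)
      then show "(if l = 1 then (if k = 0 then x else 0) else 0) + (if l = 0 then (if k = 1 then y else 0) else 0)
        + (if k = 0 then 0 else c * (real k - 1 + s)) * q (k - 1) l + (T l - T (Suc l)) = q k l * (1 + c * (real k + s))"
        using rec[of k l] unfolding TS by (auto simp: algebra_simps split: if_splits)
    qed
    ultimately have "(\<lambda>l. q k l * (1 + c * (real k + s))) sums ((if k = 0 then x else 0) + (if k = 1 then y else 0)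
        + (if k = 0 then 0 else c * (real k - 1 + s)) * P (k - 1) + 0)" by simp
    moreover have "(\<lambda>l. q k l * (1 + c * (real k + s))) sums (P k * (1 + c * (real k + s)))"
      by (intro sums_mult2 Psums)
    ultimately show ?thesis using sums_unique2 by fastforce
  qed
  \<comment> \<open>The flow from \<open>k\<close> to \<open>Suc k\<close>; the claim is that it
    sums to \<open>x\<close>.\<close>
  define D where "D k = c * (real k + s) * P k" for k
  have Dpos: "D k \<ge> 0" for k using Ppos par by (simp add: D_def)
  have PD0: "P 0 = x - D 0" and PD: "P (Suc k) = (if k = 0 then y else 0) + D k - D (Suc k)" for k
    using recP[of 0] recP[of "Suc k"] by (auto simp: D_def algebra_simps)
  have Dalt: "D = (\<lambda>k. c * (real k * P k) + c * s * P k)" by (simp add: D_def fun_eq_iff algebra_simps)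
  have sD: "summable D" unfolding Dalt by (intro summable_add summable_mult skP sP)
  have part: "(\<Sum>k<Suc (Suc n). P k) = 1 - D (Suc n)" for n
  proof (induction n)
    case 0
    show ?case using PD0 PD[of 0] par by simp
  next
    case (Suc n)
    then show ?case using PD[of "Suc n"] sum.lessThan_Suc[of P "Suc (Suc n)"] by simp
  qed
  have "(\<lambda>n. 1 - D (Suc n)) \<longlonglongrightarrow> 1 - 0"
    by (intro tendsto_intros LIMSEQ_Suc summable_LIMSEQ_zero sD)
  moreover have "(\<lambda>n. \<Sum>k<Suc (Suc n). P k) \<longlonglongrightarrow> suminf P"
    by (intro LIMSEQ_Suc summable_LIMSEQ sP)
  ultimately have sumP: "suminf P = 1"
    unfolding part using LIMSEQ_unique by fastforce
  \<comment> \<open>Summation by parts. The boundary term \<open>n * D n\<close> converges because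
    all other terms do, and summability of \<open>D\<close> makes its limit 0.\<close>
  have partk: "(\<Sum>k<Suc (Suc n). real k * P k) = y + (\<Sum>k<Suc n. D k) - real (Suc n) * D (Suc n)" for n
  proof (induction n)
    case 0
    show ?case using PD[of 0] by simp
  next
    case (Suc n)
    have "(\<Sum>k<Suc (Suc (Suc n)). real k * P k) = y + (\<Sum>k<Suc n. D k) - real (Suc n) * D (Suc n) + real (Suc (Suc n)) * P (Suc (Suc n))"
      by (subst sum.lessThan_Suc) (simp only: Suc)
    also have "P (Suc (Suc n)) = D (Suc n) - D (Suc (Suc n))" using PD[of "Suc n"] by simp
    also have "y + (\<Sum>k<Suc n. D k) - real (Suc n) * D (Suc n) + real (Suc (Suc n)) * (D (Suc n) - D (Suc (Suc n)))
      = y + ((\<Sum>k<Suc n. D k) + D (Suc n)) - real (Suc (Suc n)) * D (Suc (Suc n))"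
      by (simp add: algebra_simps)
    also have "(\<Sum>k<Suc n. D k) + D (Suc n) = (\<Sum>k<Suc (Suc n). D k)"
      by (rule sum.lessThan_Suc[symmetric])
    finally show ?case .
  qed
  have lk: "(\<lambda>n. \<Sum>k<Suc (Suc n). real k * P k) \<longlonglongrightarrow> (\<Sum>k. real k * P k)"
    by (intro LIMSEQ_Suc summable_LIMSEQ skP)
  have lD: "(\<lambda>n. \<Sum>k<Suc n. D k) \<longlonglongrightarrow> suminf D"
    by (intro LIMSEQ_Suc summable_LIMSEQ sD)
  have "(\<lambda>n. y + (\<Sum>k<Suc n. D k) - (\<Sum>k<Suc (Suc n). real k * P k)) \<longlonglongrightarrow> y + suminf D - (\<Sum>k. real k * P k)"
    by (intro tendsto_intros lk lD)
  then have "(\<lambda>n. real (Suc n) * D (Suc n)) \<longlonglongrightarrow> y + suminf D - (\<Sum>k. real k * P k)"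
    unfolding partk by simp
  then have "(\<lambda>n. real n * D n) \<longlonglongrightarrow> y + suminf D - (\<Sum>k. real k * P k)"
    by (simp only: filterlim_sequentially_Suc[of "\<lambda>n. real n * D n"])
  from summable_weighted_limit_zero[OF sD this Dpos]
  have m: "(\<Sum>k. real k * P k) = y + suminf D" by simp
  have "suminf D = c * (\<Sum>k. real k * P k) + c * s * suminf P"
    unfolding Dalt using skP sP by (subst suminf_add[symmetric]) (auto intro!: summable_mult simp: suminf_mult)
  \<comment> \<open>Eliminating the mean from \<open>suminf D = c * mean + c * s\<close> and
    \<open>mean = y + suminf D\<close> leaves a linear equation. It is solvable since
    \<open>c < 1\<close>, and \<open>c * (1 + s) = x\<close> with \<open>x + y = 1\<close> makes the
    solution \<open>x\<close>.\<close>
  then have "suminf D * (1 - c) = c * (y + s)" unfolding m sumP by (simp add: algebra_simps)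
  also have "\<dots> = x * (1 - c)"
  proof -
    have y: "y = 1 - c * (1 + s)" using par by simp
    show ?thesis unfolding par(7)[symmetric] y by (simp add: algebra_simps)
  qed
  finally have "suminf D = x" using par by simp
  then show "(\<lambda>k. c * (real k + s) * (\<Sum>l. q k l)) sums x"
    using summable_sums[OF sD] by (simp add: D_def[abs_def] P_def)
qed

subsection \<open>Degree sums and transitions of the graph\<close>

definition indeg :: "nat pair_pre_digraph \<Rightarrow> nat \<Rightarrow> nat" where
  "indeg g v = in_degree (with_proj g) v"

definition outdeg :: "nat pair_pre_digraph \<Rightarrow> nat \<Rightarrow> nat" where
  "outdeg g v = out_degree (with_proj g) v"

definition deg_sum :: "(nat \<Rightarrow> nat \<Rightarrow> real) \<Rightarrow> nat \<Rightarrow> nat pair_pre_digraph \<Rightarrow> real" where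
  "deg_sum f n g = (\<Sum>v=1..n. f (indeg g v) (outdeg g v))"

definition add_from :: "nat \<Rightarrow> nat \<Rightarrow> nat pair_pre_digraph \<Rightarrow> nat pair_pre_digraph" where
  "add_from n v g = \<lparr>pverts = {1..Suc n}, parcs = insert (Suc n, v) (parcs g)\<rparr>"

definition add_to :: "nat \<Rightarrow> nat \<Rightarrow> nat pair_pre_digraph \<Rightarrow> nat pair_pre_digraph" where
  "add_to n v g = \<lparr>pverts = {1..Suc n}, parcs = insert (v, Suc n) (parcs g)\<rparr>"

definition graphs :: "nat \<Rightarrow> nat pair_pre_digraph set" where
  "graphs n = {g. pverts g = {1..n} \<and> parcs g \<subseteq> {1..n} \<times> {1..n}}"

lemma indeg_altdef: "indeg g v = card {a \<in> parcs g. snd a = v}"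
  by (simp add: indeg_def in_degree_def in_arcs_def with_proj_def)

lemma outdeg_altdef: "outdeg g v = card {a \<in> parcs g. fst a = v}"
  by (simp add: outdeg_def out_degree_def out_arcs_def with_proj_def)

text \<open>The finite state space at each stage makes every real function of \<open>G n\<close>
  bounded and integrable.\<close>

lemma finite_graphs: "finite (graphs n)"
proof -
  have "graphs n \<subseteq> (\<lambda>E. \<lparr>pverts = {1..n}, parcs = E\<rparr>) ` Pow ({1..n} \<times> {1..n})"
  proof
    fix x assume x: "x \<in> graphs n"
    then have "x = (\<lambda>E. \<lparr>pverts = {1..n}, parcs = E\<rparr>) (parcs x)" by (simp add: graphs_def)
    then show "x \<in> (\<lambda>E. \<lparr>pverts = {1..n}, parcs = E\<rparr>) ` Pow ({1..n} \<times> {1..n})"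
      by (rule image_eqI) (use x in \<open>simp add: graphs_def\<close>)
  qed
  then show ?thesis by (rule finite_subset) simp
qed

lemma graphs_finite_parcs: "g \<in> graphs n \<Longrightarrow> finite (parcs g)"
  by (auto simp: graphs_def intro: finite_subset)

lemma card_insert_filter:
  assumes "finite E" "a \<notin> E"
  shows "card {x \<in> insert a E. P x} = card {x \<in> E. P x} + (if P a then 1 else 0)"
proof (cases "P a")
  case True
  then have "{x \<in> insert a E. P x} = insert a {x \<in> E. P x}" by auto
  then show ?thesis using assms True by simp
next
  case False
  then have "{x \<in> insert a E. P x} = {x \<in> E. P x}" by auto
  then show ?thesis using False by simp
qed

lemma degrees_add:
  assumes g: "g \<in> graphs n" and v: "v \<in> {1..n}"
  shows "indeg (add_from n v g) u = indeg g u + (if u = v then 1 else 0)"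
    and "outdeg (add_from n v g) u = outdeg g u + (if u = Suc n then 1 else 0)"
    and "indeg (add_to n v g) u = indeg g u + (if u = Suc n then 1 else 0)"
    and "outdeg (add_to n v g) u = outdeg g u + (if u = v then 1 else 0)"
    and "indeg g (Suc n) = 0" "outdeg g (Suc n) = 0"
proof -
  have new: "(Suc n, v) \<notin> parcs g" "(v, Suc n) \<notin> parcs g"
    using g by (auto simp: graphs_def)
  note fin = graphs_finite_parcs[OF g]
  show "indeg (add_from n v g) u = indeg g u + (if u = v then 1 else 0)"
    and "outdeg (add_from n v g) u = outdeg g u + (if u = Suc n then 1 else 0)"
    and "indeg (add_to n v g) u = indeg g u + (if u = Suc n then 1 else 0)"
    and "outdeg (add_to n v g) u = outdeg g u + (if u = v then 1 else 0)"
    using card_insert_filter[OF fin new(1)] card_insert_filter[OF fin new(2)]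
    by (auto simp: indeg_altdef outdeg_altdef add_from_def add_to_def)
  have "{a \<in> parcs g. snd a = Suc n} = {}" "{a \<in> parcs g. fst a = Suc n} = {}"
    using g by (auto simp: graphs_def)
  then show "indeg g (Suc n) = 0" "outdeg g (Suc n) = 0"
    by (simp_all only: indeg_altdef outdeg_altdef card.empty)
qed

text \<open>Only the chosen vertex changes its degree, and the newborn enters with degree
  \<open>(0, 1)\<close> or \<open>(1, 0)\<close>.\<close>

lemma deg_sum_add:
  assumes g: "g \<in> graphs n" and v: "v \<in> {1..n}"
  shows "deg_sum f (Suc n) (add_from n v g) = deg_sum f n g
           + (f 0 1 + f (Suc (indeg g v)) (outdeg g v) - f (indeg g v) (outdeg g v))" (is ?A)
    and "deg_sum f (Suc n) (add_to n v g) = deg_sum f n g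
           + (f 1 0 + f (indeg g v) (Suc (outdeg g v)) - f (indeg g v) (outdeg g v))" (is ?B)
proof -
  have *: "(\<Sum>u=1..n. h u) = (\<Sum>u=1..n. k u) + (h v - k v)"
    if "\<And>u. u \<in> {1..n} \<Longrightarrow> u \<noteq> v \<Longrightarrow> h u = k u" for h k :: "nat \<Rightarrow> real"
  proof -
    have "(\<Sum>u=1..n. h u - k u) = (\<Sum>u=1..n. if u = v then h v - k v else 0)"
      by (rule sum.cong) (use that in auto)
    also have "\<dots> = h v - k v" using v by simp
    finally show ?thesis by (simp add: sum_subtractf)
  qed
  note d = degrees_add[OF g v]
  have v': "v \<noteq> Suc n" using v by simp
  have "(\<Sum>u=1..n. f (indeg (add_from n v g) u) (outdeg (add_from n v g) u)) = deg_sum f n g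
      + (f (Suc (indeg g v)) (outdeg g v) - f (indeg g v) (outdeg g v))"
    unfolding deg_sum_def by (subst *[where k="\<lambda>u. f (indeg g u) (outdeg g u)"]) (use v' in \<open>auto simp: d\<close>)
  then show ?A using v' by (simp add: deg_sum_def d)
  have "(\<Sum>u=1..n. f (indeg (add_to n v g) u) (outdeg (add_to n v g) u)) = deg_sum f n g
      + (f (indeg g v) (Suc (outdeg g v)) - f (indeg g v) (outdeg g v))"
    unfolding deg_sum_def by (subst *[where k="\<lambda>u. f (indeg g u) (outdeg g u)"]) (use v' in \<open>auto simp: d\<close>)
  then show ?B using v' by (simp add: deg_sum_def d)
qed

lemma deg_sum_linear:
  "deg_sum (\<lambda>k l. f k l + h k l) n g = deg_sum f n g + deg_sum h n g"
  "deg_sum (\<lambda>k l. f k l - h k l) n g = deg_sum f n g - deg_sum h n g"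
  "deg_sum (\<lambda>k l. c * f k l) n g = c * deg_sum f n g"
  "deg_sum (\<lambda>k l. c) n g = c * real n"
  by (simp_all add: deg_sum_def sum.distrib sum_subtractf sum_distrib_left)

context directed_pa
begin

lemma G_graphs: "n \<ge> 1 \<Longrightarrow> \<omega> \<in> space M \<Longrightarrow> G n \<omega> \<in> graphs n"
  using nodes_G by (auto simp: graphs_def)

lemma space_history [simp]: "space (history M G n) = space M"
  by (simp add: history_def space_measure_of_conv)

lemma sets_history: "sets (history M G n) = sigma_sets (space M) {G m -` A \<inter> space M | m A. m \<in> {1..n}}"
  by (simp add: history_def sets_measure_of_conv) auto

lemma G_history: "1 \<le> m \<Longrightarrow> m \<le> n \<Longrightarrow> G m \<in> measurable (history M G n) (count_space UNIV)"
  by (rule measurableI) (auto simp: sets_history intro!: sigma_sets.Basic)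

lemma history_borel:
  "1 \<le> m \<Longrightarrow> m \<le> n \<Longrightarrow> (\<lambda>\<omega>. f (G m \<omega>)) \<in> borel_measurable (history M G n)"
  by (rule measurable_compose[OF G_history]) auto

lemma history_mono: "n \<le> m \<Longrightarrow> sets (history M G n) \<subseteq> sets (history M G m)"
  unfolding sets_history by (rule sigma_sets_mono') force

lemma subalgebra_history: "subalgebra M (history M G n)"
proof -
  have "{G m -` A \<inter> space M | m A. m \<in> {1..n}} \<subseteq> sets M"
    using measurable_sets[OF measurable_G] by auto
  then show ?thesis
    unfolding subalgebra_def by (simp add: sets_history sets.sigma_sets_subset)
qed

lemma subalg_history: "finite_measure_subalgebra M (history M G n)"
  using subalgebra_history by unfold_locales

lemma G_graphs_measurable: "n \<ge> 1 \<Longrightarrow> G n \<in> measurable M (count_space (graphs n))"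
  using measurable_sets[OF measurable_G] by (intro measurableI) (auto simp: G_graphs)

text \<open>The finitely many values of \<open>G n\<close> partition the space, and on each piece
  the graph argument is fixed.\<close>

lemma measurable_G_dep:
  assumes "n \<ge> 1" "\<And>g. g \<in> graphs n \<Longrightarrow> f g \<in> measurable M S"
  shows "(\<lambda>\<omega>. f (G n \<omega>) \<omega>) \<in> measurable M S"
  by (rule measurable_compose_countable'[OF _ G_graphs_measurable])
    (use assms finite_graphs in \<open>auto intro: countable_finite\<close>)

lemma measurable_of_G: "n \<ge> 1 \<Longrightarrow> (\<lambda>\<omega>. f (G n \<omega>)) \<in> borel_measurable M"
  by (rule measurable_compose[OF measurable_G]) auto

lemma bounded_of_G:
  fixes f :: "nat pair_pre_digraph \<Rightarrow> real"
  shows "n \<ge> 1 \<Longrightarrow> \<omega> \<in> space M \<Longrightarrow> \<bar>f (G n \<omega>)\<bar> \<le> (\<Sum>g\<in>graphs n. \<bar>f g\<bar>)"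
  using member_le_sum[of "G n \<omega>" "graphs n" "\<lambda>g. \<bar>f g\<bar>"] G_graphs finite_graphs by auto

lemma integrable_of_G:
  fixes f :: "nat pair_pre_digraph \<Rightarrow> real"
  assumes "n \<ge> 1" shows "integrable M (\<lambda>\<omega>. f (G n \<omega>))"
  by (rule integrable_const_bound[where B="\<Sum>g\<in>graphs n. \<bar>f g\<bar>"])
    (use assms measurable_of_G bounded_of_G in auto)

section \<open>One-step transitions and their conditional probabilities\<close>

definition Ev1 :: "nat \<Rightarrow> nat \<Rightarrow> 'w set" where
  "Ev1 n v = {\<omega> \<in> space M. G (Suc n) \<omega> = add_from n v (G n \<omega>)}"

definition Ev2 :: "nat \<Rightarrow> nat \<Rightarrow> 'w set" where
  "Ev2 n v = {\<omega> \<in> space M. G (Suc n) \<omega> = add_to n v (G n \<omega>)}"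

lemma Ev_sets [measurable]:
  assumes "n \<ge> 1" shows "Ev1 n v \<in> sets M" "Ev2 n v \<in> sets M"
proof -
  have "{\<omega> \<in> space M. G (Suc n) \<omega> = f (G n \<omega>)} \<in> sets M" for f
  proof -
    have "Measurable.pred M (\<lambda>\<omega>. G (Suc n) \<omega> = f (G n \<omega>))"
    proof (rule measurable_G_dep[OF assms])
      fix g 
      have "G (Suc n) -` {f g} \<inter> space M \<in> sets M" by (rule measurable_sets[OF measurable_G]) auto
      moreover have "G (Suc n) -` {f g} \<inter> space M = {\<omega> \<in> space M. G (Suc n) \<omega> = f g}" by auto
      ultimately show "Measurable.pred M (\<lambda>\<omega>. G (Suc n) \<omega> = f g)" by (simp add: pred_def)
    qed
    then show ?thesis by (simp add: pred_def)
  qed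
  then show "Ev1 n v \<in> sets M" "Ev2 n v \<in> sets M" by (auto simp: Ev1_def Ev2_def)
qed

lemma cond_exp_Ev:
  assumes "n \<ge> 1" "v \<in> {1..n}"
  shows "AE \<omega> in M. real_cond_exp M (history M G n) (indicator (Ev1 n v)) \<omega>
            = c1 * (real (indeg (G n \<omega>) v) + lam) / real n"
    and "AE \<omega> in M. real_cond_exp M (history M G n) (indicator (Ev2 n v)) \<omega>
            = c2 * (real (outdeg (G n \<omega>) v) + mu) / real n"
  using step_from_new[OF assms] step_to_new[OF assms]
  by (simp_all add: Ev1_def Ev2_def add_from_def add_to_def c1_def c2_def indeg_def outdeg_def)

text \<open>The added edge is absent from \<open>G n\<close>, so it can be recovered from the two
  consecutive graphs.\<close>

lemma Ev_disjoint:
  assumes "n \<ge> 1" "v \<in> {1..n}" "w \<in> {1..n}"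
  shows "\<omega> \<in> Ev1 n v \<Longrightarrow> \<omega> \<in> Ev1 n w \<Longrightarrow> v = w" "\<omega> \<in> Ev2 n v \<Longrightarrow> \<omega> \<in> Ev2 n w \<Longrightarrow> v = w"
    "\<omega> \<in> Ev1 n v \<Longrightarrow> \<omega> \<notin> Ev2 n w"
proof -
  have sub: "parcs (G n \<omega>) \<subseteq> {1..n} \<times> {1..n}" if "\<omega> \<in> space M"
    using nodes_G[OF assms(1) that] by simp
  have new: "(Suc n, v) \<notin> parcs (G n \<omega>)" "(v, Suc n) \<notin> parcs (G n \<omega>)" if "\<omega> \<in> space M" for v
    using sub[OF that] by auto
  show "\<omega> \<in> Ev1 n v \<Longrightarrow> \<omega> \<in> Ev1 n w \<Longrightarrow> v = w" "\<omega> \<in> Ev2 n v \<Longrightarrow> \<omega> \<in> Ev2 n w \<Longrightarrow> v = w"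
    "\<omega> \<in> Ev1 n v \<Longrightarrow> \<omega> \<notin> Ev2 n w"
    using new assms by (auto simp: Ev1_def Ev2_def add_from_def add_to_def set_eq_iff insert_ident; force)+
qed

text \<open>The self-loop and one edge per step give \<open>n\<close> edges on \<open>n\<close>
  nodes, hence both totals; the last conjunct excludes degree \<open>(0, 0)\<close>.\<close>

definition regular :: "nat \<Rightarrow> 'w \<Rightarrow> bool" where
  "regular n \<omega> \<longleftrightarrow> deg_sum (\<lambda>k l. real k) n (G n \<omega>) = n \<and> deg_sum (\<lambda>k l. real l) n (G n \<omega>) = n \<and>
     (\<forall>v\<in>{1..n}. indeg (G n \<omega>) v + outdeg (G n \<omega>) v > 0)"

definition transition :: "nat \<Rightarrow> 'w \<Rightarrow> bool" where
  "transition n \<omega> \<longleftrightarrow> (\<exists>v\<in>{1..n}. \<omega> \<in> Ev1 n v \<or> \<omega> \<in> Ev2 n v)"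

lemma c_pos: "c1 > 0" "c2 > 0"
  using params_pos by (auto simp: c1_def c2_def)

lemma c_sum: "c1 * (1 + lam) + c2 * (1 + mu) = 1"
  using params_pos params_sum by (simp add: c1_def c2_def)

lemma delta_pos: "\<delta> k l > 0"
  using c_pos params_pos by (simp add: \<delta>_def add_pos_pos)

text \<open>The total selection weight: divided by \<open>n\<close>, the conditional probabilities
  of all transitions add up to 1.\<close>

lemma regular_deg_sum_delta:
  assumes "regular n \<omega>" shows "deg_sum \<delta> n (G n \<omega>) = n"
proof -
  have d: "\<delta> = (\<lambda>k l. c1 * real k + (c2 * real l + (c1 * lam + c2 * mu)))"
    by (simp add: \<delta>_def fun_eq_iff algebra_simps)
  have "deg_sum \<delta> n (G n \<omega>) = (c1 * (1 + lam) + c2 * (1 + mu)) * n"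
    using assms unfolding d deg_sum_linear by (simp add: regular_def algebra_simps)
  then show ?thesis by (simp add: c_sum)
qed

lemma regular_step:
  assumes n: "n \<ge> 1" and "regular n \<omega>" "transition n \<omega>" shows "regular (Suc n) \<omega>"
proof -
  have sp: "\<omega> \<in> space M" using assms(3) by (auto simp: transition_def Ev1_def Ev2_def)
  note g = G_graphs[OF n sp]
  from assms(3) obtain v where v: "v \<in> {1..n}" and "\<omega> \<in> Ev1 n v \<or> \<omega> \<in> Ev2 n v" by (auto simp: transition_def)
  then consider "G (Suc n) \<omega> = add_from n v (G n \<omega>)" | "G (Suc n) \<omega> = add_to n v (G n \<omega>)"
    by (auto simp: Ev1_def Ev2_def)
  then show ?thesis
  proof cases
    case 1
    have "indeg (G (Suc n) \<omega>) u + outdeg (G (Suc n) \<omega>) u > 0" if "u \<in> {1..Suc n}" for u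
      using assms(2) that by (cases "u = Suc n") (auto simp: 1 degrees_add[OF g v] regular_def)
    then show ?thesis using assms(2) by (auto simp: regular_def 1 deg_sum_add[OF g v])
  next
    case 2
    have "indeg (G (Suc n) \<omega>) u + outdeg (G (Suc n) \<omega>) u > 0" if "u \<in> {1..Suc n}" for u
      using assms(2) that by (cases "u = Suc n") (auto simp: 2 degrees_add[OF g v] regular_def)
    then show ?thesis using assms(2) by (auto simp: regular_def 2 deg_sum_add[OF g v])
  qed
qed

text \<open>The \<open>2 * n\<close> events are disjoint, and their total probability is the mean of
  \<open>deg_sum \<delta> n (G n \<omega>) / n\<close>, which is 1. Hence their complement is a null
  set.\<close>

lemma AE_transition_of_regular:
  assumes n: "n \<ge> 1" and reg: "AE \<omega> in M. regular n \<omega>"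
  shows "AE \<omega> in M. transition n \<omega>"
proof -
  interpret F: finite_measure_subalgebra M "history M G n" by (rule subalg_history)
  note [measurable] = Ev_sets[OF n]
  define I where "I = {1..n} <+> {1..n}"
  define E where "E i = (case i of Inl v \<Rightarrow> Ev1 n v | Inr v \<Rightarrow> Ev2 n v)" for i
  have E[measurable]: "E i \<in> sets M" for i unfolding E_def using Ev_sets[OF n] by (cases i) auto
  have iE: "integrable M (indicator (Ev1 n v) :: 'w \<Rightarrow> real)" "integrable M (indicator (Ev2 n v) :: 'w \<Rightarrow> real)" for v
    by (auto intro!: integrable_const_bound[where B=1])
  have p1: "prob (Ev1 n v) = expectation (\<lambda>\<omega>. c1 * (real (indeg (G n \<omega>) v) + lam) / real n)" if "v \<in> {1..n}" for v
  proof -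
    have "expectation (indicator (Ev1 n v)) = expectation (real_cond_exp M (history M G n) (indicator (Ev1 n v)))"
      using F.real_cond_exp_int(2)[OF iE(1)] by simp
    also have "\<dots> = expectation (\<lambda>\<omega>. c1 * (real (indeg (G n \<omega>) v) + lam) / real n)"
      by (rule integral_cong_AE) (use cond_exp_Ev(1)[OF n that] measurable_of_G[OF n] in auto)
    finally show ?thesis by simp
  qed
  have p2: "prob (Ev2 n v) = expectation (\<lambda>\<omega>. c2 * (real (outdeg (G n \<omega>) v) + mu) / real n)" if "v \<in> {1..n}" for v
  proof -
    have "expectation (indicator (Ev2 n v)) = expectation (real_cond_exp M (history M G n) (indicator (Ev2 n v)))"
      using F.real_cond_exp_int(2)[OF iE(2)] by simp
    also have "\<dots> = expectation (\<lambda>\<omega>. c2 * (real (outdeg (G n \<omega>) v) + mu) / real n)"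
      by (rule integral_cong_AE) (use cond_exp_Ev(2)[OF n that] measurable_of_G[OF n] in auto)
    finally show ?thesis by simp
  qed
  have int1: "integrable M (\<lambda>\<omega>. c1 * (real (indeg (G n \<omega>) v) + lam) / real n)" 
    and int2: "integrable M (\<lambda>\<omega>. c2 * (real (outdeg (G n \<omega>) v) + mu) / real n)" for v
    using integrable_of_G[OF n, of "\<lambda>g. c1 * (real (indeg g v) + lam) / real n"]
      integrable_of_G[OF n, of "\<lambda>g. c2 * (real (outdeg g v) + mu) / real n"] by auto
  have "prob (\<Union>i\<in>I. E i) = (\<Sum>i\<in>I. prob (E i))"
  proof (rule finite_measure_finite_Union)
    show "disjoint_family_on E I"
      unfolding disjoint_family_on_def
    proof (intro ballI impI)
      fix i j assume ij: "i \<in> I" "j \<in> I" "i \<noteq> j"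
      have False if "\<omega> \<in> E i" "\<omega> \<in> E j" for \<omega>
      proof (cases i; cases j)
        fix v w assume "i = Inl v" "j = Inl w"
        then show False using ij that Ev_disjoint(1)[OF n, of v w \<omega>] by (auto simp: I_def E_def)
      next
        fix v w assume "i = Inl v" "j = Inr w"
        then show False using ij that Ev_disjoint(3)[OF n, of v w \<omega>] by (auto simp: I_def E_def)
      next
        fix v w assume "i = Inr v" "j = Inl w"
        then show False using ij that Ev_disjoint(3)[OF n, of w v \<omega>] by (auto simp: I_def E_def)
      next
        fix v w assume "i = Inr v" "j = Inr w"
        then show False using ij that Ev_disjoint(2)[OF n, of v w \<omega>] by (auto simp: I_def E_def)
      qed
      then show "E i \<inter> E j = {}" by blast
    qed
  qed (auto simp: I_def)
  also have "\<dots> = (\<Sum>v=1..n. prob (Ev1 n v)) + (\<Sum>v=1..n. prob (Ev2 n v))"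
    unfolding I_def by (subst sum.Plus) (auto simp: E_def)
  also have "\<dots> = (\<Sum>v=1..n. expectation (\<lambda>\<omega>. c1 * (real (indeg (G n \<omega>) v) + lam) / real n)) +
      (\<Sum>v=1..n. expectation (\<lambda>\<omega>. c2 * (real (outdeg (G n \<omega>) v) + mu) / real n))"
    using p1 p2 by simp
  also have "\<dots> = expectation (\<lambda>\<omega>. (\<Sum>v=1..n. c1 * (real (indeg (G n \<omega>) v) + lam) / real n) +
      (\<Sum>v=1..n. c2 * (real (outdeg (G n \<omega>) v) + mu) / real n))"
    using int1 int2 by (subst Bochner_Integration.integral_add)
      (simp_all only: Bochner_Integration.integral_sum Bochner_Integration.integrable_sum)
  also have "\<dots> = expectation (\<lambda>\<omega>. deg_sum \<delta> n (G n \<omega>) / n)"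
    by (simp add: deg_sum_def \<delta>_def sum.distrib sum_divide_distrib add_divide_distrib)
  also have "\<dots> = expectation (\<lambda>\<omega>. 1)"
    using n reg by (intro integral_cong_AE) (auto intro: measurable_of_G simp: regular_deg_sum_delta)
  finally have "prob (\<Union>i\<in>I. E i) = 1" by (simp add: prob_space)
  then have "AE \<omega> in M. \<omega> \<in> (\<Union>i\<in>I. E i)"
    by (subst AE_in_set_eq_1) (auto simp: I_def)
  then show ?thesis
    by eventually_elim (auto simp: transition_def I_def E_def)
qed

text \<open>Regularity at \<open>n\<close> makes a transition almost sure, and a transition
  preserves regularity.\<close>

lemma AE_regular: "n \<ge> 1 \<Longrightarrow> AE \<omega> in M. regular n \<omega>"
proof (induction n rule: dec_induct)
  case base
  have "regular 1 \<omega>" if "\<omega> \<in> space M" for \<omega>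
  proof -
    have "{a \<in> {(1::nat, 1::nat)}. snd a = 1} = {(1,1)}" "{a \<in> {(1::nat, 1::nat)}. fst a = 1} = {(1,1)}" by auto
    then show ?thesis
      using initial_G[OF that] by (simp add: regular_def deg_sum_def indeg_altdef outdeg_altdef)
  qed
  then show ?case by simp
next
  case (step n)
  show ?case using step.IH AE_transition_of_regular[OF step.hyps(1) step.IH]
    by eventually_elim (use step.hyps(1) regular_step in blast)
qed

lemma AE_good: "AE \<omega> in M. \<forall>n\<ge>1. regular n \<omega> \<and> transition n \<omega>"
  unfolding AE_all_countable using AE_regular AE_transition_of_regular by auto

text \<open>Almost surely \<open>H\<close> is a sum of history-measurable coefficients times
  indicators of the disjoint events, and the coefficients can be pulled out. They take the whole
  graph as an argument so that conditional means at the current state may enter as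
  constants.\<close>

lemma cond_exp_step:
  assumes n: "n \<ge> 1" and H[measurable]: "H \<in> borel_measurable M"
    and h: "AE \<omega> in M. \<forall>v\<in>{1..n}.
      (G (Suc n) \<omega> = add_from n v (G n \<omega>) \<longrightarrow> H \<omega> = h1 (G n \<omega>) (indeg (G n \<omega>) v) (outdeg (G n \<omega>) v)) \<and>
      (G (Suc n) \<omega> = add_to n v (G n \<omega>) \<longrightarrow> H \<omega> = h2 (G n \<omega>) (indeg (G n \<omega>) v) (outdeg (G n \<omega>) v))"
  shows "AE \<omega> in M. real_cond_exp M (history M G n) H \<omega> =
      deg_sum (\<lambda>k l. c1 * (k + lam) * h1 (G n \<omega>) k l + c2 * (l + mu) * h2 (G n \<omega>) k l) n (G n \<omega>) / n"
proof -
  interpret F: finite_measure_subalgebra M "history M G n" by (rule subalg_history)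
  note [measurable] = Ev_sets[OF n]
  define u1 where "u1 v \<omega> = h1 (G n \<omega>) (indeg (G n \<omega>) v) (outdeg (G n \<omega>) v)" for v \<omega>
  define u2 where "u2 v \<omega> = h2 (G n \<omega>) (indeg (G n \<omega>) v) (outdeg (G n \<omega>) v)" for v \<omega>
  have uF: "u1 v \<in> borel_measurable (history M G n)" "u2 v \<in> borel_measurable (history M G n)" for v
    unfolding u1_def u2_def using history_borel[OF n order_refl, of "\<lambda>g. h1 g (indeg g v) (outdeg g v)"]
      history_borel[OF n order_refl, of "\<lambda>g. h2 g (indeg g v) (outdeg g v)"] by auto
  have iu: "integrable M (u1 v)" "integrable M (u2 v)" for v
    unfolding u1_def u2_def using integrable_of_G[OF n, of "\<lambda>g. h1 g (indeg g v) (outdeg g v)"]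
      integrable_of_G[OF n, of "\<lambda>g. h2 g (indeg g v) (outdeg g v)"] by auto
  have i: "integrable M (\<lambda>\<omega>. u1 v \<omega> * indicator (Ev1 n v) \<omega>)" "integrable M (\<lambda>\<omega>. u2 v \<omega> * indicator (Ev2 n v) \<omega>)" for v
    using integrable_mult_indicator[OF Ev_sets(1)[OF n] iu(1)] integrable_mult_indicator[OF Ev_sets(2)[OF n] iu(2)]
    by (simp_all add: mult.commute)
  define W where "W v \<omega> = u1 v \<omega> * indicator (Ev1 n v) \<omega> + u2 v \<omega> * indicator (Ev2 n v) \<omega>" for v \<omega>
  have iW: "integrable M (W v)" for v unfolding W_def using i by auto
  have HW: "AE \<omega> in M. H \<omega> = (\<Sum>v=1..n. W v \<omega>)"
    using AE_good h
  proof eventually_elim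
    case (elim \<omega>)
    then obtain v where v: "v \<in> {1..n}" and "\<omega> \<in> Ev1 n v \<or> \<omega> \<in> Ev2 n v" using n by (auto simp: transition_def)
    then consider "\<omega> \<in> Ev1 n v" | "\<omega> \<in> Ev2 n v" by blast
    then show ?case
    proof cases
      case 1
      then have "H \<omega> = u1 v \<omega>" using elim(2) v by (auto simp: Ev1_def u1_def)
      moreover have "W w \<omega> = (if w = v then u1 v \<omega> else 0)" if "w \<in> {1..n}" for w
        using 1 Ev_disjoint[OF n v that] that Ev_disjoint(1)[OF n that v]
        by (auto simp: W_def indicator_def)
      ultimately show ?thesis using v by simp
    next
      case 2
      then have "H \<omega> = u2 v \<omega>" using elim(2) v by (auto simp: Ev2_def u2_def)
      moreover have "W w \<omega> = (if w = v then u2 v \<omega> else 0)" if "w \<in> {1..n}" for w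
        using 2 Ev_disjoint[OF n v that] Ev_disjoint(3)[OF n that v]
        by (auto simp: W_def indicator_def)
      ultimately show ?thesis using v by simp
    qed
  qed
  have "AE \<omega> in M. real_cond_exp M (history M G n) H \<omega> = real_cond_exp M (history M G n) (\<lambda>\<omega>. \<Sum>v=1..n. W v \<omega>) \<omega>"
    by (rule F.real_cond_exp_cong[OF HW]) (use iW in auto)
  moreover have "AE \<omega> in M. real_cond_exp M (history M G n) (\<lambda>\<omega>. \<Sum>v=1..n. W v \<omega>) \<omega>
      = (\<Sum>v=1..n. real_cond_exp M (history M G n) (W v) \<omega>)"
    by (rule F.real_cond_exp_sum[OF iW])
  moreover have "AE \<omega> in M. \<forall>v\<in>{1..n}. real_cond_exp M (history M G n) (W v) \<omega> =
      u1 v \<omega> * (c1 * (real (indeg (G n \<omega>) v) + lam) / real n) + u2 v \<omega> * (c2 * (real (outdeg (G n \<omega>) v) + mu) / real n)"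
  proof (rule AE_finite_allI)
    fix v assume v: "v \<in> {1..n}"
    have "AE \<omega> in M. real_cond_exp M (history M G n) (W v) \<omega> =
       real_cond_exp M (history M G n) (\<lambda>\<omega>. u1 v \<omega> * indicator (Ev1 n v) \<omega>) \<omega>
       + real_cond_exp M (history M G n) (\<lambda>\<omega>. u2 v \<omega> * indicator (Ev2 n v) \<omega>) \<omega>"
      unfolding W_def by (rule F.real_cond_exp_add[OF i])
    moreover have "AE \<omega> in M. real_cond_exp M (history M G n) (\<lambda>\<omega>. u1 v \<omega> * indicator (Ev1 n v) \<omega>) \<omega>
       = u1 v \<omega> * real_cond_exp M (history M G n) (indicator (Ev1 n v)) \<omega>"
      by (rule F.real_cond_exp_mult[OF uF(1) _ i(1)]) simp
    moreover have "AE \<omega> in M. real_cond_exp M (history M G n) (\<lambda>\<omega>. u2 v \<omega> * indicator (Ev2 n v) \<omega>) \<omega>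
       = u2 v \<omega> * real_cond_exp M (history M G n) (indicator (Ev2 n v)) \<omega>"
      by (rule F.real_cond_exp_mult[OF uF(2) _ i(2)]) simp
    ultimately show "AE \<omega> in M. real_cond_exp M (history M G n) (W v) \<omega> =
      u1 v \<omega> * (c1 * (real (indeg (G n \<omega>) v) + lam) / real n) + u2 v \<omega> * (c2 * (real (outdeg (G n \<omega>) v) + mu) / real n)"
      using cond_exp_Ev[OF n v] by eventually_elim simp
  qed simp
  ultimately show ?thesis
  proof eventually_elim
    case (elim \<omega>)
    then have "real_cond_exp M (history M G n) H \<omega> = (\<Sum>v=1..n. 
      u1 v \<omega> * (c1 * (real (indeg (G n \<omega>) v) + lam) / real n) + u2 v \<omega> * (c2 * (real (outdeg (G n \<omega>) v) + mu) / real n))"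
      by simp
    then show ?case by (simp add: deg_sum_def u1_def u2_def sum_divide_distrib add_divide_distrib mult_ac)
  qed
qed

subsection \<open>Jumps of degree sums\<close>

text \<open>Change of a degree sum when the chosen vertex receives the edge, the newborn then having
  degree \<open>(0, 1)\<close>; \<open>jump2\<close> belongs to the opposite orientation.\<close>

definition jump1 :: "(nat \<Rightarrow> nat \<Rightarrow> real) \<Rightarrow> nat \<Rightarrow> nat \<Rightarrow> real" where
  "jump1 f k l = f 0 1 + f (Suc k) l - f k l"

definition jump2 :: "(nat \<Rightarrow> nat \<Rightarrow> real) \<Rightarrow> nat \<Rightarrow> nat \<Rightarrow> real" where
  "jump2 f k l = f 1 0 + f k (Suc l) - f k l"

text \<open>Integral against the one-step transition law from the graph \<open>x\<close>, with value
  \<open>u\<close> for an edge from the new node and \<open>w\<close> for an edge to it.\<close>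

definition wmean :: "(nat \<Rightarrow> nat \<Rightarrow> real) \<Rightarrow> (nat \<Rightarrow> nat \<Rightarrow> real) \<Rightarrow> nat \<Rightarrow> nat pair_pre_digraph \<Rightarrow> real" where
  "wmean u w n x = deg_sum (\<lambda>k l. c1 * (real k + lam) * u k l + c2 * (real l + mu) * w k l) n x / real n"

definition jump :: "(nat \<Rightarrow> nat \<Rightarrow> real) \<Rightarrow> nat \<Rightarrow> 'w \<Rightarrow> real" where
  "jump f n \<omega> = deg_sum f (Suc n) (G (Suc n) \<omega>) - deg_sum f n (G n \<omega>)"

definition jmean :: "(nat \<Rightarrow> nat \<Rightarrow> real) \<Rightarrow> nat \<Rightarrow> 'w \<Rightarrow> real" where
  "jmean f n \<omega> = wmean (jump1 f) (jump2 f) n (G n \<omega>)"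

definition jcov :: "(nat \<Rightarrow> nat \<Rightarrow> real) \<Rightarrow> (nat \<Rightarrow> nat \<Rightarrow> real) \<Rightarrow> nat \<Rightarrow> 'w \<Rightarrow> real" where
  "jcov f h n \<omega> = wmean (\<lambda>k l. jump1 f k l * jump1 h k l) (\<lambda>k l. jump2 f k l * jump2 h k l) n (G n \<omega>)
     - jmean f n \<omega> * jmean h n \<omega>"

text \<open>Generator of the degree process of one existing vertex, up to the factor
  \<open>1 / n\<close>; the newborn is kept apart.\<close>

definition drift :: "(nat \<Rightarrow> nat \<Rightarrow> real) \<Rightarrow> nat \<Rightarrow> nat \<Rightarrow> real" where
  "drift f k l = c1 * (real k + lam) * (f (Suc k) l - f k l) + c2 * (real l + mu) * (f k (Suc l) - f k l)"

lemma jump_cases: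
  assumes "n \<ge> 1" "\<omega> \<in> space M" "v \<in> {1..n}"
  shows "G (Suc n) \<omega> = add_from n v (G n \<omega>) \<Longrightarrow> jump f n \<omega> = jump1 f (indeg (G n \<omega>) v) (outdeg (G n \<omega>) v)"
    and "G (Suc n) \<omega> = add_to n v (G n \<omega>) \<Longrightarrow> jump f n \<omega> = jump2 f (indeg (G n \<omega>) v) (outdeg (G n \<omega>) v)"
  using deg_sum_add[OF G_graphs[OF assms(1,2)] assms(3), of f]
  by (simp_all add: jump_def jump1_def jump2_def)

lemma jump_bound:
  assumes "n \<ge> 1" "transition n \<omega>" "\<And>k l. \<bar>f k l\<bar> \<le> D" shows "\<bar>jump f n \<omega>\<bar> \<le> 3 * D"
proof -
  have sp: "\<omega> \<in> space M" using assms(2) by (auto simp: transition_def Ev1_def Ev2_def)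
  from assms(2) obtain v where v: "v \<in> {1..n}" "\<omega> \<in> Ev1 n v \<or> \<omega> \<in> Ev2 n v" by (auto simp: transition_def)
  let ?k = "indeg (G n \<omega>) v" and ?l = "outdeg (G n \<omega>) v"
  have "jump f n \<omega> = jump1 f ?k ?l \<or> jump f n \<omega> = jump2 f ?k ?l"
    using v jump_cases[OF assms(1) sp v(1)] by (auto simp: Ev1_def Ev2_def)
  then show ?thesis
    using assms(3)[of 0 1] assms(3)[of 1 0] assms(3)[of ?k ?l] assms(3)[of "Suc ?k" ?l] assms(3)[of ?k "Suc ?l"]
    unfolding jump1_def jump2_def by linarith
qed

lemma jump_measurable [measurable]: "n \<ge> 1 \<Longrightarrow> jump f n \<in> borel_measurable M"
  unfolding jump_def using measurable_of_G[of n "deg_sum f n"] measurable_of_G[of "Suc n" "deg_sum f (Suc n)"] by simp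

lemma wmean_linear:
  "wmean (\<lambda>k l. u k l + u' k l) (\<lambda>k l. w k l + w' k l) n x = wmean u w n x + wmean u' w' n x"
  "wmean (\<lambda>k l. u k l - u' k l) (\<lambda>k l. w k l - w' k l) n x = wmean u w n x - wmean u' w' n x"
  "wmean (\<lambda>k l. t * u k l) (\<lambda>k l. t * w k l) n x = t * wmean u w n x"
  by (simp_all add: wmean_def deg_sum_def algebra_simps sum.distrib sum_subtractf sum_distrib_left
      add_divide_distrib diff_divide_distrib)

lemma regular_weight1:
  assumes "regular n \<omega>" shows "deg_sum (\<lambda>k l. c1 * (real k + lam)) n (G n \<omega>) = \<alpha> * n"
proof -
  have "deg_sum (\<lambda>k l. c1 * (real k + lam)) n (G n \<omega>) = deg_sum (\<lambda>k l. c1 * real k + c1 * lam) n (G n \<omega>)"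
    by (simp add: algebra_simps)
  also have "\<dots> = c1 * (1 + lam) * n"
    using assms by (simp only: deg_sum_linear) (simp add: regular_def algebra_simps)
  finally show ?thesis using params_pos by (simp add: c1_def)
qed

lemma regular_weight2:
  assumes "regular n \<omega>" shows "deg_sum (\<lambda>k l. c2 * (real l + mu)) n (G n \<omega>) = \<gamma> * n"
proof -
  have "deg_sum (\<lambda>k l. c2 * (real l + mu)) n (G n \<omega>) = deg_sum (\<lambda>k l. c2 * real l + c2 * mu) n (G n \<omega>)"
    by (simp add: algebra_simps)
  also have "\<dots> = c2 * (1 + mu) * n"
    using assms by (simp only: deg_sum_linear) (simp add: regular_def algebra_simps)
  finally show ?thesis using params_pos by (simp add: c2_def)
qed

lemma wmean_const:
  assumes "n \<ge> 1" "regular n \<omega>" shows "wmean (\<lambda>k l. s) (\<lambda>k l. t) n (G n \<omega>) = \<alpha> * s + \<gamma> * t"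
proof -
  have "deg_sum (\<lambda>k l. c1 * (real k + lam) * s + c2 * (real l + mu) * t) n (G n \<omega>) =
     s * deg_sum (\<lambda>k l. c1 * (real k + lam)) n (G n \<omega>) + t * deg_sum (\<lambda>k l. c2 * (real l + mu)) n (G n \<omega>)"
    unfolding deg_sum_def by (simp add: sum.distrib sum_distrib_left mult_ac)
  then show ?thesis using assms
    by (simp add: wmean_def regular_weight1 regular_weight2 add_divide_distrib mult_ac)
qed

lemma wmean_mono:
  assumes "\<And>k l. u k l \<le> u' k l" "\<And>k l. w k l \<le> w' k l"
  shows "wmean u w n x \<le> wmean u' w' n x"
  unfolding wmean_def deg_sum_def using assms c_pos params_pos
  by (intro divide_right_mono sum_mono add_mono mult_left_mono) auto

lemma wmean_bound:
  assumes "n \<ge> 1" "regular n \<omega>" "\<And>k l. \<bar>u k l\<bar> \<le> D" "\<And>k l. \<bar>w k l\<bar> \<le> D"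
  shows "\<bar>wmean u w n (G n \<omega>)\<bar> \<le> D"
proof -
  have u: "- D \<le> u k l" "u k l \<le> D" "- D \<le> w k l" "w k l \<le> D" for k l
    using assms(3,4)[of k l] by auto
  have "wmean (\<lambda>k l. - D) (\<lambda>k l. - D) n (G n \<omega>) \<le> wmean u w n (G n \<omega>)" "wmean u w n (G n \<omega>) \<le> wmean (\<lambda>k l. D) (\<lambda>k l. D) n (G n \<omega>)"
    by (rule wmean_mono; rule u)+
  moreover have "\<alpha> * D + \<gamma> * D = D" using params_sum by (simp flip: distrib_right)
  ultimately show ?thesis unfolding wmean_const[OF assms(1,2)] by simp
qed

lemma jmean_bound:
  assumes "n \<ge> 1" "regular n \<omega>" "\<And>k l. \<bar>f k l\<bar> \<le> D" shows "\<bar>jmean f n \<omega>\<bar> \<le> 3 * D"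
  unfolding jmean_def
proof (rule wmean_bound[OF assms(1,2)])
  fix k l
  show "\<bar>jump1 f k l\<bar> \<le> 3 * D" "\<bar>jump2 f k l\<bar> \<le> 3 * D"
    using assms(3)[of 0 1] assms(3)[of 1 0] assms(3)[of k l] assms(3)[of "Suc k" l] assms(3)[of k "Suc l"]
    unfolding jump1_def jump2_def by linarith+
qed

text \<open>The newborn contributes constants, with total probability \<alpha> for the degree
  \<open>(0, 1)\<close> and \<gamma> for \<open>(1, 0)\<close>.\<close>

lemma jmean_drift:
  assumes "n \<ge> 1" "regular n \<omega>"
  shows "jmean f n \<omega> = \<alpha> * f 0 1 + \<gamma> * f 1 0 + deg_sum (drift f) n (G n \<omega>) / n"
proof -
  have "jmean f n \<omega> = wmean (\<lambda>k l. f 0 1) (\<lambda>k l. f 1 0) n (G n \<omega>)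
      + wmean (\<lambda>k l. f (Suc k) l - f k l) (\<lambda>k l. f k (Suc l) - f k l) n (G n \<omega>)"
    unfolding jmean_def jump1_def[abs_def] jump2_def[abs_def] wmean_linear(1)[symmetric]
    by (simp add: algebra_simps)
  then show ?thesis unfolding wmean_const[OF assms] by (simp add: wmean_def drift_def[abs_def])
qed

lemma cond_exp_jumps:
  assumes n: "n \<ge> 1"
  shows "AE \<omega> in M. real_cond_exp M (history M G n) (\<lambda>\<omega>. F (G n \<omega>) (jump f n \<omega>) (jump h n \<omega>)) \<omega>
    = wmean (\<lambda>k l. F (G n \<omega>) (jump1 f k l) (jump1 h k l)) (\<lambda>k l. F (G n \<omega>) (jump2 f k l) (jump2 h k l)) n (G n \<omega>)"
  unfolding wmean_def
proof (rule cond_exp_step[OF n])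
  show "(\<lambda>\<omega>. F (G n \<omega>) (jump f n \<omega>) (jump h n \<omega>)) \<in> borel_measurable M"
    unfolding jump_def
  proof (rule measurable_G_dep[OF n])
    fix x
    show "(\<lambda>\<omega>. F x (deg_sum f (Suc n) (G (Suc n) \<omega>) - deg_sum f n x)
           (deg_sum h (Suc n) (G (Suc n) \<omega>) - deg_sum h n x)) \<in> borel_measurable M"
      using measurable_of_G[of "Suc n" "\<lambda>y. F x (deg_sum f (Suc n) y - deg_sum f n x) (deg_sum h (Suc n) y - deg_sum h n x)"]
      by simp
  qed
  show "AE \<omega> in M. \<forall>v\<in>{1..n}.
      (G (Suc n) \<omega> = add_from n v (G n \<omega>) \<longrightarrow> F (G n \<omega>) (jump f n \<omega>) (jump h n \<omega>) =
         F (G n \<omega>) (jump1 f (indeg (G n \<omega>) v) (outdeg (G n \<omega>) v)) (jump1 h (indeg (G n \<omega>) v) (outdeg (G n \<omega>) v))) \<and>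
      (G (Suc n) \<omega> = add_to n v (G n \<omega>) \<longrightarrow> F (G n \<omega>) (jump f n \<omega>) (jump h n \<omega>) =
         F (G n \<omega>) (jump2 f (indeg (G n \<omega>) v) (outdeg (G n \<omega>) v)) (jump2 h (indeg (G n \<omega>) v) (outdeg (G n \<omega>) v)))"
    by (intro AE_I2 ballI conjI impI) (simp_all add: jump_cases n)
qed

lemma cond_exp_jump_centered:
  assumes "n \<ge> 1"
  shows "AE \<omega> in M. real_cond_exp M (history M G n) (\<lambda>\<omega>. jump f n \<omega> - jmean f n \<omega>) \<omega> = 0"
  using cond_exp_jumps[OF assms, of "\<lambda>x u _. u - wmean (jump1 f) (jump2 f) n x" f f] AE_good
proof eventually_elim
  case (elim \<omega>)
  let ?m = "wmean (jump1 f) (jump2 f) n (G n \<omega>)"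
  have "wmean (\<lambda>k l. jump1 f k l - ?m) (\<lambda>k l. jump2 f k l - ?m) n (G n \<omega>) = ?m - (\<alpha> * ?m + \<gamma> * ?m)"
    unfolding wmean_linear using wmean_const[OF assms] elim(2) assms by simp
  also have "\<alpha> * ?m + \<gamma> * ?m = ?m" using params_sum by (simp flip: distrib_right)
  finally show ?case using elim(1) by (simp add: jmean_def)
qed

lemma cond_exp_jump_cov:
  assumes "n \<ge> 1"
  shows "AE \<omega> in M. real_cond_exp M (history M G n)
     (\<lambda>\<omega>. (jump f n \<omega> - jmean f n \<omega>) * (jump h n \<omega> - jmean h n \<omega>)) \<omega> = jcov f h n \<omega>"
  using cond_exp_jumps[OF assms, of
      "\<lambda>x u w. (u - wmean (jump1 f) (jump2 f) n x) * (w - wmean (jump1 h) (jump2 h) n x)" f h] AE_good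
proof eventually_elim
  case (elim \<omega>)
  let ?m = "wmean (jump1 f) (jump2 f) n (G n \<omega>)" and ?m' = "wmean (jump1 h) (jump2 h) n (G n \<omega>)"
  have ex: "(u - ?m) * (w - ?m') = u * w - ?m' * u - ?m * w + ?m * ?m'" for u w
    by (simp add: algebra_simps)
  have "wmean (\<lambda>k l. (jump1 f k l - ?m) * (jump1 h k l - ?m')) (\<lambda>k l. (jump2 f k l - ?m) * (jump2 h k l - ?m')) n (G n \<omega>)
     = wmean (\<lambda>k l. jump1 f k l * jump1 h k l) (\<lambda>k l. jump2 f k l * jump2 h k l) n (G n \<omega>)
       - ?m' * ?m - ?m * ?m' + (\<alpha> * (?m * ?m') + \<gamma> * (?m * ?m'))"
    unfolding ex wmean_linear using wmean_const[OF assms] elim(2) assms by (simp add: algebra_simps)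
  also have "\<alpha> * (?m * ?m') + \<gamma> * (?m * ?m') = ?m * ?m'" using params_sum by (simp flip: distrib_right)
  finally show ?case using elim(1) by (simp add: jmean_def jcov_def)
qed

lemma integrable_jump:
  assumes "n \<ge> 1" shows "integrable M (jump f n)"
  using integrable_of_G[of n "deg_sum f n"] integrable_of_G[of "Suc n" "deg_sum f (Suc n)"] assms
  by (simp add: jump_def[abs_def])

text \<open>This orthogonality removes the cross term in the recursion for second moments;
  \<open>F\<close> is bounded on the finite set \<open>graphs n\<close>.\<close>

lemma expectation_centered:
  assumes n: "n \<ge> 1"
  shows "expectation (\<lambda>\<omega>. F (G n \<omega>) * (jump f n \<omega> - jmean f n \<omega>)) = 0"
    and "integrable M (\<lambda>\<omega>. F (G n \<omega>) * (jump f n \<omega> - jmean f n \<omega>))"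
proof -
  interpret F: finite_measure_subalgebra M "history M G n" by (rule subalg_history)
  have j: "integrable M (\<lambda>\<omega>. jump f n \<omega> - jmean f n \<omega>)"
    unfolding jmean_def using integrable_jump[OF n] integrable_of_G[OF n, of "wmean (jump1 f) (jump2 f) n"] by simp
  show i: "integrable M (\<lambda>\<omega>. F (G n \<omega>) * (jump f n \<omega> - jmean f n \<omega>))"
  proof (rule Bochner_Integration.integrable_bound)
    show "integrable M (\<lambda>\<omega>. (\<Sum>x\<in>graphs n. \<bar>F x\<bar>) * (jump f n \<omega> - jmean f n \<omega>))" using j by simp
    show "(\<lambda>\<omega>. F (G n \<omega>) * (jump f n \<omega> - jmean f n \<omega>)) \<in> borel_measurable M"
      using measurable_of_G[OF n, of F] j by simp
    have "\<bar>F (G n \<omega>)\<bar> * \<bar>jump f n \<omega> - jmean f n \<omega>\<bar> \<le> \<bar>\<Sum>x\<in>graphs n. \<bar>F x\<bar>\<bar> * \<bar>jump f n \<omega> - jmean f n \<omega>\<bar>" if "\<omega> \<in> space M" for \<omega>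
      using bounded_of_G[OF n that, of F] by (intro mult_right_mono) auto
    then show "AE \<omega> in M. norm (F (G n \<omega>) * (jump f n \<omega> - jmean f n \<omega>)) \<le> norm ((\<Sum>x\<in>graphs n. \<bar>F x\<bar>) * (jump f n \<omega> - jmean f n \<omega>))"
      by (intro AE_I2) (simp add: abs_mult)
  qed
  have "expectation (\<lambda>\<omega>. F (G n \<omega>) * (jump f n \<omega> - jmean f n \<omega>))
     = expectation (\<lambda>\<omega>. F (G n \<omega>) * real_cond_exp M (history M G n) (\<lambda>\<omega>. jump f n \<omega> - jmean f n \<omega>) \<omega>)"
    using F.real_cond_exp_intg(2)[OF i history_borel[OF n order_refl]] j by simp
  also have "\<dots> = expectation (\<lambda>\<omega>. 0)"
    by (rule integral_cong_AE) (use cond_exp_jump_centered[OF n, of f] measurable_of_G[OF n, of F] in auto)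
  finally show "expectation (\<lambda>\<omega>. F (G n \<omega>) * (jump f n \<omega> - jmean f n \<omega>)) = 0" by simp
qed

lemma expectation_step:
  assumes n: "n \<ge> 1"
  shows "expectation (\<lambda>\<omega>. deg_sum f (Suc n) (G (Suc n) \<omega>)) = expectation (\<lambda>\<omega>. deg_sum f n (G n \<omega>))
    + \<alpha> * f 0 1 + \<gamma> * f 1 0 + expectation (\<lambda>\<omega>. deg_sum (drift f) n (G n \<omega>)) / n"
proof -
  note i = integrable_of_G[OF n]
  have ij: "integrable M (jmean f n)" unfolding jmean_def[abs_def] by (rule i)
  have "expectation (jmean f n) = expectation (\<lambda>\<omega>. \<alpha> * f 0 1 + \<gamma> * f 1 0 + deg_sum (drift f) n (G n \<omega>) / n)"
  proof (rule integral_cong_AE)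
    show "AE \<omega> in M. jmean f n \<omega> = \<alpha> * f 0 1 + \<gamma> * f 1 0 + deg_sum (drift f) n (G n \<omega>) / n"
      using AE_good by eventually_elim (use n jmean_drift in auto)
  qed (use ij i[of "\<lambda>x. deg_sum (drift f) n x"] in auto)
  also have "\<dots> = \<alpha> * f 0 1 + \<gamma> * f 1 0 + expectation (\<lambda>\<omega>. deg_sum (drift f) n (G n \<omega>)) / n"
    using i[of "\<lambda>x. deg_sum (drift f) n x"] by (simp add: prob_space)
  finally have "expectation (jmean f n) = \<dots>" .
  moreover have "expectation (\<lambda>\<omega>. deg_sum f (Suc n) (G (Suc n) \<omega>)) - expectation (\<lambda>\<omega>. deg_sum f n (G n \<omega>)) = expectation (jmean f n)"
    using expectation_centered(1)[OF n, of "\<lambda>_. 1" f] integrable_jump[OF n, of f] ij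
      integrable_of_G[of "Suc n" "deg_sum f (Suc n)"] i[of "deg_sum f n"] by (simp add: jump_def[abs_def])
  ultimately show ?thesis by simp
qed

subsection \<open>The law of large numbers for the counts\<close>

definition unit_at :: "nat \<Rightarrow> nat \<Rightarrow> nat \<Rightarrow> nat \<Rightarrow> real" where
  "unit_at i j k l = (if k = i \<and> l = j then 1 else 0)"

text \<open>The rate of entering in-degree \<open>i\<close> from \<open>i - 1\<close>. Its value 0
  at \<open>i = 0\<close> encodes the vanishing of terms with index -1, since subtraction on
  naturals would return index 0.\<close>

definition r1 :: "nat \<Rightarrow> real" where "r1 i = (if i = 0 then 0 else c1 * (real i - 1 + lam))"

definition r2 :: "nat \<Rightarrow> real" where "r2 j = (if j = 0 then 0 else c2 * (real j - 1 + mu))"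

lemma r_nonneg: "r1 i \<ge> 0" "r2 j \<ge> 0"
  using c_pos params_pos by (auto simp: r1_def r2_def)

lemma N_deg_sum: "N n i j \<omega> = deg_sum (unit_at i j) n (G n \<omega>)"
proof -
  have "{v \<in> {1..n}. in_degree (with_proj (G n \<omega>)) v = i \<and> out_degree (with_proj (G n \<omega>)) v = j}
    = {1..n} \<inter> {v. indeg (G n \<omega>) v = i \<and> outdeg (G n \<omega>) v = j}"
    by (auto simp: indeg_def outdeg_def)
  then show ?thesis by (simp add: N_def deg_sum_def unit_at_def sum.If_cases)
qed

lemma deg_sum_finite_support:
  assumes "\<And>k l. i < k \<or> j < l \<Longrightarrow> f k l = 0"
  shows "deg_sum f n (G n \<omega>) = (\<Sum>k=0..i. \<Sum>l=0..j. f k l * N n k l \<omega>)"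
proof -
  have "f x y = (\<Sum>k=0..i. \<Sum>l=0..j. f k l * unit_at k l x y)" for x y
  proof -
    have "(\<Sum>k=0..i. \<Sum>l=0..j. f k l * unit_at k l x y) = (\<Sum>k=0..i. \<Sum>l=0..j. if l = y then (if k = x then f k y else 0) else 0)"
      by (intro sum.cong refl) (auto simp: unit_at_def)
    also have "\<dots> = (\<Sum>k=0..i. if y \<le> j then (if k = x then f k y else 0) else 0)"
      by simp
    also have "\<dots> = (if y \<le> j \<and> x \<le> i then f x y else 0)" by (cases "y \<le> j") auto
    also have "\<dots> = f x y" using assms[of x y] by auto
    finally show ?thesis ..
  qed
  then have "deg_sum f n (G n \<omega>) = (\<Sum>v=1..n. \<Sum>k=0..i. \<Sum>l=0..j. f k l * unit_at k l (indeg (G n \<omega>) v) (outdeg (G n \<omega>) v))"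
    unfolding deg_sum_def by (intro sum.cong refl)
  also have "\<dots> = (\<Sum>k=0..i. \<Sum>v=1..n. \<Sum>l=0..j. f k l * unit_at k l (indeg (G n \<omega>) v) (outdeg (G n \<omega>) v))"
    by (rule sum.swap)
  also have "\<dots> = (\<Sum>k=0..i. \<Sum>l=0..j. \<Sum>v=1..n. f k l * unit_at k l (indeg (G n \<omega>) v) (outdeg (G n \<omega>) v))"
    by (intro sum.cong refl sum.swap)
  finally show ?thesis by (simp add: N_deg_sum deg_sum_def sum_distrib_left)
qed

text \<open>On indicators the generator yields the forward equation, with inflow from two neighbours
  and outflow at rate \<open>\<delta> i j\<close>; this is how the recursion of \<open>p\<close>
  arises.\<close>

lemma drift_unit: "drift (unit_at i j) k l = r1 i * unit_at (i - 1) j k l + (r2 j * unit_at i (j - 1) k l - \<delta> i j * unit_at i j k l)"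
  by (cases i; cases j) (auto simp: drift_def unit_at_def r1_def r2_def \<delta>_def algebra_simps)

lemma deg_sum_drift_unit:
  "deg_sum (drift (unit_at i j)) n (G n \<omega>) = r1 i * N n (i - 1) j \<omega> + (r2 j * N n i (j - 1) \<omega> - \<delta> i j * N n i j \<omega>)"
  unfolding drift_unit[abs_def] N_deg_sum deg_sum_linear ..

definition src :: "nat \<Rightarrow> nat \<Rightarrow> real" where
  "src i j = (if i = 0 \<and> j = 1 then \<alpha> else 0) + (if i = 1 \<and> j = 0 then \<gamma> else 0)"

lemma src_unit: "src i j = \<alpha> * unit_at i j 0 1 + \<gamma> * unit_at i j 1 0"
  by (auto simp: src_def unit_at_def)

lemma N_bounds: "0 \<le> N n i j \<omega>" "N n i j \<omega> \<le> n"
proof -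
  show "0 \<le> N n i j \<omega>" by (simp add: N_def)
  have "card {v \<in> {1..n}. in_degree (with_proj (G n \<omega>)) v = i \<and> out_degree (with_proj (G n \<omega>)) v = j} \<le> card {1..n}"
    by (rule card_mono) auto
  then show "N n i j \<omega> \<le> n" by (simp add: N_def)
qed

lemma integrable_N: "n \<ge> 1 \<Longrightarrow> integrable M (N n i j)"
  unfolding N_deg_sum[abs_def] by (rule integrable_of_G)

lemma nu_bounds: assumes "n \<ge> 1" shows "0 \<le> nu n i j" "nu n i j \<le> n"
proof -
  show "0 \<le> nu n i j" unfolding nu_def by (rule integral_nonneg_AE) (simp add: N_bounds)
  show "nu n i j \<le> n" unfolding nu_def
    by (rule integral_le_const[OF integrable_N[OF assms]]) (simp add: N_bounds)
qed

lemma nu_step: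
  assumes n: "n \<ge> 1"
  shows "nu (Suc n) i j = nu n i j + src i j + (r1 i * nu n (i - 1) j + (r2 j * nu n i (j - 1) - \<delta> i j * nu n i j)) / n"
  using expectation_step[OF n, of "unit_at i j"] integrable_N[OF n]
  unfolding deg_sum_drift_unit by (simp add: nu_def src_unit flip: N_deg_sum)

definition dev :: "nat \<Rightarrow> nat \<Rightarrow> nat \<Rightarrow> 'w \<Rightarrow> real" where
  "dev n i j \<omega> = N n i j \<omega> - nu n i j"

lemma dev_bound: "n \<ge> 1 \<Longrightarrow> \<bar>dev n i j \<omega>\<bar> \<le> n"
  using N_bounds[of n i j \<omega>] nu_bounds[of n i j] unfolding dev_def by linarith

lemma unit_at_bound: "\<bar>unit_at i j k l\<bar> \<le> 1" by (simp add: unit_at_def)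

lemma dev_step:
  assumes n: "n \<ge> 1" and reg: "regular n \<omega>"
  shows "dev (Suc n) i j \<omega> = dev n i j \<omega> * (1 - \<delta> i j / n) + (r1 i * dev n (i - 1) j \<omega> + r2 j * dev n i (j - 1) \<omega>) / n
    + (jump (unit_at i j) n \<omega> - jmean (unit_at i j) n \<omega>)"
  unfolding jmean_drift[OF n reg] dev_def nu_step[OF n] deg_sum_drift_unit N_deg_sum jump_def src_unit
  by (simp add: algebra_simps add_divide_distrib diff_divide_distrib)

lemma integrable_dev_square: "n \<ge> 1 \<Longrightarrow> integrable M (\<lambda>\<omega>. (dev n i j \<omega>)^2)"
  unfolding dev_def N_deg_sum using integrable_of_G[of n "\<lambda>x. (deg_sum (unit_at i j) n x - nu n i j)^2"] by simp

text \<open>The contraction contributes \<open>- 2 * d * y^2 / n\<close>, which absorbs the cross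
  term through \<open>2 * y * w <= 2 * d * y^2 + w^2 / (2 * d)\<close>.\<close>

lemma square_contraction_le:
  fixes y w d n :: real
  assumes "n \<ge> 1" "d > 0"
  shows "(y * (1 - d / n) + w / n)^2 \<le> y^2 + w^2 / (2 * d * n) + ((w - d * y) / n)^2"
proof -
  have "2 * y * w \<le> 2 * d * y^2 + w^2 / (2 * d)"
  proof -
    have "0 \<le> (2 * d * y - w)^2 / (2 * d)" using assms by simp
    also have "\<dots> = 2 * d * y^2 + w^2 / (2 * d) - 2 * y * w"
      using assms by (simp add: field_simps power2_eq_square)
    finally show ?thesis by simp
  qed
  then have "(2 * y * w - 2 * d * y^2) / n \<le> (w^2 / (2 * d)) / n"
    using assms by (intro divide_right_mono) auto
  moreover have "(y * (1 - d / n) + w / n)^2 = y^2 + (2 * y * w - 2 * d * y^2) / n + ((w - d * y) / n)^2"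
    using assms by (simp add: field_simps power2_eq_square)
  ultimately show ?thesis by (simp add: mult_ac)
qed

text \<open>Induction on \<open>i + j\<close>. The neighbours enter only through \<open>w\<close>,
  whose second moment is \<open>O(n)\<close> by hypothesis and gets divided by \<open>n\<close>, so
  each step adds at most a constant.\<close>

lemma second_moment_linear: "\<exists>D::real. \<forall>n\<ge>1. expectation (\<lambda>\<omega>. (dev n i j \<omega>)^2) \<le> D * real n"
proof (induction "i + j" arbitrary: i j rule: less_induct)
  case less
  have IH: "\<exists>D::real. \<forall>n\<ge>1. r1 i^2 * expectation (\<lambda>\<omega>. (dev n (i - 1) j \<omega>)^2) \<le> D * real n"
  proof (cases "i = 0")
    case True
    then show ?thesis by (intro exI[of _ 0]) (simp add: r1_def)
  next
    case False
    then obtain D :: real where "\<forall>n\<ge>1. expectation (\<lambda>\<omega>. (dev n (i - 1) j \<omega>)^2) \<le> D * real n" using less[of "i - 1" j] by auto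
    then show ?thesis by (intro exI[of _ "r1 i^2 * D"]) (auto simp: mult.assoc intro!: mult_left_mono)
  qed
  have IH': "\<exists>D::real. \<forall>n\<ge>1. r2 j^2 * expectation (\<lambda>\<omega>. (dev n i (j - 1) \<omega>)^2) \<le> D * real n"
  proof (cases "j = 0")
    case True
    then show ?thesis by (intro exI[of _ 0]) (simp add: r2_def)
  next
    case False
    then obtain D :: real where "\<forall>n\<ge>1. expectation (\<lambda>\<omega>. (dev n i (j - 1) \<omega>)^2) \<le> D * real n" using less[of i "j - 1"] by auto
    then show ?thesis by (intro exI[of _ "r2 j^2 * D"]) (auto simp: mult.assoc intro!: mult_left_mono)
  qed
  obtain D1 :: real where D1: "\<And>n. n \<ge> 1 \<Longrightarrow> r1 i^2 * expectation (\<lambda>\<omega>. (dev n (i - 1) j \<omega>)^2) \<le> D1 * n" using IH by auto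
  obtain D2 :: real where D2: "\<And>n. n \<ge> 1 \<Longrightarrow> r2 j^2 * expectation (\<lambda>\<omega>. (dev n i (j - 1) \<omega>)^2) \<le> D2 * n" using IH' by auto
  define d where "d = \<delta> i j"
  have d: "d > 0" unfolding d_def by (rule delta_pos)
  \<comment> \<open>The summands bound the neighbours' share \<open>w^2 / (2 * d * n)\<close> in the
    mean, the square of the predictable increment by means of \<open>\<bar>dev\<bar> <= n\<close>,
    and the squared centered jump, where 36 is \<open>(3 + 3)^2\<close> from the jump and its
    mean.\<close>
  define T where "T = (D1 + D2) / d + (r1 i + r2 j + d)^2 + 36"
  have D1p: "D1 \<ge> 0"
    using order.trans[OF _ D1[of 1]] by simp
  have D2p: "D2 \<ge> 0"
    using order.trans[OF _ D2[of 1]] by simp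
  have T: "T \<ge> 36" unfolding T_def using D1p D2p d by simp
  have stp: "expectation (\<lambda>\<omega>. (dev (Suc n) i j \<omega>)^2) \<le> expectation (\<lambda>\<omega>. (dev n i j \<omega>)^2) + T" if n: "n \<ge> 1" for n
  proof -
    define w where "w \<omega> = r1 i * dev n (i - 1) j \<omega> + r2 j * dev n i (j - 1) \<omega>" for \<omega>
    define Y where "Y \<omega> = dev n i j \<omega> * (1 - d / n) + w \<omega> / n" for \<omega>
    define X where "X \<omega> = jump (unit_at i j) n \<omega> - jmean (unit_at i j) n \<omega>" for \<omega>
    define F where "F x = (deg_sum (unit_at i j) n x - nu n i j) * (1 - d / n) +
      (r1 i * (deg_sum (unit_at (i - 1) j) n x - nu n (i - 1) j) + r2 j * (deg_sum (unit_at i (j - 1)) n x - nu n i (j - 1))) / n" for x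
    have YF: "Y = (\<lambda>\<omega>. F (G n \<omega>))" by (simp add: Y_def F_def w_def dev_def N_deg_sum fun_eq_iff)
    have iY2: "integrable M (\<lambda>\<omega>. (Y \<omega>)^2)" unfolding YF using integrable_of_G[OF n, of "\<lambda>x. (F x)^2"] by simp
    have iYX: "integrable M (\<lambda>\<omega>. Y \<omega> * X \<omega>)" and YX: "expectation (\<lambda>\<omega>. Y \<omega> * X \<omega>) = 0"
      unfolding YF X_def using expectation_centered[OF n, of F] by auto
    have Xm: "X \<in> borel_measurable M"
      unfolding X_def[abs_def] jmean_def using jump_measurable[OF n] measurable_of_G[OF n, of "wmean (jump1 (unit_at i j)) (jump2 (unit_at i j)) n"] by simp
    have X2: "AE \<omega> in M. (X \<omega>)^2 \<le> 36"
      using AE_good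
    proof eventually_elim
      case (elim \<omega>)
      have "\<bar>X \<omega>\<bar> \<le> 6"
        using jump_bound[OF n, of \<omega> "unit_at i j" 1] jmean_bound[OF n, of \<omega> "unit_at i j" 1] unit_at_bound elim n
        unfolding X_def by auto
      then have "\<bar>X \<omega>\<bar>^2 \<le> 6^2" by (intro power_mono) auto
      then show ?case by simp
    qed
    have iX2: "integrable M (\<lambda>\<omega>. (X \<omega>)^2)"
      by (rule integrable_const_bound[where B=36]) (use X2 Xm in auto)
    have eq: "AE \<omega> in M. (dev (Suc n) i j \<omega>)^2 = (Y \<omega>)^2 + 2 * (Y \<omega> * X \<omega>) + (X \<omega>)^2"
      using AE_good
    proof eventually_elim
      case (elim \<omega>)
      then have "dev (Suc n) i j \<omega> = Y \<omega> + X \<omega>"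
        using dev_step[OF n, of \<omega> i j] n unfolding Y_def X_def w_def d_def by simp
      then show ?case by (simp add: power2_eq_square algebra_simps)
    qed
    have "expectation (\<lambda>\<omega>. (dev (Suc n) i j \<omega>)^2) = expectation (\<lambda>\<omega>. (Y \<omega>)^2 + 2 * (Y \<omega> * X \<omega>) + (X \<omega>)^2)"
      by (rule integral_cong_AE) (use eq iY2 iYX iX2 integrable_dev_square[of "Suc n" i j] in auto)
    also have "\<dots> = expectation (\<lambda>\<omega>. (Y \<omega>)^2) + expectation (\<lambda>\<omega>. (X \<omega>)^2)"
      using iY2 iYX iX2 YX by simp
    also have "expectation (\<lambda>\<omega>. (X \<omega>)^2) \<le> 36"
      by (rule integral_le_const[OF iX2 X2])
    also have "expectation (\<lambda>\<omega>. (Y \<omega>)^2) \<le> expectation (\<lambda>\<omega>. (dev n i j \<omega>)^2 +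
       (r1 i^2 * (dev n (i - 1) j \<omega>)^2 + r2 j^2 * (dev n i (j - 1) \<omega>)^2) / (d * n) + (r1 i + r2 j + d)^2)"
    proof (rule integral_mono[OF iY2])
      show "integrable M (\<lambda>\<omega>. (dev n i j \<omega>)^2 +
         (r1 i^2 * (dev n (i - 1) j \<omega>)^2 + r2 j^2 * (dev n i (j - 1) \<omega>)^2) / (d * n) + (r1 i + r2 j + d)^2)"
        using integrable_dev_square[OF n] by simp
      fix \<omega>
      have "(Y \<omega>)^2 \<le> (dev n i j \<omega>)^2 + (w \<omega>)^2 / (2 * d * n) + ((w \<omega> - d * dev n i j \<omega>) / n)^2"
        unfolding Y_def by (rule square_contraction_le[OF _ d]) (use n in simp)
      also have "(w \<omega>)^2 / (2 * d * n) \<le> (2 * (r1 i^2 * (dev n (i - 1) j \<omega>)^2 + r2 j^2 * (dev n i (j - 1) \<omega>)^2)) / (2 * d * n)"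
      proof (rule divide_right_mono)
        show "(w \<omega>)^2 \<le> 2 * (r1 i^2 * (dev n (i - 1) j \<omega>)^2 + r2 j^2 * (dev n i (j - 1) \<omega>)^2)"
          using sum_squares_bound[of "r1 i * dev n (i - 1) j \<omega>" "r2 j * dev n i (j - 1) \<omega>"]
          unfolding w_def by (simp add: power2_sum power_mult_distrib)
        show "0 \<le> 2 * d * n" using d by simp
      qed
      also have "\<dots> = (r1 i^2 * (dev n (i - 1) j \<omega>)^2 + r2 j^2 * (dev n i (j - 1) \<omega>)^2) / (d * n)"
        by (simp only: mult.assoc mult_divide_mult_cancel_left_if) simp
      also have "((w \<omega> - d * dev n i j \<omega>) / n)^2 \<le> (r1 i + r2 j + d)^2"
      proof -
        have "\<bar>w \<omega> - d * dev n i j \<omega>\<bar> \<le> \<bar>r1 i * dev n (i - 1) j \<omega>\<bar> + \<bar>r2 j * dev n i (j - 1) \<omega>\<bar> + \<bar>d * dev n i j \<omega>\<bar>"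
          unfolding w_def by linarith
        also have "\<dots> \<le> r1 i * n + r2 j * n + d * n"
          unfolding abs_mult using dev_bound[OF n] r_nonneg d by (intro add_mono mult_mono) auto
        finally have "\<bar>(w \<omega> - d * dev n i j \<omega>) / n\<bar> \<le> r1 i + r2 j + d"
          using n by (simp add: abs_divide divide_le_eq distrib_right)
        then have "\<bar>(w \<omega> - d * dev n i j \<omega>) / n\<bar>^2 \<le> (r1 i + r2 j + d)^2" by (intro power_mono) auto
        then show ?thesis by (simp only: power2_abs)
      qed
      finally show "(Y \<omega>)^2 \<le> (dev n i j \<omega>)^2 +
         (r1 i^2 * (dev n (i - 1) j \<omega>)^2 + r2 j^2 * (dev n i (j - 1) \<omega>)^2) / (d * n) + (r1 i + r2 j + d)^2" by simp
    qed
    also have "\<dots> = expectation (\<lambda>\<omega>. (dev n i j \<omega>)^2) + (r1 i^2 * expectation (\<lambda>\<omega>. (dev n (i - 1) j \<omega>)^2)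
         + r2 j^2 * expectation (\<lambda>\<omega>. (dev n i (j - 1) \<omega>)^2)) / (d * n) + (r1 i + r2 j + d)^2"
      using integrable_dev_square[OF n] by (simp add: prob_space)
    also have "(r1 i^2 * expectation (\<lambda>\<omega>. (dev n (i - 1) j \<omega>)^2)
         + r2 j^2 * expectation (\<lambda>\<omega>. (dev n i (j - 1) \<omega>)^2)) / (d * n) \<le> (D1 * n + D2 * n) / (d * n)"
      using D1[OF n] D2[OF n] d by (intro divide_right_mono add_mono) auto
    also have "(D1 * n + D2 * n) / (d * n) = (D1 + D2) / d"
      using n by (simp flip: distrib_right)
    finally show ?thesis by (simp add: T_def)
  qed
  show ?case
  proof (intro exI allI impI)
    fix n :: nat assume "1 \<le> n"
    then show "expectation (\<lambda>\<omega>. (dev n i j \<omega>)^2) \<le> T * n"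
    proof (induction n rule: dec_induct)
      case base
      have "(dev 1 i j \<omega>)^2 \<le> 1" for \<omega>
        using dev_bound[of 1 i j \<omega>] by (simp add: abs_square_le_1)
      then have "expectation (\<lambda>\<omega>. (dev 1 i j \<omega>)^2) \<le> 1"
        by (intro integral_le_const integrable_dev_square) auto
      then show ?case using T by simp
    next
      case (step n)
      then show ?case using stp[of n] by (simp add: algebra_simps)
    qed
  qed
qed

text \<open>At stage \<open>k^2\<close> the normalized second moment is at most
  \<open>D / k^2\<close>. The gaps are filled because one step changes \<open>dev\<close> by at most
  6, of which 3 come from the count and 3 from its mean.\<close>

lemma AE_dev_over_n: "AE \<omega> in M. (\<lambda>n. dev n i j \<omega> / n) \<longlonglongrightarrow> 0"
proof -
  obtain D :: real where D: "\<And>n. n \<ge> 1 \<Longrightarrow> expectation (\<lambda>\<omega>. (dev n i j \<omega>)^2) \<le> D * real n"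
    using second_moment_linear[of i j] by auto
  define s where "s k = (Suc k)^2" for k :: nat
  have s: "s k \<ge> 1" for k unfolding s_def by simp
  have sq: "AE \<omega> in M. (\<lambda>k. dev (s k) i j \<omega> / real (s k)) \<longlonglongrightarrow> 0"
  proof (rule AE_tendsto_zero_second_moment)
    fix k
    have i: "integrable M (\<lambda>\<omega>. dev (s k) i j \<omega>)"
      using integrable_N[OF s[of k]] by (simp add: dev_def[abs_def])
    then show "(\<lambda>\<omega>. dev (s k) i j \<omega> / real (s k)) \<in> borel_measurable M" by simp
    show "integrable M (\<lambda>\<omega>. (dev (s k) i j \<omega> / real (s k))^2)"
      using integrable_dev_square[OF s[of k]] by (simp add: power_divide)
  next
    show "summable (\<lambda>k. expectation (\<lambda>\<omega>. (dev (s k) i j \<omega> / real (s k))^2))"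
    proof (rule summable_comparison_test)
      show "\<exists>n. \<forall>k\<ge>n. norm (expectation (\<lambda>\<omega>. (dev (s k) i j \<omega> / real (s k))^2)) \<le> D * (1 / real (Suc k) ^ 2)"
      proof (intro exI allI impI)
        fix k
        have "expectation (\<lambda>\<omega>. (dev (s k) i j \<omega> / real (s k))^2) = expectation (\<lambda>\<omega>. (dev (s k) i j \<omega>)^2) / (real (s k))^2"
          by (simp add: power_divide)
        also have "\<dots> \<le> D * real (s k) / (real (s k))^2"
          using D[OF s[of k]] by (intro divide_right_mono) auto
        also have "\<dots> = D * (1 / real (s k))"
          by (simp add: power2_eq_square)
        also have "\<dots> = D * (1 / real (Suc k) ^ 2)" by (simp only: s_def of_nat_power)
        finally show "norm (expectation (\<lambda>\<omega>. (dev (s k) i j \<omega> / real (s k))^2)) \<le> D * (1 / real (Suc k) ^ 2)"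
          by simp
      qed
      have "summable (\<lambda>k. 1 / real (Suc k) ^ 2)"
        using inverse_power_summable[of 2] by (subst summable_Suc_iff) (simp add: inverse_eq_divide)
      then show "summable (\<lambda>k. D * (1 / real (Suc k) ^ 2))" by (rule summable_mult)
    qed
  qed
  have nu_inc: "\<bar>nu (Suc n) i j - nu n i j\<bar> \<le> 3" if n: "n \<ge> 1" for n
  proof -
    have "nu (Suc n) i j - nu n i j = expectation (jump (unit_at i j) n)"
      using integrable_N[OF n] integrable_N[of "Suc n"] n unfolding nu_def jump_def[abs_def]
      by (simp flip: N_deg_sum)
    moreover have "AE \<omega> in M. \<bar>jump (unit_at i j) n \<omega>\<bar> \<le> 3"
      using AE_good by eventually_elim (use jump_bound[OF n _ unit_at_bound] n in simp)
    then have "AE \<omega> in M. -3 \<le> jump (unit_at i j) n \<omega>" "AE \<omega> in M. jump (unit_at i j) n \<omega> \<le> 3"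
      by (auto elim!: eventually_mono)
    then have "-3 \<le> expectation (jump (unit_at i j) n)" "expectation (jump (unit_at i j) n) \<le> 3"
      by (auto intro!: integral_ge_const integral_le_const integrable_jump n)
    ultimately show ?thesis by simp
  qed
  show ?thesis
    using sq AE_good
  proof eventually_elim
    case (elim \<omega>)
    show ?case
    proof (rule tendsto_zero_from_squares)
      fix n :: nat assume n: "n \<ge> 1"
      have "\<bar>jump (unit_at i j) n \<omega>\<bar> \<le> 3"
        using jump_bound[OF n _ unit_at_bound] elim n by simp
      then show "\<bar>dev (Suc n) i j \<omega> - dev n i j \<omega>\<bar> \<le> 6"
        using nu_inc[OF n] unfolding dev_def jump_def N_deg_sum by linarith
    next
      have "(\<lambda>k. dev ((Suc k)^2) i j \<omega> / real ((Suc k)^2)) \<longlonglongrightarrow> 0" using elim by (simp add: s_def)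
      then show "(\<lambda>k. dev (k^2) i j \<omega> / real (k^2)) \<longlonglongrightarrow> 0"
        by (simp only: filterlim_sequentially_Suc[of "\<lambda>k. dev (k^2) i j \<omega> / real (k^2)"])
    qed
  qed
qed

section \<open>The limits \<open>p\<close> and their recursion\<close>

text \<open>Candidate for \<open>p\<close>. Since \<open>p\<close> is a definite description, its
  recursion becomes available only after convergence to this solution is known.\<close>

function pl :: "nat \<Rightarrow> nat \<Rightarrow> real" where
  "pl i j = (src i j + (if i = 0 then 0 else r1 i * pl (i - 1) j) + (if j = 0 then 0 else r2 j * pl i (j - 1)))
     / (1 + \<delta> i j)"
  by pat_completeness auto
termination by (relation "Wellfounded.measure (\<lambda>(i, j). i + j)") auto

declare pl.simps [simp del]

lemma pl_rec: "pl i j * (1 + \<delta> i j) = src i j + r1 i * pl (i - 1) j + r2 j * pl i (j - 1)"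
proof -
  have "1 + \<delta> i j \<noteq> 0" using delta_pos[of i j] by simp
  then have "pl i j * (1 + \<delta> i j) = src i j + (if i = 0 then 0 else r1 i * pl (i - 1) j) + (if j = 0 then 0 else r2 j * pl i (j - 1))"
    by (subst pl.simps) simp
  then show ?thesis by (simp add: r1_def r2_def)
qed

text \<open>Both \<open>nu n i j\<close> and \<open>n * pl i j\<close> solve the same recursion, so their difference solves the homogeneous one.\<close>

lemma nu_minus_pl_bounded: "\<exists>D. \<forall>n\<ge>1. \<bar>nu n i j - n * pl i j\<bar> \<le> D"
proof (induction "i + j" arbitrary: i j rule: less_induct)
  case less
  define ep where "ep n i j = nu n i j - real n * pl i j" for n i j
  have "\<exists>D::real. \<forall>n\<ge>1. \<bar>r1 i * ep n (i - 1) j\<bar> \<le> D"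
  proof (cases "i = 0")
    case True
    then show ?thesis by (intro exI[of _ 0]) (simp add: r1_def)
  next
    case False
    then obtain D where "\<forall>n\<ge>1. \<bar>ep n (i - 1) j\<bar> \<le> D" using less[of "i - 1" j] by (auto simp: ep_def)
    then show ?thesis by (intro exI[of _ "r1 i * D"]) (auto simp: abs_mult r_nonneg intro!: mult_left_mono)
  qed
  then obtain D1 where D1: "\<And>n. n \<ge> 1 \<Longrightarrow> \<bar>r1 i * ep n (i - 1) j\<bar> \<le> D1" by auto
  have "\<exists>D::real. \<forall>n\<ge>1. \<bar>r2 j * ep n i (j - 1)\<bar> \<le> D"
  proof (cases "j = 0")
    case True
    then show ?thesis by (intro exI[of _ 0]) (simp add: r2_def)
  next
    case False
    then obtain D where "\<forall>n\<ge>1. \<bar>ep n i (j - 1)\<bar> \<le> D" using less[of i "j - 1"] by (auto simp: ep_def)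
    then show ?thesis by (intro exI[of _ "r2 j * D"]) (auto simp: abs_mult r_nonneg intro!: mult_left_mono)
  qed
  then obtain D2 where D2: "\<And>n. n \<ge> 1 \<Longrightarrow> \<bar>r2 j * ep n i (j - 1)\<bar> \<le> D2" by auto
  have "\<exists>B. \<forall>n\<ge>1. \<bar>ep n i j\<bar> \<le> B"
  proof (rule perturbed_contraction_bounded[OF delta_pos[of i j], of "D1 + D2"])
    show "0 \<le> D1 + D2" using order.trans[OF abs_ge_zero D1[of 1]] order.trans[OF abs_ge_zero D2[of 1]] by simp
    fix n :: nat assume n: "n \<ge> 1"
    have "pl i j = src i j + (r1 i * pl (i - 1) j + (r2 j * pl i (j - 1) - \<delta> i j * pl i j))"
      using pl_rec[of i j] by (simp add: algebra_simps)
    moreover have "real (Suc n) * pl i j = real n * pl i j + pl i j" by (simp add: algebra_simps)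
    ultimately have e: "real (Suc n) * pl i j = real n * pl i j + (src i j + (r1 i * pl (i - 1) j + (r2 j * pl i (j - 1) - \<delta> i j * pl i j)))"
      by linarith
    have "ep (Suc n) i j - (1 - \<delta> i j / n) * ep n i j = (r1 i * ep n (i - 1) j + r2 j * ep n i (j - 1)) / n"
      unfolding ep_def nu_step[OF n] e using n by (simp add: field_simps)
    moreover have "\<bar>r1 i * ep n (i - 1) j + r2 j * ep n i (j - 1)\<bar> \<le> D1 + D2" using D1[OF n] D2[OF n] by linarith
    ultimately show "\<bar>ep (Suc n) i j - (1 - \<delta> i j / n) * ep n i j\<bar> \<le> (D1 + D2) / n"
      by (simp add: abs_divide divide_right_mono)
  qed
  then show ?case by (simp add: ep_def)
qed

text \<open>The power 1 serves the law of large numbers; the power 1/2 allows the limit law to be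
  centered at \<open>n * p i j\<close> instead of the mean.\<close>

lemma nu_minus_pl_limit:
  assumes k: "k > 0" shows "(\<lambda>n. (nu n i j - n * pl i j) / real n powr k) \<longlonglongrightarrow> 0"
proof -
  obtain D where D: "\<And>n. n \<ge> 1 \<Longrightarrow> \<bar>nu n i j - n * pl i j\<bar> \<le> D" using nu_minus_pl_bounded[of i j] by auto
  have "(\<lambda>n. D * real n powr - k) \<longlonglongrightarrow> D * 0"
    using k by (intro tendsto_intros tendsto_neg_powr filterlim_real_sequentially) auto
  then have "(\<lambda>n. D * real n powr - k) \<longlonglongrightarrow> 0" by simp
  then show ?thesis
  proof (rule Lim_null_comparison[rotated])
    show "\<forall>\<^sub>F n in sequentially. norm ((nu n i j - n * pl i j) / real n powr k) \<le> D * real n powr - k"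
      using eventually_ge_at_top[of 1]
    proof eventually_elim
      case (elim n)
      have "\<bar>nu n i j - n * pl i j\<bar> / real n powr k \<le> D / real n powr k"
        using D[OF elim] by (intro divide_right_mono) auto
      then show ?case by (simp add: powr_minus_divide)
    qed
  qed
qed

lemma AE_N_over_n: "AE \<omega> in M. (\<lambda>n. N n i j \<omega> / n) \<longlonglongrightarrow> pl i j"
  using AE_dev_over_n[of i j]
proof eventually_elim
  case (elim \<omega>)
  have nu0: "(\<lambda>n. (nu n i j - n * pl i j) / real n) \<longlonglongrightarrow> 0"
  proof (rule Lim_transform_eventually[OF nu_minus_pl_limit[of 1 i j]])
    show "\<forall>\<^sub>F n in sequentially. (nu n i j - n * pl i j) / real n powr 1 = (nu n i j - n * pl i j) / real n"
      by simp
  qed simp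
  have "(\<lambda>n. dev n i j \<omega> / n + (nu n i j - n * pl i j) / real n + pl i j) \<longlonglongrightarrow> 0 + 0 + pl i j"
    by (intro tendsto_intros elim nu0)
  then have "(\<lambda>n. dev n i j \<omega> / n + (nu n i j - n * pl i j) / real n + pl i j) \<longlonglongrightarrow> pl i j" by simp
  then show ?case
  proof (rule Lim_transform_eventually)
    show "\<forall>\<^sub>F n in sequentially. dev n i j \<omega> / n + (nu n i j - n * pl i j) / real n + pl i j = N n i j \<omega> / n"
      using eventually_ge_at_top[of 1] by eventually_elim (simp add: dev_def field_simps)
  qed
qed

lemma p_eq_pl: "p i j = pl i j"
  unfolding p_def
proof (rule the_equality)
  show "AE \<omega> in M. (\<lambda>n. N n i j \<omega> / real n) \<longlonglongrightarrow> pl i j" by (rule AE_N_over_n)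
  fix x assume "AE \<omega> in M. (\<lambda>n. N n i j \<omega> / real n) \<longlonglongrightarrow> x"
  with AE_N_over_n[of i j] have "AE \<omega> in M. x = pl i j"
    by eventually_elim (rule LIMSEQ_unique)
  then show "x = pl i j" by simp
qed

lemma AE_N_limit: "AE \<omega> in M. \<forall>i j. (\<lambda>n. N n i j \<omega> / n) \<longlonglongrightarrow> p i j"
  unfolding AE_all_countable p_eq_pl using AE_N_over_n by blast

lemma p_rec: "p i j * (1 + \<delta> i j) = src i j + r1 i * p (i - 1) j + r2 j * p i (j - 1)"
  unfolding p_eq_pl by (rule pl_rec)

text \<open>As \<open>p\<close> is deterministic, its properties may be read off along a single
  sample path outside the null sets.\<close>

lemma exists_typical:
  obtains \<omega> where "\<omega> \<in> space M" "\<And>n. n \<ge> 1 \<Longrightarrow> regular n \<omega>" "\<And>i j. (\<lambda>n. N n i j \<omega> / n) \<longlonglongrightarrow> p i j"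
proof -
  have "AE \<omega> in M. (\<forall>n\<ge>1. regular n \<omega>) \<and> (\<forall>i j. (\<lambda>n. N n i j \<omega> / n) \<longlonglongrightarrow> p i j)"
    using AE_good AE_N_limit by eventually_elim auto
  then have "\<exists>\<omega>\<in>space M. (\<forall>n\<ge>1. regular n \<omega>) \<and> (\<forall>i j. (\<lambda>n. N n i j \<omega> / n) \<longlonglongrightarrow> p i j)"
  proof (rule contrapos_pp)
    assume none: "\<not> (\<exists>\<omega>\<in>space M. (\<forall>n\<ge>1. regular n \<omega>) \<and> (\<forall>i j. (\<lambda>n. N n i j \<omega> / n) \<longlonglongrightarrow> p i j))"
    show "\<not> (AE \<omega> in M. (\<forall>n\<ge>1. regular n \<omega>) \<and> (\<forall>i j. (\<lambda>n. N n i j \<omega> / n) \<longlonglongrightarrow> p i j))"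
    proof
      assume "AE \<omega> in M. (\<forall>n\<ge>1. regular n \<omega>) \<and> (\<forall>i j. (\<lambda>n. N n i j \<omega> / n) \<longlonglongrightarrow> p i j)"
      with AE_space have "AE \<omega> in M. False" by eventually_elim (use none in blast)
      then show False by simp
    qed
  qed
  then show ?thesis using that by blast
qed

lemma N_00: "regular n \<omega> \<Longrightarrow> N n 0 0 \<omega> = 0"
  unfolding N_deg_sum deg_sum_def regular_def unit_at_def by (intro sum.neutral) auto

lemma p_00: "p 0 0 = 0"
proof -
  obtain \<omega> where w: "\<And>n. n \<ge> 1 \<Longrightarrow> regular n \<omega>" "\<And>i j. (\<lambda>n. N n i j \<omega> / n) \<longlonglongrightarrow> p i j" by (rule exists_typical) blast
  have "\<forall>\<^sub>F n in sequentially. N n 0 0 \<omega> / n = 0"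
    using eventually_ge_at_top[of 1] by eventually_elim (simp add: N_00 w)
  then have "(\<lambda>n. N n 0 0 \<omega> / n) \<longlonglongrightarrow> 0" by (rule tendsto_eventually)
  then show ?thesis using LIMSEQ_unique[OF w(2)] by blast
qed

lemma p_nonneg: "p i j \<ge> 0"
proof -
  obtain \<omega> where w: "\<And>i j. (\<lambda>n. N n i j \<omega> / n) \<longlonglongrightarrow> p i j" by (rule exists_typical) blast
  show ?thesis by (rule LIMSEQ_le_const[OF w]) (auto simp: N_bounds)
qed

section \<open>Total mass and mean degrees of the limits\<close>

text \<open>A finite rectangle captures only part of a degree sum, so the limit gives an inequality;
  equality is the business of \<open>preferential_recursion_mass\<close>, for which these bounds are
  the input.\<close>

lemma p_fatou:
  assumes h: "\<And>k l. h k l \<ge> 0" and lim: "\<And>n \<omega>. n \<ge> 1 \<Longrightarrow> regular n \<omega> \<Longrightarrow> deg_sum h n (G n \<omega>) \<le> n"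
  shows "(\<Sum>k<i. \<Sum>l<j. h k l * p k l) \<le> 1"
proof -
  obtain \<omega> where w: "\<And>n. n \<ge> 1 \<Longrightarrow> regular n \<omega>" "\<And>i j. (\<lambda>n. N n i j \<omega> / n) \<longlonglongrightarrow> p i j" by (rule exists_typical) blast
  have "(\<lambda>n. \<Sum>k<i. \<Sum>l<j. h k l * (N n k l \<omega> / n)) \<longlonglongrightarrow> (\<Sum>k<i. \<Sum>l<j. h k l * p k l)"
    by (intro tendsto_intros w)
  then show ?thesis
  proof (rule LIMSEQ_le_const2)
    show "\<exists>m. \<forall>n\<ge>m. (\<Sum>k<i. \<Sum>l<j. h k l * (N n k l \<omega> / n)) \<le> 1"
    proof (intro exI allI impI)
      fix n :: nat assume n: "n \<ge> 1"
      \<comment> \<open>Truncation makes \<open>deg_sum_finite_support\<close> applicable and keeps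
        the degree sum below that of \<open>h\<close>.\<close>
      define h' where "h' k l = (if k \<le> i \<and> l \<le> j then h k l else 0)" for k l
      have "(\<Sum>k<i. \<Sum>l<j. h k l * N n k l \<omega>) = (\<Sum>k<i. \<Sum>l<j. h' k l * N n k l \<omega>)"
        by (intro sum.cong refl) (auto simp: h'_def)
      also have "\<dots> \<le> (\<Sum>k<i. \<Sum>l=0..j. h' k l * N n k l \<omega>)"
        by (intro sum_mono sum_mono2) (auto simp: h'_def h N_bounds)
      also have "\<dots> \<le> (\<Sum>k=0..i. \<Sum>l=0..j. h' k l * N n k l \<omega>)"
        by (intro sum_mono2) (auto simp: h'_def h N_bounds intro!: sum_nonneg)
      also have "\<dots> = deg_sum h' n (G n \<omega>)"
        by (rule deg_sum_finite_support[symmetric]) (auto simp: h'_def)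
      also have "\<dots> \<le> deg_sum h n (G n \<omega>)"
        unfolding deg_sum_def by (intro sum_mono) (auto simp: h'_def h)
      also have "\<dots> \<le> n" by (rule lim[OF n w(1)[OF n]])
      finally show "(\<Sum>k<i. \<Sum>l<j. h k l * (N n k l \<omega> / n)) \<le> 1"
        using n by (simp add: divide_le_eq flip: sum_divide_distrib)
    qed
  qed
qed

lemma c_less_1: "c1 < 1" "c2 < 1"
  using params_pos params_sum by (auto simp: c1_def c2_def divide_less_eq)

lemma mass_in: "summable (\<lambda>l. p k l)" "(\<lambda>k. c1 * (real k + lam) * (\<Sum>l. p k l)) sums \<alpha>"
proof -
  have *: "1 + c1 * (real k + lam) + c2 * (real l + mu) = 1 + \<delta> k l" for k l by (simp add: \<delta>_def)
  have r: "(if k = 0 then 0 else c1 * (real k - 1 + lam) * y) = r1 k * y"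
    "(if k = 0 then 0 else c2 * (real k - 1 + mu) * y) = r2 k * y" for k y by (auto simp: r1_def r2_def)
  have "\<alpha> = c1 * (1 + lam)" using params_pos by (simp add: c1_def)
  then have par: "\<alpha> + \<gamma> = 1" "0 < c1" "c1 < 1" "0 < c2" "0 < lam" "0 < mu" "c1 * (1 + lam) = \<alpha>"
    using params_sum params_pos c_pos c_less_1 by auto
  have rec: "p k l * (1 + c1 * (real k + lam) + c2 * (real l + mu)) =
      (if k = 0 \<and> l = 1 then \<alpha> else 0) + (if k = 1 \<and> l = 0 then \<gamma> else 0)
      + (if k = 0 then 0 else c1 * (real k - 1 + lam) * p (k - 1) l)
      + (if l = 0 then 0 else c2 * (real l - 1 + mu) * p k (l - 1))" for k l
    unfolding * r p_rec src_def ..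
  have f: "(\<Sum>k<m. \<Sum>l<n. p k l) \<le> 1" "(\<Sum>k<m. \<Sum>l<n. real k * p k l) \<le> 1" "(\<Sum>k<m. \<Sum>l<n. real l * p k l) \<le> 1" for m n
    using p_fatou[of "\<lambda>k l. 1" n m] p_fatou[of "\<lambda>k l. real k" n m] p_fatou[of "\<lambda>k l. real l" n m]
    by (auto simp: regular_def deg_sum_linear)
  show "summable (\<lambda>l. p k l)" "(\<lambda>k. c1 * (real k + lam) * (\<Sum>l. p k l)) sums \<alpha>"
    by (rule preferential_recursion_mass[OF par p_nonneg rec f])+
qed

text \<open>In- and out-degree exchange roles: the first index of the recursion is now the
  out-degree, with \<gamma>, \<open>c2\<close>, \<open>mu\<close> in place of \<alpha>,
  \<open>c1\<close>, \<open>lam\<close>.\<close>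

lemma mass_out: "summable (\<lambda>k. p k l)" "(\<lambda>l. c2 * (real l + mu) * (\<Sum>k. p k l)) sums \<gamma>"
proof -
  have *: "1 + c2 * (real k + mu) + c1 * (real l + lam) = 1 + \<delta> l k" for k l by (simp add: \<delta>_def)
  have r: "(if k = 0 then 0 else c1 * (real k - 1 + lam) * y) = r1 k * y"
    "(if k = 0 then 0 else c2 * (real k - 1 + mu) * y) = r2 k * y" for k y by (auto simp: r1_def r2_def)
  have "\<gamma> = c2 * (1 + mu)" using params_pos by (simp add: c2_def)
  then have par: "\<gamma> + \<alpha> = 1" "0 < c2" "c2 < 1" "0 < c1" "0 < mu" "0 < lam" "c2 * (1 + mu) = \<gamma>"
    using params_sum params_pos c_pos c_less_1 by auto
  have rec: "p l k * (1 + c2 * (real k + mu) + c1 * (real l + lam)) =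
      (if k = 0 \<and> l = 1 then \<gamma> else 0) + (if k = 1 \<and> l = 0 then \<alpha> else 0)
      + (if k = 0 then 0 else c2 * (real k - 1 + mu) * p l (k - 1))
      + (if l = 0 then 0 else c1 * (real l - 1 + lam) * p (l - 1) k)" for k l
    unfolding * r p_rec src_def by auto
  have f: "(\<Sum>k<m. \<Sum>l<n. p l k) \<le> 1" "(\<Sum>k<m. \<Sum>l<n. real k * p l k) \<le> 1" "(\<Sum>k<m. \<Sum>l<n. real l * p l k) \<le> 1" for m n
    using p_fatou[of "\<lambda>k l. 1" m n] p_fatou[of "\<lambda>k l. real k" m n] p_fatou[of "\<lambda>k l. real l" m n]
    by (subst sum.swap, auto simp: regular_def deg_sum_linear)+
  show "summable (\<lambda>k. p k l)" "(\<lambda>l. c2 * (real l + mu) * (\<Sum>k. p k l)) sums \<gamma>"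
    by (rule preferential_recursion_mass[where q="\<lambda>l k. p k l", OF par p_nonneg rec f])+
qed

subsection \<open>Asymptotics of the coefficients\<close>

lemma b_outside: "i < k \<or> j < l \<Longrightarrow> b n0 i j k l n = 0"
  by (subst b.simps) simp

lemma b_initial: "k \<le> i \<Longrightarrow> l \<le> j \<Longrightarrow> n \<le> n0 \<Longrightarrow> b n0 i j k l n = 1"
  by (subst b.simps) auto

lemma b_Suc:
  assumes "k \<le> i" "l \<le> j" "n0 \<le> n" "1 \<le> n0"
  shows "b n0 i j k l (Suc n) = (b n0 i j k l n
              - b n0 i j (Suc k) l (Suc n) * (c1 * (real k + lam) / real n)
              - b n0 i j k (Suc l) (Suc n) * (c2 * (real l + mu) / real n)) / (1 - \<delta> k l / real n)"
  using assms by (subst b.simps) auto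

text \<open>If \<open>m = \<delta> k l\<close>, then \<open>n0 - \<delta> k l\<close> is a
  nonpositive integer, where \<open>Gamma\<close> takes the value 0. Nonvanishing of
  \<open>g\<close> thus protects all denominators of \<open>b\<close> from stage \<open>n0\<close>
  on.\<close>

lemma g_nonzero_imp:
  assumes "g n0 k l \<noteq> 0" "n0 \<le> m" shows "real m \<noteq> \<delta> k l"
proof
  assume "real m = \<delta> k l"
  then have "real n0 - \<delta> k l = - of_nat (m - n0)" using assms(2) by (simp add: of_nat_diff)
  then have "real n0 - \<delta> k l \<in> \<int>\<^sub>\<le>\<^sub>0" by (simp only: nonpos_Ints_of_int minus_of_nat_in_nonpos_Ints) 
  then show False using assms(1) by (simp add: g_def Gamma_eq_zero_iff)
qed

text \<open>The backward equation of the degree process: the coefficients at \<open>n\<close> are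
  those at \<open>Suc n\<close> averaged over the next move of the vertex.\<close>

lemma b_recursion:
  assumes n: "n0 \<le> n" "1 \<le> n0" and gnz: "\<forall>k\<le>i. \<forall>l\<le>j. g n0 k l \<noteq> 0"
  shows "b n0 i j k l (Suc n) + drift (\<lambda>k l. b n0 i j k l (Suc n)) k l / n = b n0 i j k l n"
proof (cases "k \<le> i \<and> l \<le> j")
  case True
  have np: "real n > 0" using n by simp
  have "real n \<noteq> \<delta> k l" by (rule g_nonzero_imp[OF _ n(1)]) (use True gnz in auto)
  then have nz: "1 - \<delta> k l / real n \<noteq> 0" using np by (simp add: field_simps)
  have "b n0 i j k l (Suc n) * (1 - \<delta> k l / real n) = b n0 i j k l n
              - b n0 i j (Suc k) l (Suc n) * (c1 * (real k + lam) / real n)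
              - b n0 i j k (Suc l) (Suc n) * (c2 * (real l + mu) / real n)"
    using b_Suc[of k i l j n0 n] True n nz by simp
  then show ?thesis unfolding drift_def \<delta>_def
    by (simp add: algebra_simps add_divide_distrib diff_divide_distrib)
next
  case False
  then show ?thesis by (auto simp: drift_def b_outside)
qed

lemma b_diag_nonzero:
  assumes "1 \<le> n0" "g n0 k l \<noteq> 0" shows "b n0 k l k l n \<noteq> 0"
proof (induction n)
  case 0
  then show ?case by (simp add: b_initial)
next
  case (Suc n)
  show ?case
  proof (cases "n0 \<le> n")
    case True
    then have "real n > 0" using assms by simp
    moreover have "real n \<noteq> \<delta> k l" by (rule g_nonzero_imp[OF assms(2) True])
    ultimately show ?thesis
      using Suc True assms by (subst b_Suc) (auto simp: b_outside)
  next
    case False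
    then show ?thesis by (simp add: b_initial)
  qed
qed

lemma b_diag_pochhammer:
  assumes "1 \<le> n0" "g n0 k l \<noteq> 0"
  shows "b n0 k l k l (n0 + m) = pochhammer (real n0) m / pochhammer (real n0 - \<delta> k l) m"
proof (induction m)
  case 0
  then show ?case by (simp add: b_initial)
next
  case (Suc m)
  have np: "real (n0 + m) > 0" using assms by simp
  have ne: "real (n0 + m) \<noteq> \<delta> k l" by (rule g_nonzero_imp[OF assms(2)]) simp
  have "b n0 k l k l (n0 + Suc m) = b n0 k l k l (n0 + m) / (1 - \<delta> k l / real (n0 + m))"
    using b_Suc[of k k l l n0 "n0 + m"] assms by (simp add: b_outside)
  also have "1 - \<delta> k l / real (n0 + m) = (real n0 - \<delta> k l + real m) / (real n0 + real m)"
    using np by (simp add: field_simps)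
  finally show ?case unfolding Suc pochhammer_Suc by (simp add: field_simps)
qed

text \<open>A quotient of two \<open>Gamma_series\<close>, Euler's limit at
  \<open>n0 - \<delta> k l\<close> and at \<open>n0\<close>, in which the factorials cancel.\<close>

lemma b_diag_limit:
  assumes n0: "1 \<le> n0" and gnz: "g n0 k l \<noteq> 0"
  shows "(\<lambda>n. b n0 k l k l n / real n powr \<delta> k l) \<longlonglongrightarrow> g n0 k l"
proof -
  define d where "d = \<delta> k l"
  have "(\<lambda>m. Gamma_series (real n0 - d) m / Gamma_series (real n0) m) \<longlonglongrightarrow> Gamma (real n0 - d) / Gamma (real n0)"
  proof (intro tendsto_divide Gamma_series_LIMSEQ)
    have "Gamma (real n0) > 0" using n0 by (intro Gamma_real_pos) simp
    then show "Gamma (real n0) \<noteq> 0" by simp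
  qed
  \<comment> \<open>\<open>Gamma_series\<close> at \<open>m\<close> contains \<open>Suc m\<close>
    Pochhammer factors, which corresponds to stage \<open>n0 + Suc m\<close>; this quotient adapts
    the power of \<open>m\<close> to that stage.\<close>
  moreover have "(\<lambda>m. (real m / real (n0 + Suc m)) powr d) \<longlonglongrightarrow> 1 powr d"
  proof (intro tendsto_powr tendsto_const)
    show "(\<lambda>m. real m / real (n0 + Suc m)) \<longlonglongrightarrow> 1" by real_asymp
  qed simp
  ultimately have "(\<lambda>m. Gamma_series (real n0 - d) m / Gamma_series (real n0) m * (real m / real (n0 + Suc m)) powr d)
      \<longlonglongrightarrow> Gamma (real n0 - d) / Gamma (real n0) * 1 powr d" by (rule tendsto_mult)
  then have "(\<lambda>m. Gamma_series (real n0 - d) m / Gamma_series (real n0) m * (real m / real (n0 + Suc m)) powr d)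
      \<longlonglongrightarrow> g n0 k l" by (simp add: g_def d_def)
  then have "(\<lambda>m. b n0 k l k l (n0 + Suc m) / real (n0 + Suc m) powr d) \<longlonglongrightarrow> g n0 k l"
  proof (rule Lim_transform_eventually)
    show "\<forall>\<^sub>F m in sequentially. Gamma_series (real n0 - d) m / Gamma_series (real n0) m * (real m / real (n0 + Suc m)) powr d
      = b n0 k l k l (n0 + Suc m) / real (n0 + Suc m) powr d"
      using eventually_gt_at_top[of 0]
    proof eventually_elim
      case (elim m)
      have "exp ((real n0 - d) * ln (real m)) / exp (real n0 * ln (real m)) * real m powr d = 1"
        using elim by (simp add: powr_def flip: exp_diff exp_add) (simp add: algebra_simps)
      then have e: "exp ((real n0 - d) * ln (real m)) / exp (real n0 * ln (real m)) = 1 / real m powr d"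
        using elim by (simp add: field_simps)
      have "Gamma_series (real n0 - d) m / Gamma_series (real n0) m
        = exp ((real n0 - d) * ln (real m)) / exp (real n0 * ln (real m)) *
          (pochhammer (real n0) (Suc m) / pochhammer (real n0 - d) (Suc m))"
        by (simp add: Gamma_series_def)
      also have "\<dots> = 1 / real m powr d * b n0 k l k l (n0 + Suc m)"
        by (simp only: e b_diag_pochhammer[OF assms] d_def[symmetric])
      finally show ?case using elim by (simp add: powr_divide)
    qed
  qed
  then have "(\<lambda>m. (\<lambda>n. b n0 k l k l n / real n powr d) (m + Suc n0)) \<longlonglongrightarrow> g n0 k l"
    by (simp add: add.commute)
  then have "(\<lambda>n. b n0 k l k l n / real n powr d) \<longlonglongrightarrow> g n0 k l" by (rule LIMSEQ_offset)
  then show ?thesis by (simp add: d_def)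
qed

section \<open>The constants \<open>\<xi>\<close> as limits of the coefficients\<close>

lemma xi_outside: "i < k \<or> j < l \<Longrightarrow> \<xi> i j k l = 0"
  by (subst \<xi>.simps) simp

lemma xi_diag: "\<xi> i j i j = 1"
  by (subst \<xi>.simps) simp

lemma xi_edge1: "k \<le> i \<Longrightarrow> 0 < k \<or> 0 < j \<Longrightarrow> \<xi> i j k j = (- 1) ^ (i - k) * (\<Prod>d = k..<i. (lam + real d) / (real i - real d))"
  by (subst \<xi>.simps) auto

lemma xi_edge2: "l \<le> j \<Longrightarrow> 0 < i \<or> 0 < l \<Longrightarrow> \<xi> i j i l = (- 1) ^ (j - l) * (\<Prod>r = l..<j. (mu + real r) / (real j - real r))"
  by (subst \<xi>.simps) auto

lemma delta_diff: "\<delta> i j - \<delta> k l = c1 * (real i - real k) + c2 * (real j - real l)"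
  by (simp add: \<delta>_def algebra_simps)

lemma delta_less:
  assumes "k \<le> i" "l \<le> j" "(k, l) \<noteq> (i, j)" shows "\<delta> k l < \<delta> i j"
proof -
  have "0 \<le> c1 * (real i - real k)" "0 \<le> c2 * (real j - real l)" using assms c_pos by auto
  moreover have "0 < c1 * (real i - real k) \<or> 0 < c2 * (real j - real l)" using assms c_pos by auto
  ultimately have "0 < \<delta> i j - \<delta> k l" unfolding delta_diff by linarith
  then show ?thesis by simp
qed

text \<open>On the edges \<open>l = j\<close> and \<open>k = i\<close> one neighbour lies outside
  the rectangle and \<open>c1\<close> or \<open>c2\<close> cancels, so the closed products obey the
  recursion of the interior. The convention at \<open>(0, 0)\<close> is the reason for the last
  exclusion.\<close>

lemma xi_recursion:
  assumes kl: "k \<le> i" "l \<le> j" "(k, l) \<noteq> (i, j)" "(k, l) \<noteq> (0, 0)"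
  shows "(\<delta> i j - \<delta> k l) * \<xi> i j k l = - (c1 * (real k + lam) * \<xi> i j (Suc k) l + c2 * (real l + mu) * \<xi> i j k (Suc l))"
proof -
  consider "l = j" "k < i" | "k = i" "l < j" | "k < i" "l < j" using kl by fastforce
  then show ?thesis
  proof cases
    case 1
    have "\<xi> i j k j = (- 1) ^ (i - k) * (\<Prod>d = k..<i. (lam + real d) / (real i - real d))"
      by (rule xi_edge1) (use 1 kl in auto)
    also have "i - k = Suc (i - Suc k)" using 1 by simp
    also have "(\<Prod>d = k..<i. (lam + real d) / (real i - real d)) = (lam + real k) / (real i - real k) * (\<Prod>d = Suc k..<i. (lam + real d) / (real i - real d))"
      using 1 by (simp add: prod.atLeast_Suc_lessThan)
    also have "(- 1) ^ Suc (i - Suc k) * ((lam + real k) / (real i - real k) * (\<Prod>d = Suc k..<i. (lam + real d) / (real i - real d)))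
      = - ((lam + real k) / (real i - real k)) * \<xi> i j (Suc k) j"
      using 1 by (subst xi_edge1) auto
    finally have "\<xi> i j k j = - ((lam + real k) / (real i - real k)) * \<xi> i j (Suc k) j" .
    then have "(real i - real k) * \<xi> i j k j = - ((lam + real k) * \<xi> i j (Suc k) j)"
      using 1 by (simp add: field_simps)
    then have "c1 * ((real i - real k) * \<xi> i j k j) = c1 * - ((lam + real k) * \<xi> i j (Suc k) j)" by (rule arg_cong)
    then show ?thesis using 1 by (simp add: delta_diff xi_outside mult_ac add.commute)
  next
    case 2
    have "\<xi> i j i l = (- 1) ^ (j - l) * (\<Prod>d = l..<j. (mu + real d) / (real j - real d))"
      by (rule xi_edge2) (use 2 kl in auto)
    also have "j - l = Suc (j - Suc l)" using 2 by simp
    also have "(\<Prod>d = l..<j. (mu + real d) / (real j - real d)) = (mu + real l) / (real j - real l) * (\<Prod>d = Suc l..<j. (mu + real d) / (real j - real d))"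
      using 2 by (simp add: prod.atLeast_Suc_lessThan)
    also have "(- 1) ^ Suc (j - Suc l) * ((mu + real l) / (real j - real l) * (\<Prod>d = Suc l..<j. (mu + real d) / (real j - real d)))
      = - ((mu + real l) / (real j - real l)) * \<xi> i j i (Suc l)"
      using 2 by (subst xi_edge2) auto
    finally have "\<xi> i j i l = - ((mu + real l) / (real j - real l)) * \<xi> i j i (Suc l)" .
    then have "(real j - real l) * \<xi> i j i l = - ((mu + real l) * \<xi> i j i (Suc l))"
      using 2 by (simp add: field_simps)
    then have "c2 * ((real j - real l) * \<xi> i j i l) = c2 * - ((mu + real l) * \<xi> i j i (Suc l))" by (rule arg_cong)
    then show ?thesis using 2 by (simp add: delta_diff xi_outside mult_ac add.commute)
  next
    case 3
    have "\<delta> i j - \<delta> k l \<noteq> 0" using delta_less[OF kl(1-3)] by simp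
    moreover have "\<xi> i j k l = - (c1 * (real k + lam) / (\<delta> i j - \<delta> k l) * \<xi> i j (Suc k) l
            + c2 * (real l + mu) / (\<delta> i j - \<delta> k l) * \<xi> i j k (Suc l))"
      using 3 kl(4) by (subst \<xi>.simps) auto
    moreover have "d * - (x / d * u + y / d * v) = - (x * u + y * v)" if "d \<noteq> 0" for d x y u v :: real
      using that by (simp add: field_simps)
    ultimately show ?thesis by simp
  qed
qed

text \<open>Variation of constants: dividing by the diagonal solution \<open>b n0 k l k l\<close> turns the recursion into a sum.\<close>

lemma b_limit_step:
  assumes n0: "1 \<le> n0" and kl: "k \<le> i" "l \<le> j" "(k, l) \<noteq> (i, j)" and gnz: "g n0 k l \<noteq> 0"
    and x1: "(\<lambda>n. b n0 i j (Suc k) l n / real n powr \<delta> i j) \<longlonglongrightarrow> x1"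
    and x2: "(\<lambda>n. b n0 i j k (Suc l) n / real n powr \<delta> i j) \<longlonglongrightarrow> x2"
  shows "(\<lambda>n. b n0 i j k l n / real n powr \<delta> i j) \<longlonglongrightarrow>
    - (c1 * (real k + lam) * x1 + c2 * (real l + mu) * x2) / (\<delta> i j - \<delta> k l)"
proof -
  define D where "D = \<delta> i j"
  define d where "d = \<delta> k l"
  \<comment> \<open>Excess growth: the forcing by the neighbours, of order \<open>n powr D\<close>,
    outruns the homogeneous solution \<open>P\<close>, of order \<open>n powr d\<close>.\<close>
  define q where "q = D - d"
  have q: "q > 0" using delta_less[OF kl] by (simp add: q_def D_def d_def)
  define P where "P n = b n0 k l k l n" for n
  have Pnz: "P n \<noteq> 0" for n unfolding P_def by (rule b_diag_nonzero[OF n0 gnz])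
  have Plim: "(\<lambda>n. P n / real n powr d) \<longlonglongrightarrow> g n0 k l" unfolding P_def d_def by (rule b_diag_limit[OF n0 gnz])
  define w where "w n = b n0 i j k l n" for n
  define s where "s n = c1 * (real k + lam) * b n0 i j (Suc k) l n + c2 * (real l + mu) * b n0 i j k (Suc l) n" for n
  define S where "S = c1 * (real k + lam) * x1 + c2 * (real l + mu) * x2"
  have slim: "(\<lambda>n. s n / real n powr D) \<longlonglongrightarrow> S"
    unfolding s_def S_def D_def add_divide_distrib times_divide_eq_right[symmetric]
    by (intro tendsto_intros x1 x2)
  define t where "t m = s (Suc m) / (real m * P m)" for m
  have wrec: "w (Suc n) / P (Suc n) = w n / P n - t n" if n: "n0 \<le> n" for n
  proof -
    have np: "real n > 0" using n n0 by simp
    have ne: "real n \<noteq> d" unfolding d_def by (rule g_nonzero_imp[OF gnz n])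
    have 1: "P (Suc n) = P n / (1 - d / real n)"
      using b_Suc[of k k l l n0 n] n n0 by (simp add: b_outside P_def d_def)
    have 2: "w (Suc n) = (w n - s (Suc n) / real n) / (1 - d / real n)"
      using b_Suc[of k i l j n0 n] kl n n0 by (simp add: w_def s_def d_def add_divide_distrib mult_ac diff_diff_eq)
    have nz: "1 - d / real n \<noteq> 0" using np ne by (simp add: field_simps)
    show ?thesis unfolding 1 2 t_def using nz Pnz[of n] np by (simp add: field_simps)
  qed
  have wsum: "w (Suc n) / P (Suc n) = w n0 / P n0 - (\<Sum>m=n0..n. t m)" if "n0 \<le> n" for n
    using that
  proof (induction n rule: dec_induct)
    case base
    show ?case using wrec[of n0] by simp
  next
    case (step n)
    then show ?case using wrec[of "Suc n"] by simp
  qed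
  have "(\<lambda>m. t m / real m powr (q - 1)) \<longlonglongrightarrow> S / g n0 k l"
  proof -
    have "(\<lambda>m. s (Suc m) / real (Suc m) powr D) \<longlonglongrightarrow> S" using slim by (rule LIMSEQ_Suc)
    moreover have "(\<lambda>m. (real (Suc m) / real m) powr D) \<longlonglongrightarrow> 1 powr D"
    proof (intro tendsto_powr tendsto_const)
      show "(\<lambda>m. real (Suc m) / real m) \<longlonglongrightarrow> 1" by real_asymp
    qed simp
    ultimately have "(\<lambda>m. s (Suc m) / real (Suc m) powr D * (real (Suc m) / real m) powr D / (P m / real m powr d)) \<longlonglongrightarrow> S * 1 powr D / g n0 k l"
      by (intro tendsto_divide tendsto_mult Plim gnz)
    then have "(\<lambda>m. s (Suc m) / real (Suc m) powr D * (real (Suc m) / real m) powr D / (P m / real m powr d)) \<longlonglongrightarrow> S / g n0 k l" by simp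
    then show ?thesis
    proof (rule Lim_transform_eventually)
      show "\<forall>\<^sub>F m in sequentially. s (Suc m) / real (Suc m) powr D * (real (Suc m) / real m) powr D / (P m / real m powr d) = t m / real m powr (q - 1)"
        using eventually_gt_at_top[of 0]
      proof eventually_elim
        case (elim m)
        have "real m powr (q - 1) = real m powr D / real m powr d / real m"
          using elim by (simp add: q_def powr_diff)
        moreover have "(real (Suc m) / real m) powr D = real (Suc m) powr D / real m powr D"
          by (simp add: powr_divide)
        ultimately show ?case using elim by (simp add: t_def del: of_nat_Suc)
      qed
    qed
  qed
  from powr_weighted_sum_limit[OF q this, of n0]
  have lim: "(\<lambda>n. real n powr - q * (\<Sum>m=n0..n. t m)) \<longlonglongrightarrow> S / g n0 k l / q" .
  \<comment> \<open>This removes the initial value \<open>w n0 / P n0\<close> from the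
    limit.\<close>
  have q0: "(\<lambda>n. real n powr - q) \<longlonglongrightarrow> 0"
    using q by (intro tendsto_neg_powr filterlim_real_sequentially) auto
  have Plim1: "(\<lambda>n. P (Suc n) / real (Suc n) powr d) \<longlonglongrightarrow> g n0 k l" using Plim by (rule LIMSEQ_Suc)
  have rat: "(\<lambda>n. (real n / real (Suc n)) powr q) \<longlonglongrightarrow> 1 powr q"
  proof (intro tendsto_powr tendsto_const)
    show "(\<lambda>m. real m / real (Suc m)) \<longlonglongrightarrow> 1" by real_asymp
  qed simp
  have "(\<lambda>n. (real n powr - q * (w n0 / P n0) - real n powr - q * (\<Sum>m=n0..n. t m)) * (P (Suc n) / real (Suc n) powr d) * (real n / real (Suc n)) powr q)
    \<longlonglongrightarrow> (0 * (w n0 / P n0) - S / g n0 k l / q) * g n0 k l * 1 powr q"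
    by (intro tendsto_intros lim q0 Plim1 rat)
  also have "(0 * (w n0 / P n0) - S / g n0 k l / q) * g n0 k l * 1 powr q = - S / q" using gnz by simp
  finally have "(\<lambda>n. (real n powr - q * (w n0 / P n0) - real n powr - q * (\<Sum>m=n0..n. t m)) * (P (Suc n) / real (Suc n) powr d) * (real n / real (Suc n)) powr q)
    \<longlonglongrightarrow> - S / q" .
  then have "(\<lambda>n. w (Suc n) / real (Suc n) powr D) \<longlonglongrightarrow> - S / q"
  proof (rule Lim_transform_eventually)
    show "\<forall>\<^sub>F n in sequentially. (real n powr - q * (w n0 / P n0) - real n powr - q * (\<Sum>m=n0..n. t m)) * (P (Suc n) / real (Suc n) powr d) * (real n / real (Suc n)) powr q
      = w (Suc n) / real (Suc n) powr D"
      using eventually_ge_at_top[of n0]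
    proof eventually_elim
      case (elim n)
      have n: "real n > 0" using elim n0 by simp
      have "real n powr - q * (w n0 / P n0) - real n powr - q * (\<Sum>m=n0..n. t m) = real n powr - q * (w (Suc n) / P (Suc n))"
        unfolding wsum[OF elim] by (simp add: algebra_simps)
      moreover have "real (Suc n) powr D = real (Suc n) powr d * real (Suc n) powr q" by (simp add: q_def flip: powr_add)
      moreover have "(real n / real (Suc n)) powr q = real n powr q / real (Suc n) powr q" by (simp add: powr_divide)
      moreover have "real n powr - q * real n powr q = 1" using n by (simp flip: powr_add)
      ultimately show ?case using Pnz[of "Suc n"] by (simp add: field_simps del: of_nat_Suc)
    qed
  qed
  then have "(\<lambda>n. w n / real n powr D) \<longlonglongrightarrow> - S / q" by (simp only: filterlim_sequentially_Suc[of "\<lambda>n. w n / real n powr D"])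
  then show ?thesis by (simp add: w_def D_def d_def q_def S_def)
qed

text \<open>Induction from \<open>(i, j)\<close> down to lower degrees. For larger
  \<open>(i, j)\<close> only existence of the limit is claimed at \<open>(0, 0)\<close>, where the
  value need not agree with the convention for \<open>\<xi>\<close>; existence is what
  \<open>b_bound\<close> needs there.\<close>

lemma b_limit_aux:
  assumes n0: "1 \<le> n0" and gnz: "\<forall>k\<le>i. \<forall>l\<le>j. g n0 k l \<noteq> 0"
  shows "\<exists>x. (\<lambda>n. b n0 i j k l n / real n powr \<delta> i j) \<longlonglongrightarrow> x \<and>
    ((k, l) \<noteq> (0, 0) \<or> (i, j) = (0, 0) \<longrightarrow> x = g n0 i j * \<xi> i j k l)"
proof (induction "(Suc i - k) + (Suc j - l)" arbitrary: k l rule: less_induct)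
  case less
  show ?case
  proof (cases "k \<le> i \<and> l \<le> j")
    case False
    then have "(\<lambda>n. b n0 i j k l n / real n powr \<delta> i j) \<longlonglongrightarrow> 0 \<and> 0 = g n0 i j * \<xi> i j k l"
      by (auto simp: b_outside xi_outside)
    then show ?thesis by blast
  next
    case kl: True
    show ?thesis
    proof (cases "(k, l) = (i, j)")
      case True
      then show ?thesis using b_diag_limit[OF n0, of i j] gnz by (auto simp: xi_diag)
    next
      case False
      have x1: "(\<lambda>n. b n0 i j (Suc k) l n / real n powr \<delta> i j) \<longlonglongrightarrow> g n0 i j * \<xi> i j (Suc k) l"
        using less[of "Suc k" l] kl by auto
      have x2: "(\<lambda>n. b n0 i j k (Suc l) n / real n powr \<delta> i j) \<longlonglongrightarrow> g n0 i j * \<xi> i j k (Suc l)"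
        using less[of k "Suc l"] kl by auto
      have "g n0 k l \<noteq> 0" using gnz kl by simp
      note lim = b_limit_step[OF n0 _ _ False this x1 x2]
      have "- (c1 * (real k + lam) * (g n0 i j * \<xi> i j (Suc k) l) + c2 * (real l + mu) * (g n0 i j * \<xi> i j k (Suc l))) / (\<delta> i j - \<delta> k l)
         = g n0 i j * \<xi> i j k l" if "(k, l) \<noteq> (0, 0)"
      proof -
        have "\<delta> i j - \<delta> k l \<noteq> 0" using delta_less[of k i l j] kl False by auto
        then have "\<xi> i j k l = - (c1 * (real k + lam) * \<xi> i j (Suc k) l + c2 * (real l + mu) * \<xi> i j k (Suc l)) / (\<delta> i j - \<delta> k l)"
          using xi_recursion[of k i l j] kl False that by (simp add: field_simps)
        then show ?thesis by (simp only:) (simp add: field_simps)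
      qed
      moreover have "(k, l) \<noteq> (0, 0)" if "(i, j) = (0, 0)" using that kl False by auto
      ultimately show ?thesis using lim kl by blast
    qed
  qed
qed

lemma b_limit:
  assumes "1 \<le> n0" "\<forall>k\<le>i. \<forall>l\<le>j. g n0 k l \<noteq> 0" "(k, l) \<noteq> (0, 0)"
  shows "(\<lambda>n. b n0 i j k l n / real n powr \<delta> i j) \<longlonglongrightarrow> g n0 i j * \<xi> i j k l"
  using b_limit_aux[OF assms(1,2), of k l] assms(3) by auto

lemma b_bound:
  assumes n0: "1 \<le> n0" and gnz: "\<forall>k\<le>i. \<forall>l\<le>j. g n0 k l \<noteq> 0"
  obtains D where "D \<ge> 0" "\<And>k l n. n \<ge> 1 \<Longrightarrow> \<bar>b n0 i j k l n\<bar> \<le> D * real n powr \<delta> i j"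
proof -
  have "\<exists>D. \<forall>n. \<bar>b n0 i j k l n / real n powr \<delta> i j\<bar> \<le> D" for k l
  proof -
    have "convergent (\<lambda>n. b n0 i j k l n / real n powr \<delta> i j)"
      using b_limit_aux[OF assms, of k l] by (auto simp: convergent_def)
    then have "Bseq (\<lambda>n. b n0 i j k l n / real n powr \<delta> i j)" by (rule convergent_imp_Bseq)
    then show ?thesis by (auto simp: Bseq_def)
  qed
  then obtain D where D: "\<And>k l n. \<bar>b n0 i j k l n / real n powr \<delta> i j\<bar> \<le> D k l" by metis
  have Dp: "D k l \<ge> 0" for k l using order.trans[OF abs_ge_zero D[of k l 0]] .
  show ?thesis
  proof (rule that)
    show "0 \<le> (\<Sum>k\<le>i. \<Sum>l\<le>j. D k l)" by (intro sum_nonneg Dp)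
    fix k l n :: nat assume n: "n \<ge> 1"
    show "\<bar>b n0 i j k l n\<bar> \<le> (\<Sum>k\<le>i. \<Sum>l\<le>j. D k l) * real n powr \<delta> i j"
    proof (cases "k \<le> i \<and> l \<le> j")
      case True
      have "\<bar>b n0 i j k l n\<bar> \<le> D k l * real n powr \<delta> i j"
        using D[of k l n] n by (simp add: abs_divide divide_le_eq split: if_splits)
      also have "\<dots> \<le> (\<Sum>k\<le>i. \<Sum>l\<le>j. D k l) * real n powr \<delta> i j"
      proof (rule mult_right_mono)
        have "D k l \<le> (\<Sum>l\<le>j. D k l)" using True by (intro member_le_sum) (auto simp: Dp)
        also have "\<dots> \<le> (\<Sum>k\<le>i. \<Sum>l\<le>j. D k l)" using True by (intro member_le_sum) (auto intro!: sum_nonneg Dp)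
        finally show "D k l \<le> (\<Sum>k\<le>i. \<Sum>l\<le>j. D k l)" .
      qed simp
      finally show ?thesis .
    next
      case False
      then show ?thesis by (auto simp: b_outside intro!: mult_nonneg_nonneg sum_nonneg Dp)
    qed
  qed
qed

subsection \<open>Increments of the martingales and their covariances\<close>

text \<open>The degree arguments come last, so that a stage of \<open>b\<close> can be passed to
  \<open>deg_sum\<close>, \<open>drift\<close> and the jumps.\<close>

definition bc :: "nat \<Rightarrow> nat \<Rightarrow> nat \<Rightarrow> nat \<Rightarrow> nat \<Rightarrow> nat \<Rightarrow> real" where
  "bc n0 i j n k l = b n0 i j k l n"

lemma bc_outside: "i < k \<or> j < l \<Longrightarrow> bc n0 i j n k l = 0"
  by (simp add: bc_def b_outside)

lemma Mart_deg_sum: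
  assumes "n \<ge> 1"
  shows "Mart n0 i j n \<omega> = deg_sum (bc n0 i j n) n (G n \<omega>) - expectation (\<lambda>\<omega>. deg_sum (bc n0 i j n) n (G n \<omega>))"
proof -
  have *: "deg_sum (bc n0 i j n) n (G n \<omega>) = (\<Sum>l=0..j. \<Sum>k=0..i. b n0 i j k l n * N n k l \<omega>)" for \<omega>
  proof (subst deg_sum_finite_support[of i j])
    show "bc n0 i j n k l = 0" if "i < k \<or> j < l" for k l by (rule bc_outside[OF that])
    show "(\<Sum>k=0..i. \<Sum>l=0..j. bc n0 i j n k l * N n k l \<omega>) = (\<Sum>l=0..j. \<Sum>k=0..i. b n0 i j k l n * N n k l \<omega>)"
      unfolding bc_def by (rule sum.swap)
  qed
  have "expectation (\<lambda>\<omega>. deg_sum (bc n0 i j n) n (G n \<omega>)) = (\<Sum>l=0..j. \<Sum>k=0..i. b n0 i j k l n * nu n k l)"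
    unfolding * nu_def using integrable_N[OF assms] by (simp add: Bochner_Integration.integral_sum)
  then show ?thesis unfolding Mart_def * by (simp add: right_diff_distrib sum_subtractf)
qed

lemma bc_deg_sum_rec:
  assumes n: "n0 \<le> n" "1 \<le> n0" and gnz: "\<forall>k\<le>i. \<forall>l\<le>j. g n0 k l \<noteq> 0"
  shows "deg_sum (bc n0 i j n) n x = deg_sum (bc n0 i j (Suc n)) n x + deg_sum (drift (bc n0 i j (Suc n))) n x / n"
proof -
  have "bc n0 i j n = (\<lambda>k l. bc n0 i j (Suc n) k l + (1 / real n) * drift (bc n0 i j (Suc n)) k l)"
  proof (intro ext)
    fix k l
    show "bc n0 i j n k l = bc n0 i j (Suc n) k l + (1 / real n) * drift (bc n0 i j (Suc n)) k l"
      using b_recursion[where i=i and j=j and k=k and l=l, OF assms] by (simp add: bc_def[abs_def] drift_def)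
  qed
  then show ?thesis by (simp only: deg_sum_linear) simp
qed

text \<open>Expressing the coefficients at \<open>n\<close> through those at \<open>Suc n\<close>
  produces exactly the drift part of \<open>jmean\<close>; the same recursion for the expectations
  accounts for the newborn terms.\<close>

lemma Mart_step:
  assumes n: "n0 \<le> n" "1 \<le> n0" and gnz: "\<forall>k\<le>i. \<forall>l\<le>j. g n0 k l \<noteq> 0" and reg: "regular n \<omega>"
  shows "Mart n0 i j (Suc n) \<omega> - Mart n0 i j n \<omega> = jump (bc n0 i j (Suc n)) n \<omega> - jmean (bc n0 i j (Suc n)) n \<omega>"
proof -
  have n1: "n \<ge> 1" using n by simp
  let ?f = "bc n0 i j (Suc n)"
  note rec = bc_deg_sum_rec[where i=i and j=j, OF n gnz]
  have "expectation (\<lambda>\<omega>. deg_sum (bc n0 i j n) n (G n \<omega>)) =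
      expectation (\<lambda>\<omega>. deg_sum ?f n (G n \<omega>)) + expectation (\<lambda>\<omega>. deg_sum (drift ?f) n (G n \<omega>)) / n"
    unfolding rec using integrable_of_G[OF n1, of "deg_sum ?f n"] integrable_of_G[OF n1, of "deg_sum (drift ?f) n"] by simp
  then show ?thesis
    unfolding Mart_deg_sum[OF n1] Mart_deg_sum[of "Suc n", OF le_SucI[OF n1]] jmean_drift[OF n1 reg] jump_def
      expectation_step[OF n1] rec[of "G n \<omega>"] by simp
qed

lemma Mart_measurable:
  assumes "n \<ge> 1" shows "Mart n0 i j n \<in> borel_measurable (history M G n)"
proof -
  have "Mart n0 i j n = (\<lambda>\<omega>. deg_sum (bc n0 i j n) n (G n \<omega>) - expectation (\<lambda>\<omega>. deg_sum (bc n0 i j n) n (G n \<omega>)))"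
    using Mart_deg_sum[OF assms] by (intro ext)
  then show ?thesis
    using history_borel[OF assms order_refl, of "\<lambda>x. deg_sum (bc n0 i j n) n x - expectation (\<lambda>\<omega>. deg_sum (bc n0 i j n) n (G n \<omega>))"]
    by simp
qed

lemma Mart_measurable_M [measurable]: "n \<ge> 1 \<Longrightarrow> Mart n0 i j n \<in> borel_measurable M"
  using measurable_from_subalg[OF subalgebra_history Mart_measurable] .

lemma cond_exp_Mart:
  assumes n: "n0 \<le> n" "1 \<le> n0" and gnz: "\<forall>k\<le>i. \<forall>l\<le>j. g n0 k l \<noteq> 0"
    and gnz': "\<forall>k\<le>s. \<forall>l\<le>t. g n0 k l \<noteq> 0"
  shows "AE \<omega> in M. real_cond_exp M (history M G n) (\<lambda>\<omega>. (Mart n0 i j (Suc n) \<omega> - Mart n0 i j n \<omega>) *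
       (Mart n0 s t (Suc n) \<omega> - Mart n0 s t n \<omega>)) \<omega> = jcov (bc n0 i j (Suc n)) (bc n0 s t (Suc n)) n \<omega>"
proof -
  interpret F: finite_measure_subalgebra M "history M G n" by (rule subalg_history)
  have n1: "n \<ge> 1" using n by simp
  let ?f = "bc n0 i j (Suc n)" and ?h = "bc n0 s t (Suc n)"
  have jm: "jmean f n \<in> borel_measurable M" for f
    unfolding jmean_def[abs_def] by (rule measurable_of_G[OF n1])
  have "AE \<omega> in M. real_cond_exp M (history M G n) (\<lambda>\<omega>. (Mart n0 i j (Suc n) \<omega> - Mart n0 i j n \<omega>) *
       (Mart n0 s t (Suc n) \<omega> - Mart n0 s t n \<omega>)) \<omega>
     = real_cond_exp M (history M G n) (\<lambda>\<omega>. (jump ?f n \<omega> - jmean ?f n \<omega>) * (jump ?h n \<omega> - jmean ?h n \<omega>)) \<omega>"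
  proof (rule F.real_cond_exp_cong)
    show "AE \<omega> in M. (Mart n0 i j (Suc n) \<omega> - Mart n0 i j n \<omega>) * (Mart n0 s t (Suc n) \<omega> - Mart n0 s t n \<omega>)
       = (jump ?f n \<omega> - jmean ?f n \<omega>) * (jump ?h n \<omega> - jmean ?h n \<omega>)"
      using AE_good
    proof eventually_elim
      case (elim \<omega>)
      then have "regular n \<omega>" using n1 by simp
      then show ?case
        using Mart_step[where i=i and j=j, OF n gnz] Mart_step[where i=s and j=t, OF n gnz'] by simp
    qed
  qed (use n1 jump_measurable[OF n1] jm in auto)
  then show ?thesis using cond_exp_jump_cov[OF n1, of ?f ?h] by eventually_elim simp
qed

lemma jcov_scale: "jcov (\<lambda>k l. s * f k l) (\<lambda>k l. t * h k l) n \<omega> = s * t * jcov f h n \<omega>"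
proof -
  have m: "jmean (\<lambda>k l. r * f k l) n \<omega> = r * jmean f n \<omega>" for r f
  proof -
    have "jump1 (\<lambda>k l. r * f k l) = (\<lambda>k l. r * jump1 f k l)" "jump2 (\<lambda>k l. r * f k l) = (\<lambda>k l. r * jump2 f k l)"
      by (simp_all add: jump1_def jump2_def fun_eq_iff algebra_simps)
    then show ?thesis unfolding jmean_def by (simp only: wmean_linear)
  qed
  have j: "(\<lambda>k l. jump1 (\<lambda>k l. s * f k l) k l * jump1 (\<lambda>k l. t * h k l) k l) = (\<lambda>k l. (s * t) * (jump1 f k l * jump1 h k l))"
    "(\<lambda>k l. jump2 (\<lambda>k l. s * f k l) k l * jump2 (\<lambda>k l. t * h k l) k l) = (\<lambda>k l. (s * t) * (jump2 f k l * jump2 h k l))"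
    by (simp_all add: jump1_def jump2_def fun_eq_iff algebra_simps)
  show ?thesis unfolding jcov_def j m wmean_linear by (simp add: algebra_simps)
qed

section \<open>Limits of conditional means and covariances\<close>

text \<open>Without the newborn's product, the summand vanishes outside a rectangle supporting
  \<open>f\<close> and \<open>h\<close>, since \<open>jump1 f\<close> is \<open>f 0 1\<close> and
  \<open>jump2 f\<close> is \<open>f 1 0\<close> there. Only finitely many counts remain.\<close>

definition corr :: "(nat \<Rightarrow> nat \<Rightarrow> real) \<Rightarrow> (nat \<Rightarrow> nat \<Rightarrow> real) \<Rightarrow> nat \<Rightarrow> nat \<Rightarrow> real" where
  "corr f h k l = c1 * (real k + lam) * (jump1 f k l * jump1 h k l - f 0 1 * h 0 1)
     + c2 * (real l + mu) * (jump2 f k l * jump2 h k l - f 1 0 * h 1 0)"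

lemma corr_outside:
  assumes "\<And>k l. i < k \<or> j < l \<Longrightarrow> f k l = 0" "\<And>k l. i < k \<or> j < l \<Longrightarrow> h k l = 0" "i < k \<or> j < l"
  shows "corr f h k l = 0"
  using assms(3) by (auto simp: corr_def jump1_def jump2_def assms(1,2))

lemma drift_outside:
  assumes "\<And>k l. i < k \<or> j < l \<Longrightarrow> f k l = 0" "i < k \<or> j < l" shows "drift f k l = 0"
  using assms(2) by (auto simp: drift_def assms(1))

lemma wmean_corr:
  assumes "n \<ge> 1" "regular n \<omega>" "\<And>k l. i < k \<or> j < l \<Longrightarrow> f k l = 0" "\<And>k l. i < k \<or> j < l \<Longrightarrow> h k l = 0"
  shows "wmean (\<lambda>k l. jump1 f k l * jump1 h k l) (\<lambda>k l. jump2 f k l * jump2 h k l) n (G n \<omega>)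
    = \<alpha> * (f 0 1 * h 0 1) + \<gamma> * (f 1 0 * h 1 0) + (\<Sum>k=0..i. \<Sum>l=0..j. corr f h k l * (N n k l \<omega> / n))"
proof -
  have "wmean (\<lambda>k l. jump1 f k l * jump1 h k l) (\<lambda>k l. jump2 f k l * jump2 h k l) n (G n \<omega>)
    = wmean (\<lambda>k l. f 0 1 * h 0 1) (\<lambda>k l. f 1 0 * h 1 0) n (G n \<omega>)
    + wmean (\<lambda>k l. jump1 f k l * jump1 h k l - f 0 1 * h 0 1) (\<lambda>k l. jump2 f k l * jump2 h k l - f 1 0 * h 1 0) n (G n \<omega>)"
    unfolding wmean_linear(1)[symmetric] by simp
  also have "wmean (\<lambda>k l. jump1 f k l * jump1 h k l - f 0 1 * h 0 1) (\<lambda>k l. jump2 f k l * jump2 h k l - f 1 0 * h 1 0) n (G n \<omega>)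
    = deg_sum (corr f h) n (G n \<omega>) / n"
    by (simp add: wmean_def corr_def[abs_def])
  also have "deg_sum (corr f h) n (G n \<omega>) = (\<Sum>k=0..i. \<Sum>l=0..j. corr f h k l * N n k l \<omega>)"
    by (rule deg_sum_finite_support) (rule corr_outside[OF assms(3,4)])
  finally show ?thesis by (simp add: wmean_const[OF assms(1,2)] sum_divide_distrib)
qed

text \<open>Limit of \<open>jmean\<close> when the rectangle up to \<open>(i, j)\<close> contains
  the support of \<open>f\<close>; \<open>blim\<close> is its analogue for products of two
  jumps.\<close>

definition mlim :: "(nat \<Rightarrow> nat \<Rightarrow> real) \<Rightarrow> nat \<Rightarrow> nat \<Rightarrow> real" where
  "mlim f i j = \<alpha> * f 0 1 + \<gamma> * f 1 0 + (\<Sum>k=0..i. \<Sum>l=0..j. drift f k l * p k l)"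

definition blim :: "(nat \<Rightarrow> nat \<Rightarrow> real) \<Rightarrow> (nat \<Rightarrow> nat \<Rightarrow> real) \<Rightarrow> nat \<Rightarrow> nat \<Rightarrow> real" where
  "blim f h i j = \<alpha> * (f 0 1 * h 0 1) + \<gamma> * (f 1 0 * h 1 0) + (\<Sum>k=0..i. \<Sum>l=0..j. corr f h k l * p k l)"

text \<open>No vertex has degree \<open>(0, 0)\<close>, so the coefficient there may be arbitrary.\<close>

lemma jcov_limit:
  assumes reg: "\<And>n. n \<ge> 1 \<Longrightarrow> regular n \<omega>" and lim: "\<And>k l. (\<lambda>n. N n k l \<omega> / n) \<longlonglongrightarrow> p k l"
    and f0: "\<And>n k l. i < k \<or> j < l \<Longrightarrow> f n k l = 0" and h0: "\<And>n k l. i < k \<or> j < l \<Longrightarrow> h n k l = 0"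
    and f: "\<And>k l. (k, l) \<noteq> (0, 0) \<Longrightarrow> (\<lambda>n. f n k l) \<longlonglongrightarrow> f' k l"
    and h: "\<And>k l. (k, l) \<noteq> (0, 0) \<Longrightarrow> (\<lambda>n. h n k l) \<longlonglongrightarrow> h' k l"
  shows "(\<lambda>n. jcov (f n) (h n) n \<omega>) \<longlonglongrightarrow> blim f' h' i j - mlim f' i j * mlim h' i j"
proof -
  have N0: "\<forall>\<^sub>F n in sequentially. N n 0 0 \<omega> / n = 0"
    using eventually_ge_at_top[of 1] by eventually_elim (simp add: N_00 reg)
  have trm: "(\<lambda>n. u n k l * (N n k l \<omega> / n)) \<longlonglongrightarrow> u' k l * p k l"
    if "\<And>k l. (k, l) \<noteq> (0, 0) \<Longrightarrow> (\<lambda>n. u n k l) \<longlonglongrightarrow> u' k l" for u :: "nat \<Rightarrow> nat \<Rightarrow> nat \<Rightarrow> real" and u' k l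
  proof (cases "(k, l) = (0, 0)")
    case True
    have "\<forall>\<^sub>F n in sequentially. u n k l * (N n k l \<omega> / n) = 0"
      using N0 by eventually_elim (use True in simp)
    then show ?thesis using True by (simp add: p_00 tendsto_eventually)
  next
    case False
    then show ?thesis by (intro tendsto_mult that lim)
  qed
  have m: "(\<lambda>n. jmean (f n) n \<omega>) \<longlonglongrightarrow> mlim f' i j"
    if f0: "\<And>n k l. i < k \<or> j < l \<Longrightarrow> f n k l = 0" 
      and f: "\<And>k l. (k, l) \<noteq> (0, 0) \<Longrightarrow> (\<lambda>n. f n k l) \<longlonglongrightarrow> f' k l" for f :: "nat \<Rightarrow> nat \<Rightarrow> nat \<Rightarrow> real" and f'
  proof -
    have "(\<lambda>n. drift (f n) k l) \<longlonglongrightarrow> drift f' k l" if "(k, l) \<noteq> (0, 0)" for k l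
      unfolding drift_def using that by (intro tendsto_intros f) auto
    then have "(\<lambda>n. \<alpha> * f n 0 1 + \<gamma> * f n 1 0 + (\<Sum>k=0..i. \<Sum>l=0..j. drift (f n) k l * (N n k l \<omega> / n))) \<longlonglongrightarrow> mlim f' i j"
      unfolding mlim_def by (intro tendsto_intros trm f) auto
    then show ?thesis
    proof (rule Lim_transform_eventually)
      show "\<forall>\<^sub>F n in sequentially. \<alpha> * f n 0 1 + \<gamma> * f n 1 0 + (\<Sum>k=0..i. \<Sum>l=0..j. drift (f n) k l * (N n k l \<omega> / n)) = jmean (f n) n \<omega>"
        using eventually_ge_at_top[of 1]
      proof eventually_elim
        case (elim n)
        have "deg_sum (drift (f n)) n (G n \<omega>) = (\<Sum>k=0..i. \<Sum>l=0..j. drift (f n) k l * N n k l \<omega>)"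
          by (rule deg_sum_finite_support) (rule drift_outside[OF f0])
        then show ?case by (simp add: jmean_drift[OF elim reg[OF elim]] sum_divide_distrib)
      qed
    qed
  qed
  have "(\<lambda>n. wmean (\<lambda>k l. jump1 (f n) k l * jump1 (h n) k l) (\<lambda>k l. jump2 (f n) k l * jump2 (h n) k l) n (G n \<omega>)) \<longlonglongrightarrow> blim f' h' i j"
  proof -
    have "(\<lambda>n. corr (f n) (h n) k l) \<longlonglongrightarrow> corr f' h' k l" if "(k, l) \<noteq> (0, 0)" for k l
      unfolding corr_def jump1_def jump2_def using that by (intro tendsto_intros f h) auto
    then have "(\<lambda>n. \<alpha> * (f n 0 1 * h n 0 1) + \<gamma> * (f n 1 0 * h n 1 0) + (\<Sum>k=0..i. \<Sum>l=0..j. corr (f n) (h n) k l * (N n k l \<omega> / n))) \<longlonglongrightarrow> blim f' h' i j"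
      unfolding blim_def by (intro tendsto_intros trm f h) auto
    then show ?thesis
    proof (rule Lim_transform_eventually)
      show "\<forall>\<^sub>F n in sequentially. \<alpha> * (f n 0 1 * h n 0 1) + \<gamma> * (f n 1 0 * h n 1 0) + (\<Sum>k=0..i. \<Sum>l=0..j. corr (f n) (h n) k l * (N n k l \<omega> / n))
         = wmean (\<lambda>k l. jump1 (f n) k l * jump1 (h n) k l) (\<lambda>k l. jump2 (f n) k l * jump2 (h n) k l) n (G n \<omega>)"
        using eventually_ge_at_top[of 1] by eventually_elim (simp add: wmean_corr[OF _ reg f0 h0])
    qed
  qed
  then show ?thesis unfolding jcov_def by (intro tendsto_intros m f0 h0 f h)
qed

lemma mlim_extend:
  assumes "\<And>k l. i < k \<or> j < l \<Longrightarrow> f k l = 0" "i \<le> i'" "j \<le> j'"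
  shows "mlim f i' j' = mlim f i j"
proof -
  have z: "drift f k l = 0" if "i < k \<or> j < l" for k l by (rule drift_outside[OF assms(1) that])
  have "(\<Sum>k=0..i'. \<Sum>l=0..j'. drift f k l * p k l) = (\<Sum>k=0..i'. \<Sum>l=0..j. drift f k l * p k l)"
    by (intro sum.cong sum.mono_neutral_right) (use assms(3) in \<open>auto simp: z\<close>)
  also have "\<dots> = (\<Sum>k=0..i. \<Sum>l=0..j. drift f k l * p k l)"
    by (intro sum.mono_neutral_right) (use assms(2) in \<open>auto simp: z\<close>)
  finally show ?thesis by (simp add: mlim_def)
qed

text \<open>Stationarity of \<open>p\<close>: inserting its recursion and shifting the summation
  index moves the transitions from \<open>p\<close> to \<open>f\<close>.\<close>

lemma mlim_eq_sum:
  assumes f0: "\<And>k l. i < k \<or> j < l \<Longrightarrow> f k l = 0"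
  shows "(\<Sum>k=0..i. \<Sum>l=0..j. f k l * p k l) = mlim f i j"
proof -
  \<comment> \<open>The shift loses the last term \<open>u i\<close>, which is 0 because
    \<open>f\<close> vanishes beyond the rectangle.\<close>
  have shift: "(\<Sum>k=0..i. (if k = 0 then 0 else u (k - 1))) = (\<Sum>k=0..i. u k)" if "u i = 0" for u :: "nat \<Rightarrow> real" and i
  proof (cases i)
    case 0
    then show ?thesis using that by simp
  next
    case (Suc i')
    have "(\<Sum>k=0..i. (if k = 0 then 0 else u (k - 1))) = (\<Sum>k=0..i'. u k)"
      unfolding Suc by (subst sum.atLeast0_atMost_Suc_shift) simp
    then show ?thesis using that Suc by simp
  qed
  have rp: "p k l = src k l + r1 k * p (k - 1) l + r2 l * p k (l - 1) - \<delta> k l * p k l" for k l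
    using p_rec[of k l] by (simp add: algebra_simps)
  have "(\<Sum>k=0..i. \<Sum>l=0..j. f k l * p k l) =
      (\<Sum>k=0..i. \<Sum>l=0..j. f k l * (src k l + r1 k * p (k - 1) l + r2 l * p k (l - 1) - \<delta> k l * p k l))"
    by (subst rp) (rule refl)
  also have "\<dots> = (\<Sum>k=0..i. \<Sum>l=0..j. f k l * src k l) + (\<Sum>k=0..i. \<Sum>l=0..j. f k l * (r1 k * p (k - 1) l))
     + (\<Sum>k=0..i. \<Sum>l=0..j. f k l * (r2 l * p k (l - 1))) - (\<Sum>k=0..i. \<Sum>l=0..j. f k l * (\<delta> k l * p k l))"
    by (simp add: distrib_left right_diff_distrib sum.distrib sum_subtractf)
  also have "(\<Sum>k=0..i. \<Sum>l=0..j. f k l * src k l) = \<alpha> * f 0 1 + \<gamma> * f 1 0"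
  proof -
    have s: "f k l * src k l = (if k = 0 then (if l = 1 then \<alpha> * f 0 1 else 0) else 0) + (if k = 1 then (if l = 0 then \<gamma> * f 1 0 else 0) else 0)" for k l
      by (auto simp: src_def)
    have "(\<Sum>k=0..i. \<Sum>l=0..j. f k l * src k l) = (\<Sum>k=0..i. (if k = 0 then (if 1 \<le> j then \<alpha> * f 0 1 else 0) else 0)) + (\<Sum>k=0..i. if k = 1 then \<gamma> * f 1 0 else 0)"
      unfolding s sum.distrib by (intro arg_cong2[where f="(+)"] sum.cong refl) auto
    also have "\<dots> = \<alpha> * f 0 1 + \<gamma> * f 1 0"
      using f0[of 0 1] f0[of 1 0] by (auto simp: not_le)
    finally show ?thesis .
  qed
  also have "(\<Sum>k=0..i. \<Sum>l=0..j. f k l * (r1 k * p (k - 1) l)) = (\<Sum>k=0..i. \<Sum>l=0..j. c1 * (real k + lam) * f (Suc k) l * p k l)"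
  proof -
    have "(\<Sum>k=0..i. \<Sum>l=0..j. f k l * (r1 k * p (k - 1) l)) = (\<Sum>k=0..i. if k = 0 then 0 else (\<lambda>k. \<Sum>l=0..j. c1 * (real k + lam) * f (Suc k) l * p k l) (k - 1))"
      by (intro sum.cong refl) (auto simp: r1_def of_nat_diff intro!: sum.cong)
    also have "\<dots> = (\<Sum>k=0..i. \<Sum>l=0..j. c1 * (real k + lam) * f (Suc k) l * p k l)"
      by (rule shift) (simp add: f0)
    finally show ?thesis .
  qed
  also have "(\<Sum>k=0..i. \<Sum>l=0..j. f k l * (r2 l * p k (l - 1))) = (\<Sum>k=0..i. \<Sum>l=0..j. c2 * (real l + mu) * f k (Suc l) * p k l)"
  proof (rule sum.cong[OF refl])
    fix k
    have "(\<Sum>l=0..j. f k l * (r2 l * p k (l - 1))) = (\<Sum>l=0..j. if l = 0 then 0 else (\<lambda>l. c2 * (real l + mu) * f k (Suc l) * p k l) (l - 1))"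
      by (intro sum.cong refl) (auto simp: r2_def of_nat_diff)
    also have "\<dots> = (\<Sum>l=0..j. c2 * (real l + mu) * f k (Suc l) * p k l)"
      by (rule shift) (simp add: f0)
    finally show "(\<Sum>l=0..j. f k l * (r2 l * p k (l - 1))) = (\<Sum>l=0..j. c2 * (real l + mu) * f k (Suc l) * p k l)" .
  qed
  finally show ?thesis
    by (simp add: mlim_def drift_def \<delta>_def algebra_simps sum.distrib sum_subtractf)
qed

lemma e_mlim: "e i j = mlim (\<xi> i j) i j"
  unfolding e_def using mlim_eq_sum[of i j "\<xi> i j"] xi_outside by (subst sum.swap) simp

lemma a_mlim: "a i j = - mlim (\<xi> i j) i j"
proof -
  have "(\<Sum>l=0..j. \<Sum>k=0..i. p k l * (\<delta> k l * \<xi> i j k l - c1 * (real k + lam) * \<xi> i j (k + 1) l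
       - c2 * (real l + mu) * \<xi> i j k (l + 1))) = (\<Sum>k=0..i. \<Sum>l=0..j. - (drift (\<xi> i j) k l * p k l))"
    by (subst sum.swap) (intro sum.cong refl, simp add: drift_def \<delta>_def algebra_simps)
  then show ?thesis unfolding a_def mlim_def by (simp add: sum_negf)
qed

text \<open>The newborn products multiply \<open>in1\<close> and \<open>in2\<close> over all
  degrees, which \<open>mass_in\<close> and \<open>mass_out\<close> sum to \<alpha> and \<gamma>;
  lost mass would show up here. The remainder is \<open>corr\<close>, of finite support.\<close>

lemma B_blim:
  assumes "i \<le> I" "s \<le> I" "j \<le> J" "t \<le> J"
  shows "B i j s t = blim (\<xi> i j) (\<xi> s t) I J"
proof -
  define f where "f = \<xi> i j"
  define h where "h = \<xi> s t"
  have f0: "f k l = 0" "h k l = 0" if "I < k \<or> J < l" for k l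
    using that assms by (auto simp: f_def h_def xi_outside)
  have corr0: "corr f h k l = 0" if "I < k \<or> J < l" for k l by (rule corr_outside[OF f0 that])
  define in1 where "in1 = (\<lambda>r q. c1 * (real r + lam) * p r q)"
  define in2 where "in2 = (\<lambda>r q. c2 * (real q + mu) * p r q)"
  have s1: "summable (\<lambda>r. in1 r q)" and o1: "(\<lambda>q. \<Sum>r. in1 r q) sums \<alpha>" for q
  proof -
    have a: "in1 r q \<ge> 0" for r q unfolding in1_def using c_pos params_pos p_nonneg by simp
    have b: "summable (in1 r)" for r unfolding in1_def by (intro summable_mult mass_in)
    have c: "(\<lambda>r. \<Sum>q. in1 r q) sums \<alpha>" using mass_in(2) mass_in(1) unfolding in1_def by (simp add: suminf_mult)
    show "summable (\<lambda>r. in1 r q)" by (rule sums_swap_nonneg(1)[where f=in1, OF a b c])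
    show "(\<lambda>q. \<Sum>r. in1 r q) sums \<alpha>" by (rule sums_swap_nonneg(2)[where f=in1, OF a b c])
  qed
  have s2: "summable (\<lambda>r. in2 r q)" and o2: "(\<lambda>q. \<Sum>r. in2 r q) sums \<gamma>" for q
    using mass_out unfolding in2_def by (auto intro!: summable_mult simp: suminf_mult)
  define P where "P = f 0 1 * h 0 1"
  define Q where "Q = f 1 0 * h 1 0"
  have trm: "c1 * (real r + lam) * p r q * (f (r + 1) q + f 0 1 - f r q) * (h (r + 1) q + h 0 1 - h r q)
     + c2 * (real q + mu) * p r q * (f r (q + 1) + f 1 0 - f r q) * (h r (q + 1) + h 1 0 - h r q)
     = P * in1 r q + Q * in2 r q + corr f h r q * p r q" for r q
    unfolding P_def Q_def in1_def in2_def corr_def jump1_def jump2_def by (simp add: algebra_simps)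
  have inner: "(\<lambda>r. P * in1 r q + Q * in2 r q + corr f h r q * p r q) sums
      (P * (\<Sum>r. in1 r q) + Q * (\<Sum>r. in2 r q) + (\<Sum>r=0..I. corr f h r q * p r q))" for q
    by (intro sums_add sums_mult summable_sums s1 s2 sums_finite) (auto simp: corr0 not_le)
  have outer: "(\<lambda>q. P * (\<Sum>r. in1 r q) + Q * (\<Sum>r. in2 r q) + (\<Sum>r=0..I. corr f h r q * p r q)) sums
      (P * \<alpha> + Q * \<gamma> + (\<Sum>q=0..J. \<Sum>r=0..I. corr f h r q * p r q))"
    by (intro sums_add sums_mult o1 o2 sums_finite) (auto simp: corr0 not_le)
  have "B i j s t = P * \<alpha> + Q * \<gamma> + (\<Sum>q=0..J. \<Sum>r=0..I. corr f h r q * p r q)"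
    unfolding B_def f_def[symmetric] h_def[symmetric] trm sums_unique[OF inner, symmetric]
    by (rule sums_unique[OF outer, symmetric])
  then show ?thesis
    by (subst (asm) sum.swap) (simp add: blim_def f_def[symmetric] h_def[symmetric] P_def Q_def mult_ac)
qed

text \<open>With \<open>a = - m\<close> and \<open>e = m\<close> for \<open>m = mlim\<close>, the
  three products in \<open>A\<close> add up to minus the product of the two means.\<close>

lemma C_limit:
  assumes "i \<le> I" "s \<le> I" "j \<le> J" "t \<le> J"
  shows "C i j s t = blim (\<xi> i j) (\<xi> s t) I J - mlim (\<xi> i j) I J * mlim (\<xi> s t) I J"
proof -
  have m: "mlim (\<xi> i j) I J = mlim (\<xi> i j) i j" "mlim (\<xi> s t) I J = mlim (\<xi> s t) s t"
    using assms by (auto intro!: mlim_extend simp: xi_outside)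
  show ?thesis unfolding C_def A_def a_mlim e_mlim B_blim[OF assms] m by simp
qed

lemma blim_scale: "blim (\<lambda>k l. u * f k l) (\<lambda>k l. w * h k l) i j = u * w * blim f h i j"
proof -
  have "corr (\<lambda>k l. u * f k l) (\<lambda>k l. w * h k l) k l = u * w * corr f h k l" for k l
    by (simp add: corr_def jump1_def jump2_def algebra_simps)
  then show ?thesis by (simp add: blim_def algebra_simps sum_distrib_left)
qed

lemma mlim_scale: "mlim (\<lambda>k l. u * f k l) i j = u * mlim f i j"
proof -
  have "drift (\<lambda>k l. u * f k l) k l = u * drift f k l" for k l
    by (simp add: drift_def algebra_simps)
  then show ?thesis by (simp add: mlim_def algebra_simps sum_distrib_left)
qed

lemma jcov_bc_limit:
  assumes reg: "\<And>n. n \<ge> 1 \<Longrightarrow> regular n \<omega>" and lim: "\<And>k l. (\<lambda>n. N n k l \<omega> / n) \<longlonglongrightarrow> p k l"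
    and n0: "1 \<le> n0" and gnz: "\<forall>k\<le>i. \<forall>l\<le>j. g n0 k l \<noteq> 0" and gnz': "\<forall>k\<le>s. \<forall>l\<le>t. g n0 k l \<noteq> 0"
  shows "(\<lambda>n. jcov (bc n0 i j (Suc n)) (bc n0 s t (Suc n)) n \<omega> / real (Suc n) powr (\<delta> i j + \<delta> s t)) \<longlonglongrightarrow> \<tau> n0 i j s t"
proof -
  define f where "f n k l = inverse (real (Suc n) powr \<delta> i j) * bc n0 i j (Suc n) k l" for n k l
  define h where "h n k l = inverse (real (Suc n) powr \<delta> s t) * bc n0 s t (Suc n) k l" for n k l
  \<comment> \<open>The maxima provide one rectangle that contains both supports.\<close>
  have "(\<lambda>n. jcov (f n) (h n) n \<omega>) \<longlonglongrightarrow> blim (\<lambda>k l. g n0 i j * \<xi> i j k l) (\<lambda>k l. g n0 s t * \<xi> s t k l) (max i s) (max j t)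
    - mlim (\<lambda>k l. g n0 i j * \<xi> i j k l) (max i s) (max j t) * mlim (\<lambda>k l. g n0 s t * \<xi> s t k l) (max i s) (max j t)"
  proof (rule jcov_limit[OF reg lim])
    show "f n k l = 0" "h n k l = 0" if "max i s < k \<or> max j t < l" for n k l
      using that by (auto simp: f_def h_def bc_outside)
    show "(\<lambda>n. f n k l) \<longlonglongrightarrow> g n0 i j * \<xi> i j k l" if "(k, l) \<noteq> (0, 0)" for k l
      using LIMSEQ_Suc[OF b_limit[where i=i and j=j, OF n0 gnz that]] by (simp add: f_def bc_def field_simps)
    show "(\<lambda>n. h n k l) \<longlonglongrightarrow> g n0 s t * \<xi> s t k l" if "(k, l) \<noteq> (0, 0)" for k l
      using LIMSEQ_Suc[OF b_limit[where i=s and j=t, OF n0 gnz' that]] by (simp add: h_def bc_def field_simps)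
  qed
  also have "blim (\<lambda>k l. g n0 i j * \<xi> i j k l) (\<lambda>k l. g n0 s t * \<xi> s t k l) (max i s) (max j t)
    - mlim (\<lambda>k l. g n0 i j * \<xi> i j k l) (max i s) (max j t) * mlim (\<lambda>k l. g n0 s t * \<xi> s t k l) (max i s) (max j t)
    = \<tau> n0 i j s t"
    unfolding blim_scale mlim_scale \<tau>_def
      C_limit[of i "max i s" s j "max j t" t, OF max.cobounded1 max.cobounded2 max.cobounded1 max.cobounded2]
    by (simp add: algebra_simps)
  finally show ?thesis
    unfolding f_def[abs_def] h_def[abs_def] jcov_scale by (simp add: powr_add divide_inverse mult_ac)
qed

text \<open>Covariances of order \<open>m powr (\<delta> i j + \<delta> s t)\<close> are summed, and
  the resulting divisor turns \<open>\<tau>\<close> into \<open>\<sigma>2\<close>. The free start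
  \<open>r\<close> serves both \<open>V\<close> and the array of the central limit theorem.\<close>

lemma weighted_cov_limit:
  assumes reg: "\<And>n. n \<ge> 1 \<Longrightarrow> regular n \<omega>" and lim: "\<And>k l. (\<lambda>n. N n k l \<omega> / n) \<longlonglongrightarrow> p k l"
    and n0: "1 \<le> n0" and gnz: "\<forall>k\<le>i. \<forall>l\<le>j. g n0 k l \<noteq> 0" and gnz': "\<forall>k\<le>s. \<forall>l\<le>t. g n0 k l \<noteq> 0"
    and q: "\<And>m. m \<ge> n0 \<Longrightarrow> q (Suc m) = jcov (bc n0 i j (Suc m)) (bc n0 s t (Suc m)) m \<omega>"
  shows "(\<lambda>n. real n powr - (\<delta> i j + \<delta> s t + 1) * (\<Sum>m=r..n. q m)) \<longlonglongrightarrow> \<sigma>2 n0 i j s t"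
proof -
  have "(\<lambda>m. q (Suc m) / real (Suc m) powr ((\<delta> i j + \<delta> s t + 1) - 1)) \<longlonglongrightarrow> \<tau> n0 i j s t"
  proof (rule Lim_transform_eventually[OF jcov_bc_limit[where i=i and j=j and s=s and t=t, OF reg lim n0 gnz gnz']])
    show "\<forall>\<^sub>F m in sequentially. jcov (bc n0 i j (Suc m)) (bc n0 s t (Suc m)) m \<omega> / real (Suc m) powr (\<delta> i j + \<delta> s t)
      = q (Suc m) / real (Suc m) powr ((\<delta> i j + \<delta> s t + 1) - 1)"
      using eventually_ge_at_top[of n0] by eventually_elim (simp add: q)
  qed
  then have "(\<lambda>m. q m / real m powr ((\<delta> i j + \<delta> s t + 1) - 1)) \<longlonglongrightarrow> \<tau> n0 i j s t"
    by (simp only: filterlim_sequentially_Suc[of "\<lambda>m. q m / real m powr ((\<delta> i j + \<delta> s t + 1) - 1)"])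
  from powr_weighted_sum_limit[OF _ this, of r] show ?thesis
    using delta_pos[of i j] delta_pos[of s t] by (simp add: \<sigma>2_def add_ac)
qed

lemma AE_cond_exp_Mart:
  assumes n0: "1 \<le> n0" and gnz: "\<forall>k\<le>i. \<forall>l\<le>j. g n0 k l \<noteq> 0" and gnz': "\<forall>k\<le>s. \<forall>l\<le>t. g n0 k l \<noteq> 0"
  shows "AE \<omega> in M. \<forall>n\<ge>n0. real_cond_exp M (history M G n) (\<lambda>\<omega>. (Mart n0 i j (Suc n) \<omega> - Mart n0 i j n \<omega>) *
       (Mart n0 s t (Suc n) \<omega> - Mart n0 s t n \<omega>)) \<omega> = jcov (bc n0 i j (Suc n)) (bc n0 s t (Suc n)) n \<omega>"
  unfolding AE_all_countable
proof
  fix n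
  show "AE \<omega> in M. n \<ge> n0 \<longrightarrow> real_cond_exp M (history M G n) (\<lambda>\<omega>. (Mart n0 i j (Suc n) \<omega> - Mart n0 i j n \<omega>) *
       (Mart n0 s t (Suc n) \<omega> - Mart n0 s t n \<omega>)) \<omega> = jcov (bc n0 i j (Suc n)) (bc n0 s t (Suc n)) n \<omega>"
    using cond_exp_Mart[where i=i and j=j and s=s and t=t, OF _ n0 gnz gnz'] by (cases "n \<ge> n0") auto
qed

lemma V_limit:
  assumes n0: "1 \<le> n0" and gnz: "\<forall>k\<le>i. \<forall>l\<le>j. g n0 k l \<noteq> 0" and gnz': "\<forall>k\<le>s. \<forall>l\<le>t. g n0 k l \<noteq> 0"
  shows "AE \<omega> in M. (\<lambda>n. V n0 Imax Omax i j s t n \<omega>) \<longlonglongrightarrow> \<sigma>2 n0 i j s t"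
  using AE_good AE_N_limit AE_cond_exp_Mart[where i=i and j=j and s=s and t=t, OF n0 gnz gnz']
proof eventually_elim
  case (elim \<omega>)
  define q where "q m = real_cond_exp M (history M G (m - 1)) (\<lambda>\<omega>. (Mart n0 i j m \<omega> - Mart n0 i j (m - 1) \<omega>) *
       (Mart n0 s t m \<omega> - Mart n0 s t (m - 1) \<omega>)) \<omega>" for m
  have "(\<lambda>n. real n powr - (\<delta> i j + \<delta> s t + 1) * (\<Sum>m=max Imax Omax + 1..n. q m)) \<longlonglongrightarrow> \<sigma>2 n0 i j s t"
    by (rule weighted_cov_limit[where i=i and j=j and s=s and t=t, OF _ _ n0 gnz gnz']) (use elim in \<open>auto simp: q_def\<close>)
  then show ?case by (simp only: V_def q_def sum_distrib_left)
qed

subsection \<open>Gaussian limit of linear combinations of the martingales\<close>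

lemma AE_all_finite:
  fixes P :: "'i::finite \<Rightarrow> 'w \<Rightarrow> bool"
  assumes "\<And>i. AE \<omega> in M. P i \<omega>" shows "AE \<omega> in M. \<forall>i. P i \<omega>"
  using AE_finite_allI[where S=UNIV and M=M and Q=P] assms by simp

text \<open>Stated with \<open>n\<close> instead of \<open>m\<close>, which
  \<open>\<delta> i j > 0\<close> permits, so that one bound serves a whole row of the array. The
  factor 6 is 3 for the jump plus 3 for its mean.\<close>

lemma Mart_increment_bound:
  assumes n0: "1 \<le> n0" and gnz: "\<forall>k\<le>i. \<forall>l\<le>j. g n0 k l \<noteq> 0"
  shows "\<exists>D\<ge>0. \<forall>m n. n0 \<le> m \<longrightarrow> m < n \<longrightarrow> (AE \<omega> in M. \<bar>Mart n0 i j (Suc m) \<omega> - Mart n0 i j m \<omega>\<bar> \<le> D * real n powr \<delta> i j)"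
proof -
  obtain D where D: "D \<ge> 0" "\<And>k l n. n \<ge> 1 \<Longrightarrow> \<bar>b n0 i j k l n\<bar> \<le> D * real n powr \<delta> i j"
    using b_bound[OF n0 gnz] by blast
  show ?thesis
  proof (intro exI[of _ "6 * D"] conjI allI impI)
    show "0 \<le> 6 * D" using D by simp
    fix m n assume m: "n0 \<le> m" "m < n"
    have m1: "m \<ge> 1" using m n0 by simp
    define E where "E = D * real n powr \<delta> i j"
    have bE: "\<bar>bc n0 i j (Suc m) k l\<bar> \<le> E" for k l
    proof -
      have "\<bar>b n0 i j k l (Suc m)\<bar> \<le> D * real (Suc m) powr \<delta> i j" by (rule D(2)) simp
      also have "\<dots> \<le> E" unfolding E_def using m D delta_pos[of i j] by (intro mult_left_mono powr_mono2) auto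
      finally show ?thesis by (simp add: bc_def)
    qed
    show "AE \<omega> in M. \<bar>Mart n0 i j (Suc m) \<omega> - Mart n0 i j m \<omega>\<bar> \<le> 6 * D * real n powr \<delta> i j"
      using AE_good
    proof eventually_elim
      case (elim \<omega>)
      then have r: "regular m \<omega>" "transition m \<omega>" using m1 by auto
      show ?case
        unfolding Mart_step[OF m(1) n0 gnz r(1)]
        using jump_bound[where f="bc n0 i j (Suc m)", OF m1 r(2) bE] jmean_bound[where f="bc n0 i j (Suc m)", OF m1 r(1) bE] unfolding E_def by linarith
    qed
  qed
qed

text \<open>The weight \<open>n powr - (\<delta> + 1/2)\<close> cancels the growth
  \<open>n powr \<delta>\<close> of the increments and leaves \<open>n powr (-1/2)\<close>.
  Subtracting the value at \<open>n0\<close> lets the sum telescope over the stages governed by the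
  recursion.\<close>

lemma martingale_combination_CLT:
  fixes idx :: "'n::finite \<Rightarrow> nat \<times> nat" and s :: "real^'n"
  assumes n0: "1 \<le> n0" and gnz: "\<And>u. \<forall>k\<le>fst (idx u). \<forall>l\<le>snd (idx u). g n0 k l \<noteq> 0"
  defines "Y \<equiv> \<lambda>n \<omega>. \<Sum>u\<in>UNIV. s $ u * real n powr - (\<delta> (fst (idx u)) (snd (idx u)) + 1/2) *
        (Mart n0 (fst (idx u)) (snd (idx u)) n \<omega> - Mart n0 (fst (idx u)) (snd (idx u)) n0 \<omega>)"
  shows "(\<lambda>n. \<integral>\<omega>. iexp (Y n \<omega>) \<partial>M) \<longlonglongrightarrow> of_real (exp (- (s \<bullet> (Sig n0 idx *v s)) / 2))"
proof -
  define I where "I u = fst (idx u)" for u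
  define J where "J u = snd (idx u)" for u
  define dl where "dl u = \<delta> (I u) (J u)" for u
  define c where "c n u = s $ u * real n powr - (dl u + 1/2)" for n u
  define D where "D u m \<omega> = Mart n0 (I u) (J u) (Suc m) \<omega> - Mart n0 (I u) (J u) m \<omega>" for u m \<omega>
  define jc where "jc u w m \<omega> = jcov (bc n0 (I u) (J u) (Suc m)) (bc n0 (I w) (J w) (Suc m)) m \<omega>" for u w m \<omega>
  \<comment> \<open>Zero before \<open>n0\<close>, where the coefficients are still constant and
    \<open>Mart_step\<close> does not apply.\<close>
  define d where "d n m \<omega> = (if n0 \<le> m then \<Sum>u\<in>UNIV. c n u * D u m \<omega> else 0)" for n m \<omega>
  define v where "v n m \<omega> = (if n0 \<le> m then \<Sum>x\<in>UNIV. c n (fst x) * c n (snd x) * jc (fst x) (snd x) m \<omega> else 0)" for n m \<omega>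
  have g': "\<forall>k\<le>I u. \<forall>l\<le>J u. g n0 k l \<noteq> 0" for u using gnz[of u] by (simp add: I_def J_def)
  have "\<exists>D. \<forall>u. D u \<ge> 0 \<and> (\<forall>m n. n0 \<le> m \<longrightarrow> m < n \<longrightarrow> (AE \<omega> in M. \<bar>Mart n0 (I u) (J u) (Suc m) \<omega> - Mart n0 (I u) (J u) m \<omega>\<bar> \<le> D u * real n powr dl u))"
    unfolding dl_def by (intro choice allI) (use Mart_increment_bound[OF n0 g'] in blast)
  then obtain Bd where Bd: "\<And>u. Bd u \<ge> 0"
    "\<And>u m n. n0 \<le> m \<Longrightarrow> m < n \<Longrightarrow> AE \<omega> in M. \<bar>D u m \<omega>\<bar> \<le> Bd u * real n powr dl u"
    unfolding D_def by blast
  have pairs: "(\<Sum>x\<in>UNIV. f (fst x) (snd x)) = (\<Sum>u\<in>UNIV. \<Sum>w\<in>UNIV. f u w)" for f :: "'n \<Rightarrow> 'n \<Rightarrow> real"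
    using sum.cartesian_product[of f UNIV UNIV] by (simp add: case_prod_unfold)
  have DM: "D u m \<in> borel_measurable M" if "n0 \<le> m" for u m
    using Mart_measurable_M[of m n0 "I u" "J u"] Mart_measurable_M[of "Suc m" n0 "I u" "J u"] that n0
    unfolding D_def[abs_def] by simp
  have iD: "integrable M (D u m)" if "n0 \<le> m" for u m
    by (rule integrable_bounded[OF DM[OF that] Bd(2)[OF that lessI, folded real_norm_def]])
  have iDD: "integrable M (\<lambda>\<omega>. D u m \<omega> * D w m \<omega>)" if m: "n0 \<le> m" for u w m
  proof (rule integrable_bounded)
    show "(\<lambda>\<omega>. D u m \<omega> * D w m \<omega>) \<in> borel_measurable M" using DM[OF m] by simp
    show "AE \<omega> in M. norm (D u m \<omega> * D w m \<omega>) \<le> (Bd u * real (Suc m) powr dl u) * (Bd w * real (Suc m) powr dl w)"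
      using Bd(2)[OF m lessI, of u] Bd(2)[OF m lessI, of w]
      by eventually_elim (simp add: abs_mult mult_mono Bd)
  qed
  have "(\<lambda>n. \<integral>\<omega>. iexp (\<Sum>m<n. d n m \<omega>) \<partial>M) \<longlonglongrightarrow> of_real (exp (- (s \<bullet> (Sig n0 idx *v s)) / 2))"
  proof (rule martingale_difference_array_CLT[where F="history M G" and v=v and c="\<Sum>u\<in>UNIV. \<bar>s $ u\<bar> * Bd u"])
    show "prob_space M" by (rule prob_space_axioms)
    show "subalgebra M (history M G m)" for m by (rule subalgebra_history)
    show "sets (history M G m) \<subseteq> sets (history M G (Suc m))" for m by (rule history_mono) simp
    show "d n m \<in> borel_measurable (history M G (Suc m))" for n m
    proof (cases "n0 \<le> m")
      case True
      have "Mart n0 i j m \<in> borel_measurable (history M G (Suc m))" for i j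
        using Mart_measurable[of m n0 i j] history_mono[of m "Suc m"] True n0
        by (auto simp: measurable_def)
      moreover have "Mart n0 i j (Suc m) \<in> borel_measurable (history M G (Suc m))" for i j
        by (rule Mart_measurable) simp
      ultimately show ?thesis using True by (simp add: d_def[abs_def] D_def[abs_def])
    qed (simp add: d_def[abs_def])
    show "v n m \<in> borel_measurable (history M G m)" for n m
    proof (cases "n0 \<le> m")
      case True
      have "(\<lambda>\<omega>. jcov f h m \<omega>) \<in> borel_measurable (history M G m)" for f h
        unfolding jcov_def jmean_def using True n0
        by (intro borel_measurable_diff borel_measurable_times history_borel[OF _ order_refl]) auto
      then show ?thesis using True by (simp add: v_def[abs_def] jc_def[abs_def])
    qed (simp add: v_def[abs_def])
    show "AE \<omega> in M. \<bar>d n m \<omega>\<bar> \<le> (\<Sum>u\<in>UNIV. \<bar>s $ u\<bar> * Bd u) / sqrt (real n)" if mn: "m < n" for n m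
    proof (cases "n0 \<le> m")
      case True
      have "AE \<omega> in M. \<forall>u. \<bar>D u m \<omega>\<bar> \<le> Bd u * real n powr dl u"
        by (rule AE_all_finite) (rule Bd(2)[OF True mn])
      then show ?thesis
      proof eventually_elim
        case (elim \<omega>)
        have "\<bar>d n m \<omega>\<bar> \<le> (\<Sum>u\<in>UNIV. \<bar>c n u * D u m \<omega>\<bar>)" using True by (simp add: d_def sum_abs)
        also have "\<dots> \<le> (\<Sum>u\<in>UNIV. \<bar>c n u\<bar> * (Bd u * real n powr dl u))"
          using elim by (intro sum_mono) (simp add: abs_mult mult_left_mono)
        also have "\<dots> = (\<Sum>u\<in>UNIV. \<bar>s $ u\<bar> * Bd u * real n powr - (1/2))"
          by (intro sum.cong refl) (simp add: c_def abs_mult powr_add[symmetric] mult.assoc mult.left_commute flip: powr_add)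
        also have "\<dots> = (\<Sum>u\<in>UNIV. \<bar>s $ u\<bar> * Bd u) / sqrt (real n)"
          by (simp add: sum_divide_distrib powr_minus_divide powr_half_sqrt)
        finally show ?case .
      qed
    next
      case False
      then show ?thesis using Bd(1) by (simp add: d_def sum_nonneg)
    qed
    show "AE \<omega> in M. real_cond_exp M (history M G m) (d n m) \<omega> = 0" if mn: "m < n" for n m
    proof -
      interpret F: finite_measure_subalgebra M "history M G m" by (rule subalg_history)
      show ?thesis
      proof (cases "n0 \<le> m")
        case True
        then have m1: "m \<ge> 1" using n0 by simp
        have jm: "jmean f m \<in> borel_measurable M" for f
          unfolding jmean_def[abs_def] by (rule measurable_of_G[OF m1])
        have z: "AE \<omega> in M. real_cond_exp M (history M G m) (D u m) \<omega> = 0" for u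
        proof -
          have "AE \<omega> in M. D u m \<omega> = jump (bc n0 (I u) (J u) (Suc m)) m \<omega> - jmean (bc n0 (I u) (J u) (Suc m)) m \<omega>"
            using AE_good by eventually_elim (use m1 Mart_step[OF True n0 g'] in \<open>auto simp: D_def\<close>)
          then have "AE \<omega> in M. real_cond_exp M (history M G m) (D u m) \<omega> =
             real_cond_exp M (history M G m) (\<lambda>\<omega>. jump (bc n0 (I u) (J u) (Suc m)) m \<omega> - jmean (bc n0 (I u) (J u) (Suc m)) m \<omega>) \<omega>"
            by (rule F.real_cond_exp_cong) (use DM[OF True] jump_measurable[OF m1] jm in auto)
          then show ?thesis using cond_exp_jump_centered[OF m1] by eventually_elim auto
        qed
        have "AE \<omega> in M. real_cond_exp M (history M G m) (\<lambda>\<omega>. \<Sum>u\<in>UNIV. c n u * D u m \<omega>) \<omega>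
           = (\<Sum>u\<in>UNIV. real_cond_exp M (history M G m) (\<lambda>\<omega>. c n u * D u m \<omega>) \<omega>)"
          by (rule F.real_cond_exp_sum) (use iD[OF True] in simp)
        moreover have "AE \<omega> in M. \<forall>u. real_cond_exp M (history M G m) (\<lambda>\<omega>. c n u * D u m \<omega>) \<omega> = 0"
        proof -
          have "AE \<omega> in M. real_cond_exp M (history M G m) (\<lambda>\<omega>. c n u * D u m \<omega>) \<omega> = 0" for u
            using F.real_cond_exp_cmult[OF iD[OF True], of "c n u" u] z[of u] by eventually_elim simp
          then show ?thesis by (rule AE_all_finite)
        qed
        moreover have "d n m = (\<lambda>\<omega>. \<Sum>u\<in>UNIV. c n u * D u m \<omega>)" using True by (simp add: d_def[abs_def])
        ultimately show ?thesis by auto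
      next
        case False
        have "AE \<omega> in M. real_cond_exp M (history M G m) (\<lambda>\<omega>. 0) \<omega> = 0"
          by (rule F.real_cond_exp_F_meas) auto
        then show ?thesis using False by (simp add: d_def[abs_def])
      qed
    qed
    show "AE \<omega> in M. real_cond_exp M (history M G m) (\<lambda>\<omega>. (d n m \<omega>)^2) \<omega> = v n m \<omega>" if mn: "m < n" for n m
    proof -
      interpret F: finite_measure_subalgebra M "history M G m" by (rule subalg_history)
      show ?thesis
      proof (cases "n0 \<le> m")
        case True
        define E where "E x \<omega> = (c n (fst x) * c n (snd x)) * (D (fst x) m \<omega> * D (snd x) m \<omega>)" for x :: "'n \<times> 'n" and \<omega>
        have sq: "(\<lambda>\<omega>. (d n m \<omega>)^2) = (\<lambda>\<omega>. \<Sum>x\<in>UNIV. E x \<omega>)"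
          unfolding E_def pairs[of "\<lambda>u w. c n u * c n w * (D u m \<omega> * D w m \<omega>)" for \<omega>]
          using True by (simp add: d_def power2_eq_square sum_product mult_ac)
        have "AE \<omega> in M. real_cond_exp M (history M G m) (\<lambda>\<omega>. \<Sum>x\<in>UNIV. E x \<omega>) \<omega>
           = (\<Sum>x\<in>UNIV. real_cond_exp M (history M G m) (E x) \<omega>)"
          by (rule F.real_cond_exp_sum) (use iDD[OF True] in \<open>simp add: E_def[abs_def]\<close>)
        moreover have "AE \<omega> in M. \<forall>x. real_cond_exp M (history M G m) (E x) \<omega> = c n (fst x) * c n (snd x) * jc (fst x) (snd x) m \<omega>"
        proof -
          have "AE \<omega> in M. real_cond_exp M (history M G m) (E x) \<omega> = c n (fst x) * c n (snd x) * jc (fst x) (snd x) m \<omega>" for x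
            using F.real_cond_exp_cmult[OF iDD[OF True], of "c n (fst x) * c n (snd x)" "fst x" "snd x"]
              cond_exp_Mart[OF True n0 g' g', of "fst x" "snd x"]
            unfolding E_def[abs_def] jc_def D_def by eventually_elim simp
          then show ?thesis by (rule AE_all_finite)
        qed
        ultimately show ?thesis
          unfolding sq by eventually_elim (use True in \<open>simp add: v_def del: split_paired_All\<close>)
      next
        case False
        have "AE \<omega> in M. real_cond_exp M (history M G m) (\<lambda>\<omega>. 0) \<omega> = 0"
          by (rule F.real_cond_exp_F_meas) auto
        then show ?thesis using False by (simp add: d_def[abs_def] v_def)
      qed
    qed
    show "AE \<omega> in M. (\<lambda>n. \<Sum>m<n. v n m \<omega>) \<longlonglongrightarrow> s \<bullet> (Sig n0 idx *v s)"
      using AE_good AE_N_limit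
    proof eventually_elim
      case (elim \<omega>)
      \<comment> \<open>\<open>weighted_cov_limit\<close> indexes an increment by its end point,
        hence the start at \<open>Suc n0\<close> and the argument \<open>m - 1\<close>.\<close>
      have part: "(\<lambda>n. real n powr - (dl u + dl w + 1) * (\<Sum>m=Suc n0..n. jc u w (m - 1) \<omega>)) \<longlonglongrightarrow> \<sigma>2 n0 (I u) (J u) (I w) (J w)" for u w
        unfolding dl_def by (rule weighted_cov_limit[OF _ _ n0 g' g']) (use elim in \<open>auto simp: jc_def\<close>)
      have "(\<lambda>n. \<Sum>x\<in>UNIV. s $ fst x * s $ snd x * (real n powr - (dl (fst x) + dl (snd x) + 1) * (\<Sum>m=Suc n0..n. jc (fst x) (snd x) (m - 1) \<omega>)))
        \<longlonglongrightarrow> (\<Sum>x\<in>UNIV. s $ fst x * s $ snd x * \<sigma>2 n0 (I (fst x)) (J (fst x)) (I (snd x)) (J (snd x)))"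
        by (intro tendsto_intros part)
      moreover have "(\<Sum>x\<in>UNIV. s $ fst x * s $ snd x * (real n powr - (dl (fst x) + dl (snd x) + 1) * (\<Sum>m=Suc n0..n. jc (fst x) (snd x) (m - 1) \<omega>)))
        = (\<Sum>m<n. v n m \<omega>)" for n
      proof -
        have "(\<Sum>m<n. v n m \<omega>) = (\<Sum>m=n0..<n. \<Sum>x\<in>UNIV. c n (fst x) * c n (snd x) * jc (fst x) (snd x) m \<omega>)"
          unfolding v_def by (subst sum.inter_filter[symmetric]) (auto intro!: sum.cong)
        also have "\<dots> = (\<Sum>x\<in>UNIV. \<Sum>m=n0..<n. c n (fst x) * c n (snd x) * jc (fst x) (snd x) m \<omega>)"
          by (rule sum.swap)
        also have "\<dots> = (\<Sum>x\<in>UNIV. s $ fst x * s $ snd x * (real n powr - (dl (fst x) + dl (snd x) + 1) * (\<Sum>m=Suc n0..n. jc (fst x) (snd x) (m - 1) \<omega>)))"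
        proof (rule sum.cong[OF refl])
          fix x :: "'n \<times> 'n"
          have "(\<Sum>m=Suc n0..n. jc (fst x) (snd x) (m - 1) \<omega>) = (\<Sum>m=n0..<n. jc (fst x) (snd x) m \<omega>)"
            unfolding atLeastLessThanSuc_atLeastAtMost[symmetric] by (subst sum.shift_bounds_Suc_ivl) simp
          moreover have "c n (fst x) * c n (snd x) = s $ fst x * s $ snd x * real n powr - (dl (fst x) + dl (snd x) + 1)"
          proof -
            have "real n powr - (dl (fst x) + 1/2) * real n powr - (dl (snd x) + 1/2) = real n powr - (dl (fst x) + dl (snd x) + 1)"
              unfolding powr_add[symmetric] by (rule arg_cong[where f="(powr) (real n)"]) simp
            then show ?thesis unfolding c_def by (simp only: mult_ac)
          qed
          ultimately show "(\<Sum>m=n0..<n. c n (fst x) * c n (snd x) * jc (fst x) (snd x) m \<omega>)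
             = s $ fst x * s $ snd x * (real n powr - (dl (fst x) + dl (snd x) + 1) * (\<Sum>m=Suc n0..n. jc (fst x) (snd x) (m - 1) \<omega>))"
            by (simp only: sum_distrib_left[symmetric] mult.assoc)
        qed
        finally show ?thesis ..
      qed
      moreover have "(\<Sum>x\<in>UNIV. s $ fst x * s $ snd x * \<sigma>2 n0 (I (fst x)) (J (fst x)) (I (snd x)) (J (snd x))) = s \<bullet> (Sig n0 idx *v s)"
        unfolding pairs[of "\<lambda>u w. s $ u * s $ w * \<sigma>2 n0 (I u) (J u) (I w) (J w)"]
        by (simp add: inner_vec_def matrix_vector_mult_def Sig_def I_def J_def case_prod_unfold sum_distrib_left mult_ac)
      ultimately show ?case by simp
    qed
  qed
  moreover have "\<forall>\<^sub>F n in sequentially. (\<integral>\<omega>. iexp (\<Sum>m<n. d n m \<omega>) \<partial>M) = (\<integral>\<omega>. iexp (Y n \<omega>) \<partial>M)"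
    using eventually_ge_at_top[of n0]
  proof eventually_elim
    case (elim n)
    have "(\<Sum>m<n. d n m \<omega>) = Y n \<omega>" for \<omega>
    proof -
      have "(\<Sum>m<n. d n m \<omega>) = (\<Sum>m=n0..<n. \<Sum>u\<in>UNIV. c n u * D u m \<omega>)"
        unfolding d_def by (subst sum.inter_filter[symmetric]) (auto intro!: sum.cong)
      also have "\<dots> = (\<Sum>u\<in>UNIV. c n u * (\<Sum>m=n0..<n. D u m \<omega>))"
        by (subst sum.swap) (simp add: sum_distrib_left)
      also have "\<dots> = Y n \<omega>"
        unfolding D_def I_def J_def
          sum_Suc_diff'[OF elim, of "\<lambda>m. Mart n0 (fst (idx u)) (snd (idx u)) m \<omega>" for u]
        by (simp add: Y_def c_def dl_def I_def J_def)
      finally show ?thesis .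
    qed
    then show ?case by simp
  qed
  ultimately show ?thesis by (rule Lim_transform_eventually)
qed

subsection \<open>The limit law of the counts\<close>

text \<open>\<open>g n0 i j\<close> is a common factor of its row of \<open>K\<close>, and an
  invertible matrix has no zero row.\<close>

lemma K_invertible_g:
  fixes idx :: "'n::finite \<Rightarrow> nat \<times> nat"
  assumes inv: "invertible (K n0 idx)" and idx: "idx u = (i, j)"
  shows "g n0 i j \<noteq> 0"
proof
  assume g0: "g n0 i j = 0"
  obtain Q where Q: "K n0 idx ** Q = mat 1" using inv unfolding invertible_def by blast
  have "(K n0 idx ** Q) $ u $ u = 0"
    using g0 idx by (simp add: matrix_matrix_mult_def K_def)
  then show False unfolding Q by (simp add: mat_def)
qed

lemma Sig_symmetric: "transpose (Sig n0 idx) = Sig n0 idx"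
proof -
  have "B i j s t = B s t i j" for i j s t
    unfolding B_def by (simp add: mult_ac)
  then have "\<sigma>2 n0 i j s t = \<sigma>2 n0 s t i j" for i j s t
    by (simp add: \<sigma>2_def \<tau>_def C_def A_def mult_ac add_ac)
  then show ?thesis by (auto simp: transpose_def Sig_def vec_eq_iff case_prod_unfold)
qed

lemma integrable_abs_dev: "n \<ge> 1 \<Longrightarrow> integrable M (\<lambda>\<omega>. \<bar>dev n i j \<omega>\<bar> / sqrt (real n))"
  using integrable_N[of n i j] by (simp add: dev_def)

text \<open>First moments suffice for tightness and for discarding coefficient errors;
  \<open>\<bar>x\<bar> <= 1 + x^2\<close> reduces them to second moments.\<close>

lemma abs_dev_moment: "\<exists>D\<ge>0. \<forall>n\<ge>1. expectation (\<lambda>\<omega>. \<bar>dev n i j \<omega>\<bar> / sqrt (real n)) \<le> D"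
proof -
  obtain D :: real where D: "\<And>n. n \<ge> 1 \<Longrightarrow> expectation (\<lambda>\<omega>. (dev n i j \<omega>)^2) \<le> D * real n"
    using second_moment_linear[of i j] by auto
  have D0: "D \<ge> 0" using order.trans[OF _ D[of 1]] by simp
  have "expectation (\<lambda>\<omega>. \<bar>dev n i j \<omega>\<bar> / sqrt (real n)) \<le> 1 + D" if n: "n \<ge> 1" for n
  proof -
    have "expectation (\<lambda>\<omega>. \<bar>dev n i j \<omega>\<bar> / sqrt (real n)) \<le> expectation (\<lambda>\<omega>. 1 + (dev n i j \<omega>)^2 / n)"
    proof (rule integral_mono[OF integrable_abs_dev[OF n]])
      show "integrable M (\<lambda>\<omega>. 1 + (dev n i j \<omega>)^2 / n)" using integrable_dev_square[OF n] by simp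
      fix \<omega>
      have q: "\<bar>x\<bar> \<le> 1 + x^2" for x :: real
      proof -
        have "0 \<le> (\<bar>x\<bar> - 1)^2" by simp
        then have "2 * \<bar>x\<bar> \<le> 1 + x^2" by (simp add: power2_diff)
        then show ?thesis by simp
      qed
      show "\<bar>dev n i j \<omega>\<bar> / sqrt (real n) \<le> 1 + (dev n i j \<omega>)^2 / n"
        using q[of "dev n i j \<omega> / sqrt (real n)"] by (simp add: abs_divide power_divide)
    qed
    also have "\<dots> = 1 + expectation (\<lambda>\<omega>. (dev n i j \<omega>)^2) / n"
      using integrable_dev_square[OF n] by (simp add: prob_space)
    also have "\<dots> \<le> 1 + D" using D[OF n] n by (simp add: divide_le_eq)
    finally show ?thesis .
  qed
  then show ?thesis using D0 by (intro exI[of _ "1 + D"]) auto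
qed

text \<open>At this one coordinate the entries of \<open>K\<close> and the limits of
  \<open>b\<close> may disagree, without effect on the martingales.\<close>

lemma dev_00: "n \<ge> 1 \<Longrightarrow> regular n \<omega> \<Longrightarrow> dev n 0 0 \<omega> = 0"
proof -
  assume n: "n \<ge> 1" and r: "regular n \<omega>"
  have "expectation (N n 0 0) = expectation (\<lambda>\<omega>. 0)"
    by (rule integral_cong_AE) (use AE_regular[OF n] N_00 integrable_N[OF n] in auto)
  then show "dev n 0 0 \<omega> = 0" by (simp add: dev_def nu_def N_00[OF r])
qed

lemma Mart_bounded: "n \<ge> 1 \<Longrightarrow> \<exists>D\<ge>0. \<forall>\<omega>\<in>space M. \<bar>Mart n0 i j n \<omega>\<bar> \<le> D"
  unfolding Mart_deg_sum
  using bounded_of_G[of n _ "\<lambda>x. deg_sum (bc n0 i j n) n x - expectation (\<lambda>\<omega>. deg_sum (bc n0 i j n) n (G n \<omega>))"]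
  by (intro exI[of _ "\<Sum>x\<in>graphs n. \<bar>deg_sum (bc n0 i j n) n x - expectation (\<lambda>\<omega>. deg_sum (bc n0 i j n) n (G n \<omega>))\<bar>"])
    (auto intro: sum_nonneg)

lemma normalized_counts_measurable [measurable]:
  fixes idx :: "'n::finite \<Rightarrow> nat \<times> nat"
  shows "normalized_counts idx n \<in> borel_measurable M"
proof (cases "n \<ge> 1")
  case True
  then show ?thesis
    unfolding normalized_counts_def[abs_def] N_deg_sum by (rule measurable_of_G)
next
  case False
  \<comment> \<open>At \<open>n = 0\<close> the factor \<open>sqrt (real n)\<close> is 0, whatever
    \<open>G 0\<close> is.\<close>
  then have "normalized_counts idx n = (\<lambda>\<omega>. 0)"
    by (simp add: normalized_counts_def[abs_def] case_prod_unfold vec_eq_iff fun_eq_iff)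
  then show ?thesis by simp
qed

section \<open>The limit law on a fixed index rectangle\<close>

context
  fixes idx :: "'n::finite \<Rightarrow> nat \<times> nat" and Imax Omax n0 :: nat
  assumes n0: "1 \<le> n0" and idx: "bij_betw idx UNIV ({0..Imax} \<times> {0..Omax})"
    and inv: "invertible (K n0 idx)"
begin

lemma idx_range: "fst (idx u) \<le> Imax" "snd (idx u) \<le> Omax"
proof -
  have "idx u \<in> {0..Imax} \<times> {0..Omax}" using idx by (auto simp: bij_betw_def)
  then show "fst (idx u) \<le> Imax" "snd (idx u) \<le> Omax" by (auto simp: mem_Times_iff)
qed

text \<open>The enumeration covers the rectangle, so every smaller degree \<open>(k, l)\<close>
  indexes a row of \<open>K\<close> as well.\<close>

lemma g_nonzero: "\<forall>k\<le>fst (idx u). \<forall>l\<le>snd (idx u). g n0 k l \<noteq> 0"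
proof (intro allI impI)
  fix k l assume "k \<le> fst (idx u)" "l \<le> snd (idx u)"
  then have "(k, l) \<in> {0..Imax} \<times> {0..Omax}" using idx_range[of u] by auto
  then obtain w where "idx w = (k, l)" using idx by (metis bij_betw_iff_bijections)
  then show "g n0 k l \<noteq> 0" by (rule K_invertible_g[OF inv])
qed

lemma Mart_idx_sum:
  "Mart n0 (fst (idx u)) (snd (idx u)) n \<omega> =
    (\<Sum>v\<in>UNIV. b n0 (fst (idx u)) (snd (idx u)) (fst (idx v)) (snd (idx v)) n * dev n (fst (idx v)) (snd (idx v)) \<omega>)"
proof -
  define i where "i = fst (idx u)"
  define j where "j = snd (idx u)"
  have ij: "i \<le> Imax" "j \<le> Omax" using idx_range by (auto simp: i_def j_def)
  have "(\<Sum>v\<in>UNIV. b n0 i j (fst (idx v)) (snd (idx v)) n * dev n (fst (idx v)) (snd (idx v)) \<omega>)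
    = (\<Sum>x\<in>{0..Imax} \<times> {0..Omax}. b n0 i j (fst x) (snd x) n * dev n (fst x) (snd x) \<omega>)"
    by (rule sum.reindex_bij_betw[OF idx])
  also have "\<dots> = (\<Sum>x\<in>{0..i} \<times> {0..j}. b n0 i j (fst x) (snd x) n * dev n (fst x) (snd x) \<omega>)"
  proof (rule sum.mono_neutral_right)
    show "\<forall>x\<in>{0..Imax} \<times> {0..Omax} - {0..i} \<times> {0..j}. b n0 i j (fst x) (snd x) n * dev n (fst x) (snd x) \<omega> = 0"
    proof
      fix x assume "x \<in> {0..Imax} \<times> {0..Omax} - {0..i} \<times> {0..j}"
      then have "i < fst x \<or> j < snd x" by (auto simp: mem_Times_iff)
      then show "b n0 i j (fst x) (snd x) n * dev n (fst x) (snd x) \<omega> = 0" by (simp add: b_outside)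
    qed
  qed (use ij in auto)
  also have "\<dots> = (\<Sum>k=0..i. \<Sum>l=0..j. b n0 i j k l n * dev n k l \<omega>)"
    by (simp add: sum.cartesian_product case_prod_unfold)
  also have "\<dots> = Mart n0 i j n \<omega>" unfolding Mart_def dev_def by (rule sum.swap)
  finally show ?thesis by (simp add: i_def j_def)
qed

text \<open>The deterministic error of centering at \<open>n * p\<close> rather than at the
  mean.\<close>

definition ep :: "nat \<Rightarrow> 'n \<Rightarrow> real" where
  "ep n v = (nu n (fst (idx v)) (snd (idx v)) - n * p (fst (idx v)) (snd (idx v))) / sqrt (real n)"

lemma ep_limit: "(\<lambda>n. ep n v) \<longlonglongrightarrow> 0"
  using nu_minus_pl_limit[of "1/2"] by (simp add: ep_def p_eq_pl powr_half_sqrt)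

lemma normalized_counts_dev:
  assumes "n \<ge> 1"
  shows "normalized_counts idx n \<omega> $ v = dev n (fst (idx v)) (snd (idx v)) \<omega> / sqrt (real n) + ep n v"
proof -
  have n: "real n = sqrt (real n) * sqrt (real n)" "sqrt (real n) > 0" using assms by auto
  have "sqrt (real n) * (x / real n - y) = (x - real n * y) / sqrt (real n)" for x y
    by (subst (2 3) n(1)) (use n(2) in \<open>simp add: field_simps\<close>)
  then show ?thesis
    by (simp add: normalized_counts_def case_prod_unfold dev_def ep_def diff_divide_distrib)
qed

text \<open>\<open>K\<close> applied to the counts differs from the rescaled martingales by
  coefficients not yet at their limit, by \<open>ep\<close>, and by the value at \<open>n0\<close>.
  A majorant of the difference vanishes in the mean, and \<open>iexp\<close> is 1-Lipschitz.\<close>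

lemma char_limit:
  fixes s :: "real^'n"
  shows "(\<lambda>n. \<integral>\<omega>. iexp (s \<bullet> (K n0 idx *v normalized_counts idx n \<omega>)) \<partial>M) \<longlonglongrightarrow> of_real (exp (- (s \<bullet> (Sig n0 idx *v s)) / 2))"
proof -
  define I where "I u = fst (idx u)" for u
  define J where "J u = snd (idx u)" for u
  define dl where "dl u = \<delta> (I u) (J u)" for u
  define h where "h n u = real n powr - (dl u + 1/2)" for n u
  define k where "k u v = K n0 idx $ u $ v" for u v
  define q where "q n u v = k u v - b n0 (I u) (J u) (I v) (J v) n / real n powr dl u" for n u v
  define Y where "Y n \<omega> = (\<Sum>u\<in>UNIV. s $ u * h n u *
        (Mart n0 (I u) (J u) n \<omega> - Mart n0 (I u) (J u) n0 \<omega>))" for n \<omega>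
  define Z where "Z n \<omega> = s \<bullet> (K n0 idx *v normalized_counts idx n \<omega>)" for n \<omega>
  \<comment> \<open>At \<open>(0, 0)\<close> the entry of \<open>K\<close> follows the convention
    and \<open>q\<close> need not tend to 0, but the deviation there is 0 almost surely.\<close>
  define kk where "kk n u v = (if idx v = (0, 0) then 0 else \<bar>q n u v\<bar>)" for n u v
  have Ylim: "(\<lambda>n. \<integral>\<omega>. iexp (Y n \<omega>) \<partial>M) \<longlonglongrightarrow> of_real (exp (- (s \<bullet> (Sig n0 idx *v s)) / 2))"
    unfolding Y_def h_def dl_def I_def J_def by (rule martingale_combination_CLT[OF n0 g_nonzero])
  have "\<exists>Dv. \<forall>v. Dv v \<ge> 0 \<and> (\<forall>n\<ge>1. expectation (\<lambda>\<omega>. \<bar>dev n (I v) (J v) \<omega>\<bar> / sqrt (real n)) \<le> Dv v)"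
    by (intro choice allI) (use abs_dev_moment in blast)
  then obtain Dv where Dv: "\<And>v. Dv v \<ge> 0" "\<And>v n. n \<ge> 1 \<Longrightarrow> expectation (\<lambda>\<omega>. \<bar>dev n (I v) (J v) \<omega>\<bar> / sqrt (real n)) \<le> Dv v"
    by blast
  have "\<exists>Cu. \<forall>u. Cu u \<ge> 0 \<and> (\<forall>\<omega>\<in>space M. \<bar>Mart n0 (I u) (J u) n0 \<omega>\<bar> \<le> Cu u)"
    by (intro choice allI) (use Mart_bounded[OF n0] in blast)
  then obtain Cu where Cu: "\<And>u. Cu u \<ge> 0" "\<And>u \<omega>. \<omega> \<in> space M \<Longrightarrow> \<bar>Mart n0 (I u) (J u) n0 \<omega>\<bar> \<le> Cu u"
    by blast
  \<comment> \<open>Majorant of the difference on almost every path; \<open>R'\<close> bounds its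
    mean, with \<open>Dv\<close> in place of the first moments.\<close>
  define R where "R n \<omega> = (\<Sum>u\<in>UNIV. \<bar>s $ u\<bar> * ((\<Sum>v\<in>UNIV. kk n u v * (\<bar>dev n (I v) (J v) \<omega>\<bar> / sqrt (real n)))
     + (\<Sum>v\<in>UNIV. \<bar>k u v\<bar> * \<bar>ep n v\<bar>) + Cu u * h n u))" for n \<omega>
  define R' where "R' n = (\<Sum>u\<in>UNIV. \<bar>s $ u\<bar> * ((\<Sum>v\<in>UNIV. kk n u v * Dv v)
     + (\<Sum>v\<in>UNIV. \<bar>k u v\<bar> * \<bar>ep n v\<bar>) + Cu u * h n u))" for n
  have kk0: "(\<lambda>n. kk n u v) \<longlonglongrightarrow> 0" for u v
  proof (cases "idx v = (0, 0)")
    case False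
    then have "(I v, J v) \<noteq> (0, 0)" by (simp add: I_def J_def prod_eq_iff)
    have "\<forall>k\<le>I u. \<forall>l\<le>J u. g n0 k l \<noteq> 0" unfolding I_def J_def by (rule g_nonzero)
    from b_limit[OF n0 this \<open>(I v, J v) \<noteq> (0, 0)\<close>]
    have "(\<lambda>n. b n0 (I u) (J u) (I v) (J v) n / real n powr dl u) \<longlonglongrightarrow> k u v"
      by (simp add: dl_def k_def K_def I_def J_def case_prod_unfold)
    then have "(\<lambda>n. \<bar>q n u v\<bar>) \<longlonglongrightarrow> \<bar>k u v - k u v\<bar>"
      unfolding q_def by (intro tendsto_intros)
    then show ?thesis using False by (simp add: kk_def)
  qed (simp add: kk_def)
  have kkp: "kk n u v \<ge> 0" for n u v by (simp add: kk_def)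
  \<comment> \<open>This is \<open>- (dl u + 1/2) < 0\<close> cleared of fractions, the condition
    under which \<open>h\<close> tends to 0.\<close>
  have dlp: "- 1 < dl u * 2" for u
    unfolding dl_def using delta_pos[of "I u" "J u"] by linarith
  have "R' \<longlonglongrightarrow> (\<Sum>u\<in>UNIV. \<bar>s $ u\<bar> * ((\<Sum>v\<in>UNIV. 0 * Dv v) + (\<Sum>v\<in>UNIV. \<bar>k u v\<bar> * \<bar>0\<bar>) + Cu u * 0))"
    unfolding R'_def[abs_def] h_def
    by (intro tendsto_intros kk0 ep_limit tendsto_neg_powr filterlim_real_sequentially) (use dlp in auto)
  then have R'0: "R' \<longlonglongrightarrow> 0" by simp
  have diff: "AE \<omega> in M. \<bar>Z n \<omega> - Y n \<omega>\<bar> \<le> R n \<omega>" if n: "n \<ge> 1" for n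
    using AE_regular[OF n] AE_space
  proof eventually_elim
    case (elim \<omega>)
    let ?d = "\<lambda>v. dev n (I v) (J v) \<omega>"
    let ?T = "\<lambda>u. (\<Sum>v\<in>UNIV. q n u v * (?d v / sqrt (real n)))
      + (\<Sum>v\<in>UNIV. k u v * ep n v) + h n u * Mart n0 (I u) (J u) n0 \<omega>"
    have sp: "h n u = 1 / (real n powr dl u * sqrt (real n))" for u
      by (simp add: h_def powr_minus_divide powr_add powr_half_sqrt del: minus_add_distrib)
    have "Z n \<omega> - Y n \<omega> = (\<Sum>u\<in>UNIV. s $ u * ?T u)"
    proof -
      have "(K n0 idx *v normalized_counts idx n \<omega>) $ u - h n u * (Mart n0 (I u) (J u) n \<omega> - Mart n0 (I u) (J u) n0 \<omega>)
        = ?T u" for u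
      proof -
        have 1: "(K n0 idx *v normalized_counts idx n \<omega>) $ u = (\<Sum>v\<in>UNIV. k u v * (?d v / sqrt (real n))) + (\<Sum>v\<in>UNIV. k u v * ep n v)"
          by (simp add: k_def matrix_vector_mult_def normalized_counts_dev[OF n] distrib_left sum.distrib I_def J_def)
        have 2: "h n u * Mart n0 (I u) (J u) n \<omega> = (\<Sum>v\<in>UNIV. b n0 (I u) (J u) (I v) (J v) n / real n powr dl u * (?d v / sqrt (real n)))"
          unfolding sp I_def J_def Mart_idx_sum by (simp add: sum_divide_distrib)
        show ?thesis unfolding right_diff_distrib 1 2 q_def left_diff_distrib sum_subtractf by linarith
      qed
      then show ?thesis
        unfolding Z_def Y_def inner_vec_def by (simp add: mult.assoc flip: right_diff_distrib sum_subtractf)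
    qed
    also have "\<bar>\<dots>\<bar> \<le> R n \<omega>"
      unfolding R_def
    proof (rule order.trans[OF sum_abs sum_mono])
      fix u :: 'n
      have "\<bar>(\<Sum>v\<in>UNIV. q n u v * (?d v / sqrt (real n)))\<bar>
         \<le> (\<Sum>v\<in>UNIV. kk n u v * (\<bar>?d v\<bar> / sqrt (real n)))"
      proof (rule order.trans[OF sum_abs sum_mono])
        fix v :: 'n
        show "\<bar>q n u v * (?d v / sqrt (real n))\<bar>
          \<le> kk n u v * (\<bar>?d v\<bar> / sqrt (real n))"
          using dev_00[OF n elim(1)] by (auto simp: kk_def abs_mult abs_divide I_def J_def)
      qed
      moreover have "\<bar>(\<Sum>v\<in>UNIV. k u v * ep n v)\<bar> \<le> (\<Sum>v\<in>UNIV. \<bar>k u v\<bar> * \<bar>ep n v\<bar>)"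
        by (rule order.trans[OF sum_abs]) (simp add: abs_mult)
      moreover have "\<bar>h n u * Mart n0 (I u) (J u) n0 \<omega>\<bar> \<le> Cu u * h n u"
        using mult_left_mono[OF Cu(2)[OF elim(2), of u], of "h n u"]
          by (simp add: h_def abs_mult mult.commute)
      ultimately have "\<bar>?T u\<bar>
       \<le> (\<Sum>v\<in>UNIV. kk n u v * (\<bar>?d v\<bar> / sqrt (real n))) + (\<Sum>v\<in>UNIV. \<bar>k u v\<bar> * \<bar>ep n v\<bar>) + Cu u * h n u"
        by linarith
      then show "\<bar>s $ u * ?T u\<bar>
      \<le> \<bar>s $ u\<bar> * ((\<Sum>v\<in>UNIV. kk n u v * (\<bar>?d v\<bar> / sqrt (real n)))
         + (\<Sum>v\<in>UNIV. \<bar>k u v\<bar> * \<bar>ep n v\<bar>) + Cu u * h n u)"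
        unfolding abs_mult by (rule mult_left_mono) simp
    qed
    finally show ?case .
  qed
  have Zm[measurable]: "Z n \<in> borel_measurable M" for n
    unfolding Z_def[abs_def]
  proof (rule borel_measurable_inner)
    have "(\<lambda>x. K n0 idx *v x) \<in> borel_measurable borel"
      by (intro borel_measurable_continuous_onI linear_continuous_on matrix_vector_mul_bounded_linear)
    then show "(\<lambda>\<omega>. K n0 idx *v normalized_counts idx n \<omega>) \<in> borel_measurable M"
      by (rule measurable_compose[OF normalized_counts_measurable])
  qed simp
  have Ym: "Y n \<in> borel_measurable M" if "n \<ge> 1" for n
    unfolding Y_def[abs_def] using Mart_measurable_M[OF that] Mart_measurable_M[OF n0] by simp
  have close: "cmod ((\<integral>\<omega>. iexp (Z n \<omega>) \<partial>M) - (\<integral>\<omega>. iexp (Y n \<omega>) \<partial>M)) \<le> R' n" if n: "n \<ge> 1" for n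
  proof -
    have iR: "integrable M (R n)"
      unfolding R_def[abs_def]
      by (intro Bochner_Integration.integrable_sum integrable_mult_right Bochner_Integration.integrable_add integrable_abs_dev n integrable_const)
    have iZ: "integrable M (\<lambda>\<omega>. iexp (Z n \<omega>))" by (rule iexp_integrable[OF finite_measure_axioms Zm])
    have iY: "integrable M (\<lambda>\<omega>. iexp (Y n \<omega>))" by (rule iexp_integrable[OF finite_measure_axioms Ym[OF n]])
    have "(\<integral>\<omega>. iexp (Z n \<omega>) \<partial>M) - (\<integral>\<omega>. iexp (Y n \<omega>) \<partial>M) = (\<integral>\<omega>. iexp (Z n \<omega>) - iexp (Y n \<omega>) \<partial>M)"
      using iZ iY by simp
    also have "cmod \<dots> \<le> (\<integral>\<omega>. cmod (iexp (Z n \<omega>) - iexp (Y n \<omega>)) \<partial>M)" by (rule integral_norm_bound)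
    also have "\<dots> \<le> expectation (R n)"
    proof (rule integral_mono_AE)
      show "integrable M (\<lambda>\<omega>. cmod (iexp (Z n \<omega>) - iexp (Y n \<omega>)))" using iZ iY by auto
      show "AE \<omega> in M. cmod (iexp (Z n \<omega>) - iexp (Y n \<omega>)) \<le> R n \<omega>"
        using diff[OF n] by eventually_elim (rule order.trans[OF cmod_iexp_diff_le])
    qed (rule iR)
    also have "\<dots> = (\<Sum>u\<in>UNIV. \<bar>s $ u\<bar> * ((\<Sum>v\<in>UNIV. kk n u v * expectation (\<lambda>\<omega>. \<bar>dev n (I v) (J v) \<omega>\<bar> / sqrt (real n)))
     + (\<Sum>v\<in>UNIV. \<bar>k u v\<bar> * \<bar>ep n v\<bar>) + Cu u * h n u))"
    proof -
      define X where "X v \<omega> = \<bar>dev n (I v) (J v) \<omega>\<bar> / sqrt (real n)" for v \<omega>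
      have iX: "integrable M (X v)" for v unfolding X_def[abs_def] by (rule integrable_abs_dev[OF n])
      show ?thesis
        unfolding R_def[abs_def] X_def[symmetric] using iX by (simp add: prob_space)
    qed
    also have "\<dots> \<le> R' n"
      unfolding R'_def by (intro sum_mono mult_left_mono add_mono order_refl Dv n kkp) auto
    finally show ?thesis .
  qed
  have "(\<lambda>n. (\<integral>\<omega>. iexp (Z n \<omega>) \<partial>M) - (\<integral>\<omega>. iexp (Y n \<omega>) \<partial>M)) \<longlonglongrightarrow> 0"
  proof (rule Lim_null_comparison[OF _ R'0])
    show "\<forall>\<^sub>F n in sequentially. cmod ((\<integral>\<omega>. iexp (Z n \<omega>) \<partial>M) - (\<integral>\<omega>. iexp (Y n \<omega>) \<partial>M)) \<le> R' n"
      using eventually_ge_at_top[of 1] by eventually_elim (rule close)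
  qed
  from tendsto_add[OF this Ylim] show ?thesis unfolding Z_def by simp
qed

text \<open>Markov's inequality for a bound on the 1-norm, whose mean is controlled by the first
  absolute moments.\<close>

lemma tight_counts:
  assumes eps: "eps > 0"
  shows "\<exists>R. \<forall>\<^sub>F n in sequentially. measure M {\<omega> \<in> space M. R < norm (normalized_counts idx n \<omega>)} \<le> eps"
proof -
  have "\<exists>Dv. \<forall>v. Dv v \<ge> 0 \<and> (\<forall>n\<ge>1. expectation (\<lambda>\<omega>. \<bar>dev n (fst (idx v)) (snd (idx v)) \<omega>\<bar> / sqrt (real n)) \<le> Dv v)"
    by (intro choice allI) (use abs_dev_moment in blast)
  then obtain Dv where Dv: "\<And>v. Dv v \<ge> 0" "\<And>v n. n \<ge> 1 \<Longrightarrow> expectation (\<lambda>\<omega>. \<bar>dev n (fst (idx v)) (snd (idx v)) \<omega>\<bar> / sqrt (real n)) \<le> Dv v"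
    by blast
  define D where "D = (\<Sum>v\<in>UNIV. Dv v + 1)"
  define R where "R = (D + 1) / eps"
  have D: "D \<ge> 0" unfolding D_def using Dv by (intro sum_nonneg) (simp add: add_nonneg_nonneg)
  then have R: "R > 0" unfolding R_def using eps by simp
  have "\<forall>\<^sub>F n in sequentially. \<bar>ep n v\<bar> \<le> 1" for v
  proof -
    have "\<forall>\<^sub>F n in sequentially. \<bar>ep n v\<bar> < 1"
      using order_tendstoD(2)[OF tendsto_rabs[OF ep_limit[of v]], of 1] by simp
    then show ?thesis by (auto elim: eventually_mono)
  qed
  then have "\<forall>\<^sub>F n in sequentially. \<forall>v. \<bar>ep n v\<bar> \<le> 1" by (intro eventually_all_finite)
  then have "\<forall>\<^sub>F n in sequentially. measure M {\<omega> \<in> space M. R < norm (normalized_counts idx n \<omega>)} \<le> eps"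
    using eventually_ge_at_top[of 1]
  proof eventually_elim
    case (elim n)
    \<comment> \<open>The summand 1 accounts for \<open>ep\<close>, which is eventually at most 1 in
      absolute value.\<close>
    define W where "W \<omega> = (\<Sum>v\<in>UNIV. \<bar>dev n (fst (idx v)) (snd (idx v)) \<omega>\<bar> / sqrt (real n) + 1)" for \<omega>
    have iW: "integrable M W"
      unfolding W_def[abs_def] by (intro Bochner_Integration.integrable_sum Bochner_Integration.integrable_add integrable_abs_dev elim integrable_const)
    have [measurable]: "W \<in> borel_measurable M" using iW by simp
    have le: "norm (normalized_counts idx n \<omega>) \<le> W \<omega>" for \<omega>
    proof -
      have "norm (normalized_counts idx n \<omega>) \<le> (\<Sum>v\<in>UNIV. \<bar>normalized_counts idx n \<omega> $ v\<bar>)" by (rule norm_le_l1_cart)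
      also have "\<dots> \<le> W \<omega>"
        unfolding W_def
      proof (rule sum_mono)
        fix v
        show "\<bar>normalized_counts idx n \<omega> $ v\<bar> \<le> \<bar>dev n (fst (idx v)) (snd (idx v)) \<omega>\<bar> / sqrt (real n) + 1"
          unfolding normalized_counts_dev[OF elim(2)]
          using elim(1) abs_triangle_ineq[of "dev n (fst (idx v)) (snd (idx v)) \<omega> / sqrt (real n)" "ep n v"]
          by (auto simp: abs_divide intro: order.trans add_left_mono)
      qed
      finally show ?thesis .
    qed
    have "measure M {\<omega> \<in> space M. R < norm (normalized_counts idx n \<omega>)} \<le> measure M {\<omega> \<in> space M. R \<le> W \<omega>}"
      using le by (intro finite_measure_mono) (auto intro: order.trans less_imp_le, measurable)
    also have "\<dots> \<le> expectation W / R"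
      by (rule integral_Markov_inequality_measure[OF iW sets.empty_sets _ R])
        (auto simp: W_def intro!: AE_I2 sum_nonneg add_nonneg_nonneg)
    also have "expectation W \<le> D"
    proof -
      have "expectation W = (\<Sum>v\<in>UNIV. expectation (\<lambda>\<omega>. \<bar>dev n (fst (idx v)) (snd (idx v)) \<omega>\<bar> / sqrt (real n)) + 1)"
      proof -
        define X where "X v \<omega> = \<bar>dev n (fst (idx v)) (snd (idx v)) \<omega>\<bar> / sqrt (real n)" for v \<omega>
        have iX: "integrable M (X v)" for v unfolding X_def[abs_def] by (rule integrable_abs_dev[OF elim(2)])
        show ?thesis
          unfolding W_def[abs_def] X_def[symmetric] using iX by (simp add: prob_space sum.distrib)
      qed
      then show ?thesis unfolding D_def using Dv(2)[OF elim(2)] by (simp add: sum_mono)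
    qed
    also have "D / R \<le> eps" using eps D by (simp add: R_def field_simps)
    finally show ?case using R by (simp add: divide_right_mono)
  qed
  then show ?thesis by blast
qed

text \<open>With \<open>Q\<close> the inverse of \<open>K\<close>, \<open>t \<bullet> x\<close>
  equals \<open>(transpose Q *v t) \<bullet> (K n0 idx *v x)\<close>. Hence
  \<open>char_limit\<close> at \<open>transpose Q *v t\<close> is the limit at \<open>t\<close>, and
  \<open>Q\<close> appears on both sides of \<open>Sig\<close>.\<close>

lemma gaussian_limit:
  "\<exists>L. centered_gaussian (matrix_inv (K n0 idx) ** Sig n0 idx ** transpose (matrix_inv (K n0 idx))) L \<and>
    converges_in_distribution M (normalized_counts idx) L"
proof -
  define Q where "Q = matrix_inv (K n0 idx)"
  define S where "S = Q ** Sig n0 idx ** transpose Q"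
  have QK: "Q ** K n0 idx = mat 1" unfolding Q_def by (rule matrix_inv_mult_self[OF inv])
  have St: "t \<bullet> (S *v t) = (transpose Q *v t) \<bullet> (Sig n0 idx *v (transpose Q *v t))" for t
    unfolding S_def by (simp add: transpose_matrix_vector dot_lmul_matrix flip: matrix_vector_mul_assoc)
  have tK: "(transpose Q *v t) \<bullet> (K n0 idx *v x) = t \<bullet> x" for t x
    by (simp add: transpose_matrix_vector dot_lmul_matrix matrix_vector_mul_assoc QK)
  have ch: "(\<lambda>n. \<integral>\<omega>. iexp (t \<bullet> normalized_counts idx n \<omega>) \<partial>M) \<longlonglongrightarrow> of_real (exp (- (t \<bullet> (S *v t)) / 2))" for t
    using char_limit[of "transpose Q *v t"] by (simp only: tK St)
  have "psd S"
    unfolding psd_def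
  proof (intro conjI allI)
    show "transpose S = S"
      by (simp add: S_def matrix_transpose_mul Sig_symmetric matrix_mul_assoc)
    fix t
    \<comment> \<open>Positivity comes from the limit itself: characteristic functions have modulus
      at most 1, hence so does \<open>exp (- (t \<bullet> (S *v t)) / 2)\<close>.\<close>
    have "cmod (\<integral>\<omega>. iexp (t \<bullet> normalized_counts idx n \<omega>) \<partial>M) \<le> 1" for n
      by (rule order.trans[OF integral_norm_bound]) (simp add: prob_space)
    then have "cmod (of_real (exp (- (t \<bullet> (S *v t)) / 2))) \<le> 1"
      by (intro LIMSEQ_le_const2[OF tendsto_norm[OF ch]]) auto
    then have "exp (- (t \<bullet> (S *v t)) / 2) \<le> 1" by simp
    then show "0 \<le> t \<bullet> (S *v t)" by simp
  qed
  from centered_gaussian_exists[OF this] obtain L where L: "centered_gaussian S L"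
    and chL: "\<And>t. (\<integral>x. iexp (t \<bullet> x) \<partial>L) = exp (- (t \<bullet> (S *v t)) / 2)" by blast
  have "converges_in_distribution M (normalized_counts idx) L"
  proof (rule converges_in_distribution_char[OF prob_space_axioms normalized_counts_measurable])
    show "prob_space L" "sets L = sets borel" using L by (auto simp: centered_gaussian_def)
    show "(\<lambda>n. \<integral>\<omega>. iexp (t \<bullet> normalized_counts idx n \<omega>) \<partial>M) \<longlonglongrightarrow> (\<integral>x. iexp (t \<bullet> x) \<partial>L)" for t
      unfolding chL by (rule ch)
    show "\<exists>R. \<forall>\<^sub>F n in sequentially. measure M {\<omega> \<in> space M. R < norm (normalized_counts idx n \<omega>)} \<le> e" if "e > 0" for e
      by (rule tight_counts[OF that])
  qed
  then show ?thesis using L unfolding S_def Q_def by blast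
qed

lemma V_limit_idx:
  "AE \<omega> in M. (\<lambda>n. V n0 Imax Omax (fst (idx u)) (snd (idx u)) (fst (idx v)) (snd (idx v)) n \<omega>) \<longlonglongrightarrow> Sig n0 idx $ u $ v"
  using V_limit[OF n0 g_nonzero[of u] g_nonzero[of v]] by (simp add: Sig_def case_prod_unfold)

end

end

theorem theorem3p1:
  fixes M :: "'w measure"
    and \<alpha> \<gamma> lam mu :: real
    and G :: "nat \<Rightarrow> 'w \<Rightarrow> nat pair_pre_digraph"
    and Imax Omax n0 :: nat
    and idx :: "'n::finite \<Rightarrow> nat \<times> nat"
  defines "K \<equiv> directed_pa.K \<alpha> \<gamma> lam mu n0 idx"
    and "Sig \<equiv> directed_pa.Sig M \<alpha> \<gamma> lam mu G n0 idx"
  assumes model: "directed_pa M \<alpha> \<gamma> lam mu G"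
    and positive: "1 \<le> Imax" "1 \<le> Omax" "1 \<le> n0"
    and idx: "bij_betw idx UNIV ({0..Imax} \<times> {0..Omax})"
    and K_inv: "invertible K"
  shows "(\<exists>N. centered_gaussian (matrix_inv K ** Sig ** transpose (matrix_inv K)) N \<and>
              converges_in_distribution M (directed_pa.normalized_counts M G idx) N) \<and>
         (\<forall>u v. AE \<omega> in M.
            (\<lambda>n. directed_pa.V M \<alpha> \<gamma> lam mu G n0 Imax Omax
                   (fst (idx u)) (snd (idx u)) (fst (idx v)) (snd (idx v)) n \<omega>)
              \<longlonglongrightarrow> Sig $ u $ v)"
proof -
  \<comment> \<open>Saved before the interpretation, which introduces the locale's own
    \<open>K_def\<close> and \<open>Sig_def\<close> under the same names.\<close>
  note K_eq = K_def and Sig_eq = Sig_def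
  note inv = K_inv[unfolded K_def]
  interpret directed_pa M \<alpha> \<gamma> lam mu G by (rule model)
  show ?thesis
    unfolding K_eq Sig_eq
    using gaussian_limit[OF positive(3) idx inv] V_limit_idx[OF positive(3) idx inv] by blast
qed

end
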